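(* Let $\Sigma$ be an alphabet of constant size $\sigma=\mathcal{O}(1)$. Consider the problem \textsc{ApproximateCircularStringMatching}: given a pattern $x\in\Sigma^m$, a text $t\in\Sigma^n$ with $n>m$, and an integer threshold $k<m$, output all factors $u$ of $t$ such that $\delta_E(u,x^i)\le k$ for some $0\le i<m$, where $x^i=x[i\mathinner{.\,.} m-1]x[0\mathinner{.\,.} i-1]$ is the $i$-th rotation of $x$ ($x^0=x$). Assuming each letter of $t$ is drawn independently and uniformly at random from $\Sigma$, and that the error ratio satisfies $k/m<\frac12-\mathcal{O}(1/\sqrt{\sigma})$, this problem can be solved in average-case search time $\mathcal{O}(n(k+\log_\sigma m)/m)$, which is optimal.
   Context: $\delta_E(u,v)$ denotes the edit distance: the minimum number of insertions, deletions and substitutions (each of cost 1) needed to transform one string into the other. A factor of $t$ is a contiguous substring $t[a\mathinner{.\,.} b]$. "Search time" excludes the preprocessing of the pattern. Optimality refers to the known average-case lower bound $\Omega(n(k+\log_\sigma m)/m)$ for approximate string matching under edit distance, which also applies to the circular version. *)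

theory Defs
  imports "HOL-Probability.Probability"
begin

section \<open>Edit distance and circular occurrences\<close>

inductive edit_step :: "'a list \<Rightarrow> 'a list \<Rightarrow> bool" where
  insertion: "edit_step (u @ v) (u @ [a] @ v)"
| deletion: "edit_step (u @ [a] @ v) (u @ v)"
| substitution: "edit_step (u @ [a] @ v) (u @ [b] @ v)"

definition edit_distance :: "'a list \<Rightarrow> 'a list \<Rightarrow> nat" where
  "edit_distance u v = (LEAST d. (edit_step ^^ d) u v)"

lemma edit_steps_exist: "\<exists>d. (edit_step ^^ d) u v"
proof -
  have del: "edit_step\<^sup>*\<^sup>* w []" for w :: "'a list"
  proof (induction w)
    case (Cons a w)
    have "edit_step (a # w) w" using deletion[of "[]" a w] by simp
    then show ?case using Cons by (rule converse_rtranclp_into_rtranclp)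
  qed simp
  have ins: "edit_step\<^sup>*\<^sup>* [] w" for w :: "'a list"
  proof (induction w)
    case (Cons a w)
    have "edit_step w (a # w)" using insertion[of "[]" w a] by simp
    with Cons show ?case by (rule rtranclp.rtrancl_into_rtrancl)
  qed simp
  show ?thesis
    using rtranclp_trans[OF del ins] by (simp add: rtranclp_power)
qed

definition factor :: "'a list \<Rightarrow> nat \<Rightarrow> nat \<Rightarrow> 'a list" where
  "factor t a b = take (b + 1 - a) (drop a t)"

text \<open>Factors of the text are reported by position, as pairs \<open>(a, b)\<close> of inclusive end
  points. The empty factor is not representable, but for \<open>k < length x\<close> its distance to every
  rotation of \<open>x\<close> exceeds \<open>k\<close>.
  The library function \<open>rotate i x\<close> is \<open>drop i x @ take i x\<close> for \<open>i < length x\<close>.\<close>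

definition circular_occurrences :: "nat \<Rightarrow> 'a list \<Rightarrow> 'a list \<Rightarrow> (nat \<times> nat) set" where
  "circular_occurrences k x t =
     {(a, b). a \<le> b \<and> b < length t \<and>
        (\<exists>i < length x. edit_distance (factor t a b) (rotate i x) \<le> k)}"


section \<open>A word RAM\<close>

text \<open>Programs work on registers, on a random access memory and on a read-only input string
  with random access. Letters, register and memory contents and addresses are machine words,
  i.e.\ numbers below a bound \<open>W\<close>. A step that produces a number \<open>\<ge> W\<close> or reads the
  input beyond its end has no successor state, so a terminating execution never overflows; the
  bound affects neither the result nor the running time of an execution.\<close>

datatype binop = Plus | Minus | Times | Div | Mod | Less | Equals

datatype rexp =
    Const nat
  | Input_Length
  | Reg nat
  | Mem rexp
  | Input rexp
  | Binop binop rexp rexp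

datatype com =
    Skip
  | Assign nat rexp
  | Store rexp rexp  \<comment> \<open>address, value\<close>
  | Emit rexp rexp  \<comment> \<open>report a pair as part of the output\<close>
  | Seq com com
  | Cond rexp com com
  | While rexp com

record state =
  regs :: "nat \<Rightarrow> nat"
  memory :: "nat \<Rightarrow> nat"
  emitted :: "(nat \<times> nat) list"

fun apply_binop :: "binop \<Rightarrow> nat \<Rightarrow> nat \<Rightarrow> nat" where
  "apply_binop Plus a b = a + b"
| "apply_binop Minus a b = a - b"
| "apply_binop Times a b = a * b"
| "apply_binop Div a b = a div b"
| "apply_binop Mod a b = a mod b"
| "apply_binop Less a b = of_bool (a < b)"
| "apply_binop Equals a b = of_bool (a = b)"

definition word :: "nat \<Rightarrow> nat \<Rightarrow> nat option" where
  "word W v = (if v < W then Some v else None)"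

primrec rval :: "nat \<Rightarrow> nat list \<Rightarrow> state \<Rightarrow> rexp \<Rightarrow> nat option" where
  "rval W inp s (Const c) = word W c"
| "rval W inp s Input_Length = word W (length inp)"
| "rval W inp s (Reg r) = word W (regs s r)"
| "rval W inp s (Mem e) = Option.bind (rval W inp s e) (\<lambda>a. word W (memory s a))"
| "rval W inp s (Input e) =
     Option.bind (rval W inp s e) (\<lambda>a. if a < length inp then word W (inp ! a) else None)"
| "rval W inp s (Binop f e1 e2) =
     Option.bind (rval W inp s e1) (\<lambda>a.
     Option.bind (rval W inp s e2) (\<lambda>b. word W (apply_binop f a b)))"

text \<open>Every node of an expression, hence every access to memory or input and every arithmetic
  operation, costs one time unit; so does every execution of a command or loop test.\<close>

primrec rcost :: "rexp \<Rightarrow> nat" where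
  "rcost (Const c) = 1"
| "rcost Input_Length = 1"
| "rcost (Reg r) = 1"
| "rcost (Mem e) = 1 + rcost e"
| "rcost (Input e) = 1 + rcost e"
| "rcost (Binop f e1 e2) = 1 + rcost e1 + rcost e2"

text \<open>\<open>exec W inp c s T s'\<close>: started in \<open>s\<close> on input \<open>inp\<close>, the program \<open>c\<close> terminates in
  \<open>s'\<close> after \<open>T\<close> time units.\<close>

inductive exec :: "nat \<Rightarrow> nat list \<Rightarrow> com \<Rightarrow> state \<Rightarrow> nat \<Rightarrow> state \<Rightarrow> bool"
  for W :: nat and inp :: "nat list" where
  Skip: "exec W inp Skip s 1 s"
| Assign: "rval W inp s e = Some v \<Longrightarrow>
    exec W inp (Assign r e) s (1 + rcost e) (s\<lparr>regs := (regs s)(r := v)\<rparr>)"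
| Store: "rval W inp s e1 = Some a \<Longrightarrow> rval W inp s e2 = Some v \<Longrightarrow>
    exec W inp (Store e1 e2) s (1 + rcost e1 + rcost e2)
      (s\<lparr>memory := (memory s)(a := v)\<rparr>)"
| Emit: "rval W inp s e1 = Some a \<Longrightarrow> rval W inp s e2 = Some b \<Longrightarrow>
    exec W inp (Emit e1 e2) s (1 + rcost e1 + rcost e2)
      (s\<lparr>emitted := (a, b) # emitted s\<rparr>)"
| Seq: "exec W inp c1 s T1 s1 \<Longrightarrow> exec W inp c2 s1 T2 s2 \<Longrightarrow>
    exec W inp (Seq c1 c2) s (1 + T1 + T2) s2"
| Cond_True: "rval W inp s e = Some v \<Longrightarrow> v \<noteq> 0 \<Longrightarrow> exec W inp c1 s T s' \<Longrightarrow>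
    exec W inp (Cond e c1 c2) s (1 + rcost e + T) s'"
| Cond_False: "rval W inp s e = Some 0 \<Longrightarrow> exec W inp c2 s T s' \<Longrightarrow>
    exec W inp (Cond e c1 c2) s (1 + rcost e + T) s'"
| While_False: "rval W inp s e = Some 0 \<Longrightarrow>
    exec W inp (While e c) s (1 + rcost e) s"
| While_True: "rval W inp s e = Some v \<Longrightarrow> v \<noteq> 0 \<Longrightarrow> exec W inp c s T1 s1 \<Longrightarrow>
    exec W inp (While e c) s1 T2 s2 \<Longrightarrow>
    exec W inp (While e c) s (1 + rcost e + T1 + T2) s2"

inductive_cases SkipE: "exec W inp Skip s T s'"
inductive_cases AssignE: "exec W inp (Assign r e) s T s'"
inductive_cases StoreE: "exec W inp (Store e1 e2) s T s'"
inductive_cases EmitE: "exec W inp (Emit e1 e2) s T s'"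
inductive_cases SeqE: "exec W inp (Seq c1 c2) s T s'"
inductive_cases CondE: "exec W inp (Cond e c1 c2) s T s'"
inductive_cases WhileE: "exec W inp (While e c) s T s'"

lemma exec_deterministic:
  "exec W inp c s T s' \<Longrightarrow> exec W inp c s T' s'' \<Longrightarrow> T' = T \<and> s'' = s'"
proof (induction arbitrary: T' s'' rule: exec.induct)
  case (Seq c1 s T1 s1 c2 T2 s2)
  from Seq.prems obtain U1 r U2 where
    "T' = Suc (U1 + U2)" "exec W inp c1 s U1 r" "exec W inp c2 r U2 s''"
    by (rule SeqE)
  with Seq.IH(1)[of U1 r] Seq.IH(2)[of U2 s''] show ?case by simp
next
  case (Cond_True s e v c1 T s' c2)
  from Cond_True.prems obtain U where "T' = Suc (rcost e + U)" "exec W inp c1 s U s''"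
    using Cond_True.hyps by (auto elim: CondE)
  with Cond_True.IH[of U s''] show ?case by simp
next
  case (Cond_False s e c2 T s' c1)
  from Cond_False.prems obtain U where "T' = Suc (rcost e + U)" "exec W inp c2 s U s''"
    using Cond_False.hyps by (auto elim: CondE)
  with Cond_False.IH[of U s''] show ?case by simp
next
  case (While_False s e c)
  from While_False.prems show ?case
    by (rule WhileE) (simp_all add: While_False.hyps)
next
  case (While_True s e v c T1 s1 T2 s2)
  from While_True.prems obtain U1 r U2 where
    "T' = Suc (rcost e + U1 + U2)" "exec W inp c s U1 r" "exec W inp (While e c) r U2 s''"
    by (rule WhileE) (use While_True.hyps in simp_all)
  with While_True.IH(1)[of U1 r] While_True.IH(2)[of U2 s''] show ?case by simp
next
  case (Skip s)
  then show ?case by (rule SkipE) simp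
next
  case (Assign s e v r)
  from Assign.prems show ?case by (rule AssignE) (simp add: Assign.hyps)
next
  case (Store s e1 a e2 v)
  from Store.prems show ?case by (rule StoreE) (simp add: Store.hyps)
next
  case (Emit s e1 a e2 b)
  from Emit.prems show ?case by (rule EmitE) (simp add: Emit.hyps)
qed


section \<open>Approximate circular string matching\<close>

text \<open>The preprocessing runs on the pattern, with the threshold in register 0. The search then
  starts from the registers and the memory left behind, and its input is the text only. Both use
  words of \<open>O(log n)\<close> bits, \<open>n\<close> being the text length.\<close>

record algorithm =
  preprocess :: com
  search :: com
  word_exponent :: nat

definition initial_state :: "nat \<Rightarrow> state" where
  "initial_state k = \<lparr>regs = (\<lambda>_. 0)(0 := k), memory = (\<lambda>_. 0), emitted = []\<rparr>"

definition run_search :: "algorithm \<Rightarrow> nat \<Rightarrow> nat list \<Rightarrow> nat list \<Rightarrow> nat \<Rightarrow> state \<Rightarrow> bool" where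
  "run_search A k x t T s' \<longleftrightarrow>
     (let W = (length t + 2) ^ word_exponent A in
      \<exists>T0 s0. exec W x (preprocess A) (initial_state k) T0 s0 \<and>
              exec W t (search A) (s0\<lparr>emitted := []\<rparr>) T s')"

lemma run_search_deterministic:
  "run_search A k x t T s' \<Longrightarrow> run_search A k x t T' s'' \<Longrightarrow> T' = T \<and> s'' = s'"
  unfolding run_search_def Let_def by (metis exec_deterministic)

text \<open>The alphabet of size \<open>\<sigma>\<close> is \<open>{..<\<sigma>}\<close>.\<close>

definition strings :: "nat \<Rightarrow> nat \<Rightarrow> nat list set" where
  "strings \<sigma> n = {w. length w = n \<and> set w \<subseteq> {..<\<sigma>}}"

definition solves_ACSM :: "nat \<Rightarrow> algorithm \<Rightarrow> bool" where
  "solves_ACSM \<sigma> A \<longleftrightarrow>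
     (\<forall>n m k. \<forall>x \<in> strings \<sigma> m. \<forall>t \<in> strings \<sigma> n. k < m \<longrightarrow> m < n \<longrightarrow>
        (\<exists>T s'. run_search A k x t T s' \<and>
                set (emitted s') = circular_occurrences k x t))"

definition search_time :: "algorithm \<Rightarrow> nat \<Rightarrow> nat list \<Rightarrow> nat list \<Rightarrow> nat" where
  "search_time A k x t = (THE T. \<exists>s'. run_search A k x t T s')"

lemma search_time_eq: "run_search A k x t T s' \<Longrightarrow> search_time A k x t = T"
  unfolding search_time_def using run_search_deterministic by blast

definition average_search_time :: "nat \<Rightarrow> algorithm \<Rightarrow> nat \<Rightarrow> nat list \<Rightarrow> nat \<Rightarrow> real" where
  "average_search_time \<sigma> A k x n =
     measure_pmf.expectation (replicate_pmf n (pmf_of_set {..<\<sigma>}))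
       (\<lambda>t. real (search_time A k x t))"

end

theory Submission
  imports Defs "HOL-Library.Sublist" "HOL-Real_Asymp.Real_Asymp"
begin

text \<open>Upper bound. Let \<open>w = m - k\<close>, the least length of an occurrence. Cut the text into windows
  whose distance (the stride) is chosen such that every occurrence starting between two
  consecutive window positions contains a fixed block of \<open>q\<close> consecutive grams of length \<open>l\<close>.
  An occurrence leaves one of these grams with edit distance at most \<open>\<tau>\<close> to a circular factor of
  the pattern, provided \<open>q (\<tau> + 1) > k\<close>; the grams with this property are tabulated in the
  preprocessing. With \<open>l\<close> a constant multiple of the logarithm of \<open>m\<close> and
  \<open>\<tau> = l (1 - O(1 / sqrt \<sigma>))\<close>, a random gram is bad with probability at most \<open>m\<^sup>-\<^sup>1\<^sup>1\<close>, since it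
  would share a long common subsequence with the pattern; hence the brute force verification of a
  window does not matter on average, and \<open>k / m < 1 / 2 - O(1 / sqrt \<sigma>)\<close> leaves a stride linear in \<open>m\<close>.

  Lower bound. A terminating search determines its output from the letters that it reads, so it has to read
  more than \<open>r\<close> letters of every window of length \<open>m\<close> if no \<open>r\<close> letters decide whether the window
  is an occurrence. For a unary pattern this holds with \<open>r = k\<close>, and for a random pattern with \<open>r\<close>
  proportional to \<open>log m\<close>: any \<open>r\<close> letters of a window agree with some rotation.\<close>

section \<open>Edit distance\<close>

text \<open>The \<open>1 / sqrt \<sigma>\<close> comes from one count. For each start, at most
  \<open>(2 l choose e) (l choose e) \<sigma> ^ (l - e)\<close> grams share
  \<open>e = l - \<tau>\<close> letters with the circular factor of length \<open>2 l\<close>, a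
  fraction of at most \<open>(18 l^2 / (e^2 \<sigma>)) ^ e\<close>. If \<open>e / l\<close> is at
  least \<open>6 / sqrt \<sigma>\<close>, this is at most \<open>2 ^ - e\<close>, so
  \<open>\<tau> / l\<close> may be about \<open>1 - 6 / sqrt \<sigma>\<close>. The block takes about
  \<open>k l / \<tau>\<close> letters, and fitting it into \<open>m - k\<close> forces
  \<open>k\<close> below about \<open>m / 2\<close>.

  Gram length and \<open>\<tau>\<close> are fixed multiples of an integer logarithm of
  \<open>m\<close>: one program serves all \<open>m\<close>, and a table of polynomial size keeps
  addresses within words of \<open>O(log n)\<close> bits. For short patterns the block may not fit;
  then every window is verified at a cost that the constant absorbs.

  In the lower bound only reads of the text count. Preprocessing may leave any information about the
  pattern, so the argument alters the text and never the pattern. It bounds the time on every single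
  text, hence also the average.\<close>

fun lev :: "'a list \<Rightarrow> 'a list \<Rightarrow> nat" where
  "lev [] v = length v"
| "lev (a # u) [] = Suc (length u)"
| "lev (a # u) (b # v) =
     min (Suc (lev u (b # v))) (min (Suc (lev (a # u) v)) (lev u v + of_bool (a \<noteq> b)))"

lemma lev_Nil2 [simp]: "lev u [] = length u"
  by (cases u) auto

lemma lev_Cons_left: "lev (a # u) w \<le> Suc (lev u w)"
  by (cases w) auto

lemma lev_Cons_right: "lev u (b # w) \<le> Suc (lev u w)"
  by (cases u) auto

lemma lev_le_Cons_left: "lev u w \<le> Suc (lev (a # u) w)"
proof (induction w)
  case (Cons b w)
  then show ?case using lev_Cons_right[of u b w] by auto
qed simp

lemma lev_subst_left: "lev (a # u) w \<le> Suc (lev (b # u) w)"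
  by (induction w) auto

text \<open>A discrepancy of one between two tails survives a common first letter. Iterated, this
  reduces an edit inside a string to an edit at its front.\<close>

lemma lev_cong_Cons:
  assumes "\<And>w. lev u w \<le> Suc (lev u' w)"
  shows "lev (c # u) w \<le> Suc (lev (c # u') w)"
proof (induction w)
  case Nil
  show ?case using assms[of "[]"] by simp
next
  case (Cons b w)
  then show ?case using assms[of "b # w"] assms[of w] by auto
qed

lemma lev_cong_append:
  assumes "\<And>w. lev u w \<le> Suc (lev u' w)"
  shows "lev (p @ u) w \<le> Suc (lev (p @ u') w)"
  using assms
proof (induction p arbitrary: w)
  case (Cons c p)
  show ?case using lev_cong_Cons[of "p @ u" "p @ u'" c w] Cons by simp
qed simp

text \<open>The target \<open>w\<close> is arbitrary: an edit at the front changes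
  \<open>lev\<close> by at most one, and \<open>lev_cong_append\<close> moves it behind a common
  prefix. Chaining such steps shows that no edit sequence is shorter than
  \<open>lev\<close>.\<close>

lemma lev_edit_step: "edit_step u v \<Longrightarrow> lev u w \<le> Suc (lev v w)"
proof (induction rule: edit_step.induct)
  case (insertion p q a)
  show ?case using lev_cong_append[OF lev_le_Cons_left] by simp
next
  case (deletion p a q)
  show ?case using lev_cong_append[OF lev_Cons_left] by simp
next
  case (substitution p a q b)
  show ?case using lev_cong_append[OF lev_subst_left] by simp
qed

lemma lev_self [simp]: "lev u u = 0"
  by (induction u) auto

lemma lev_le_edit_steps: "(edit_step ^^ d) u v \<Longrightarrow> lev u v \<le> d"
proof (induction d arbitrary: u)
  case (Suc d)
  then obtain u' where "edit_step u u'" "(edit_step ^^ d) u' v"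
    by (metis relpowp_Suc_E2)
  then show ?case using Suc.IH[of u'] lev_edit_step[of u u' v] by simp
qed simp

lemma edit_step_Cons: "edit_step u v \<Longrightarrow> edit_step (a # u) (a # v)"
proof (induction rule: edit_step.induct)
  case (insertion p q b)
  then show ?case using edit_step.insertion[of "a # p" q b] by simp
next
  case (deletion p b q)
  then show ?case using edit_step.deletion[of "a # p" b q] by simp
next
  case (substitution p b q c)
  then show ?case using edit_step.substitution[of "a # p" b q c] by simp
qed

lemma edit_steps_Cons: "(edit_step ^^ d) u v \<Longrightarrow> (edit_step ^^ d) (a # u) (a # v)"
  by (induction d arbitrary: v) (auto intro: edit_step_Cons)

text \<open>Names the branch in which the minimum is attained, for inductions along an optimal
  alignment.\<close>

lemma lev_Cons_cases:
  fixes a b :: 'a and u v :: "'a list"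
  obtains (delete) "lev (a # u) (b # v) = Suc (lev u (b # v))"
    | (insert) "lev (a # u) (b # v) = Suc (lev (a # u) v)"
    | (substitute) "lev (a # u) (b # v) = Suc (lev u v)"
    | (keep) "lev (a # u) (b # v) = lev u v" "a = b"
proof -
  have "lev (a # u) (b # v) = Suc (lev u (b # v)) \<or> lev (a # u) (b # v) = Suc (lev (a # u) v) \<or>
      lev (a # u) (b # v) = lev u v + of_bool (a \<noteq> b)"
    unfolding lev.simps min_def by presburger
  then show thesis using that by (cases "a = b") auto
qed

lemma edit_steps_lev: "(edit_step ^^ lev u v) u v"
proof (induction u v rule: lev.induct)
  case (1 v)
  show ?case
  proof (induction v)
    case (Cons b v)
    have "edit_step [] [b]" using insertion[of "[]" "[]" b] by simp
    with edit_steps_Cons[OF Cons, of b] show ?case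
      by (simp add: relpowp_Suc_I2 del: relpowp.simps)
  qed simp
next
  case (2 a u)
  have "(edit_step ^^ length w) w []" for w :: "'a list"
  proof (induction w)
    case (Cons b w)
    have "edit_step (b # w) w" using deletion[of "[]" b w] by simp
    from relpowp_Suc_I2[OF this Cons] show ?case by simp
  qed simp
  from this[of "a # u"] show ?case by simp
next
  case (3 a u b v)
  have del: "edit_step (a # u) u" using deletion[of "[]" a u] by simp
  have ins: "edit_step v (b # v)" using insertion[of "[]" v b] by simp
  have sub: "edit_step (a # v) (b # v)" using substitution[of "[]" a v b] by simp
  show ?case
  proof (cases a u b v rule: lev_Cons_cases)
    case delete
    show ?thesis unfolding delete by (rule relpowp_Suc_I2[OF del "3.IH"(1)])
  next
    case insert
    show ?thesis unfolding insert by (rule relpowp_Suc_I[OF "3.IH"(2) ins])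
  next
    case substitute
    show ?thesis unfolding substitute by (rule relpowp_Suc_I[OF edit_steps_Cons[OF "3.IH"(3)] sub])
  next
    case keep
    show ?thesis unfolding keep(1) using edit_steps_Cons[OF "3.IH"(3), of b] keep(2) by simp
  qed
qed

lemma edit_distance_eq_lev: "edit_distance u v = lev u v"
  unfolding edit_distance_def
  by (intro Least_equality edit_steps_lev lev_le_edit_steps)

text \<open>An optimal alignment of \<open>u1 @ u2\<close> with \<open>y\<close> cuts
  \<open>y\<close> where \<open>u1\<close> ends, and its cost is the sum of both sides. Applied
  repeatedly, this charges the grams of a block separately.\<close>

lemma lev_split:
  "\<exists>y1 y2. y = y1 @ y2 \<and> lev u1 y1 + lev u2 y2 \<le> lev (u1 @ u2) y"
proof (induction u1 y rule: lev.induct)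
  case (1 v)
  show ?case by (intro exI[of _ "[]"] exI[of _ v]) simp
next
  case (2 a u)
  show ?case by simp
next
  case (3 a u b v)
  show ?case
  proof (cases a "u @ u2" b v rule: lev_Cons_cases)
    case delete
    with "3.IH"(1) obtain y1 y2 where
      "b # v = y1 @ y2" "lev u y1 + lev u2 y2 \<le> lev (u @ u2) (b # v)" by blast
    then show ?thesis using delete lev_Cons_left[of a u y1]
      by - (rule exI[of _ y1], rule exI[of _ y2], auto)
  next
    case insert
    with "3.IH"(2) obtain y1 y2 where
      "v = y1 @ y2" "lev (a # u) y1 + lev u2 y2 \<le> lev ((a # u) @ u2) v" by blast
    then show ?thesis using insert lev_Cons_right[of "a # u" b y1]
      by - (rule exI[of _ "b # y1"], rule exI[of _ y2], auto)
  next
    case substitute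
    with "3.IH"(3) obtain y1 y2 where
      "v = y1 @ y2" "lev u y1 + lev u2 y2 \<le> lev (u @ u2) v" by blast
    then show ?thesis using substitute
      by - (rule exI[of _ "b # y1"], rule exI[of _ y2], auto)
  next
    case keep
    with "3.IH"(3) obtain y1 y2 where
      "v = y1 @ y2" "lev u y1 + lev u2 y2 \<le> lev (u @ u2) v" by blast
    then show ?thesis using keep
      by - (rule exI[of _ "b # y1"], rule exI[of _ y2], auto)
  qed
qed

lemma length_le_lev1: "length u \<le> length v + lev u v"
  by (induction u v rule: lev.induct) auto

lemma length_le_lev2: "length v \<le> length u + lev u v"
  by (induction u v rule: lev.induct) auto

text \<open>The letters of \<open>u\<close> that an optimal alignment keeps form \<open>w\<close>;
  every other letter of \<open>u\<close> costs one edit. This turns closeness into a property that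
  can be counted.\<close>

lemma lev_common_subseq: "\<exists>w. subseq w u \<and> subseq w v \<and> length u \<le> length w + lev u v"
proof (induction u v rule: lev.induct)
  case (1 v)
  show ?case by (intro exI[of _ "[]"]) simp
next
  case (2 a u)
  show ?case by (intro exI[of _ "[]"]) simp
next
  case (3 a u b v)
  show ?case
  proof (cases a u b v rule: lev_Cons_cases)
    case delete
    with "3.IH"(1) obtain w where "subseq w u" "subseq w (b # v)"
      "length u \<le> length w + lev u (b # v)" by blast
    with delete show ?thesis by (intro exI[of _ w]) auto
  next
    case insert
    with "3.IH"(2) obtain w where "subseq w (a # u)" "subseq w v"
      "length (a # u) \<le> length w + lev (a # u) v" by blast
    with insert show ?thesis by (intro exI[of _ w]) auto
  next
    case substitute
    with "3.IH"(3) obtain w where "subseq w u" "subseq w v" "length u \<le> length w + lev u v" by blast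
    with substitute show ?thesis by (intro exI[of _ w]) auto
  next
    case keep
    with "3.IH"(3) obtain w where "subseq w u" "subseq w v" "length u \<le> length w + lev u v" by blast
    with keep show ?thesis by (intro exI[of _ "a # w"]) auto
  qed
qed

lemma lev_le_mismatches:
  assumes "length u = length v"
  shows "lev u v \<le> card {i. i < length u \<and> u ! i \<noteq> v ! i}"
  using assms
proof (induction u v rule: list_induct2)
  case (Cons a u b v)
  have "{i. i < length (a # u) \<and> (a # u) ! i \<noteq> (b # v) ! i} =
      (if a = b then {} else {0}) \<union> Suc ` {i. i < length u \<and> u ! i \<noteq> v ! i}" (is "?l = ?r")
    by (auto simp: image_iff less_Suc_eq_0_disj)
  moreover have "card ?r = of_bool (a \<noteq> b) + card {i. i < length u \<and> u ! i \<noteq> v ! i}"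
    by (subst card_Un_disjoint) (auto simp: card_image)
  ultimately show ?case using Cons.IH by simp
qed simp

text \<open>One edit changes the number of letters satisfying \<open>P\<close> by at most one. Such
  numbers are invariant under rotation, so they bound the distance to all rotations at once.\<close>

lemma filter_length_le_lev:
  "length (filter P v) \<le> length (filter P u) + lev u v"
  by (induction u v rule: lev.induct) (auto simp: le_Suc_eq intro: le_SucI)

section \<open>The lower bound\<close>

text \<open>A certificate in the sense of decision trees: the letters at \<open>R\<close> force
  \<open>P\<close>. The length is fixed because a program obtains \<open>Input_Length\<close>
  without reading a letter and the word size depends on the text length.\<close>

definition certifies :: "nat set \<Rightarrow> nat \<Rightarrow> nat list \<Rightarrow> (nat list \<Rightarrow> bool) \<Rightarrow> bool" where
  "certifies R T inp P \<longleftrightarrow> finite R \<and> card R \<le> T \<and>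
     (\<forall>inp'. length inp' = length inp \<longrightarrow> (\<forall>i\<in>R. inp' ! i = inp ! i) \<longrightarrow> P inp')"

lemma certifies_mono:
  assumes "certifies R1 T1 inp P1" "T1 \<le> T" "\<And>inp'. P1 inp' \<Longrightarrow> P inp'"
  shows "\<exists>R. certifies R T inp P"
proof (rule exI[of _ R1])
  show "certifies R1 T inp P" using assms
    unfolding certifies_def by simp
qed

lemma certifies_conj:
  assumes "certifies R1 T1 inp P1" "certifies R2 T2 inp P2" "T1 + T2 \<le> T"
    "\<And>inp'. P1 inp' \<Longrightarrow> P2 inp' \<Longrightarrow> P inp'"
  shows "\<exists>R. certifies R T inp P"
proof -
  have "card (R1 \<union> R2) \<le> T"
    using assms(1-3) card_Un_le[of R1 R2] unfolding certifies_def by simp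
  then show ?thesis using assms(1,2,4) unfolding certifies_def
    by (intro exI[of _ "R1 \<union> R2"]) auto
qed

lemma certifies_rval: "\<exists>R. certifies R (rcost e) inp (\<lambda>inp'. rval W inp' s e = rval W inp s e)"
proof (induction e)
  case (Mem e)
  then obtain R where "certifies R (rcost e) inp (\<lambda>inp'. rval W inp' s e = rval W inp s e)" by blast
  then show ?case by (rule certifies_mono) simp_all
next
  case (Input e)
  then obtain R where R: "certifies R (rcost e) inp (\<lambda>inp'. rval W inp' s e = rval W inp s e)" by blast
  show ?case
  proof (cases "rval W inp s e")
    case None
    show ?thesis by (rule certifies_mono[OF R]) (simp_all add: None)
  next
    case (Some a)
    \<comment> \<open>The time unit of the \<open>Input\<close> node pays for the additional
      position.\<close>
    have "certifies {a} 1 inp (\<lambda>inp'. length inp' = length inp \<and> inp' ! a = inp ! a)"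
      by (simp add: certifies_def)
    with R show ?thesis by (rule certifies_conj) (simp_all add: Some)
  qed
next
  case (Binop f e1 e2)
  from Binop(1) obtain R1 where "certifies R1 (rcost e1) inp (\<lambda>inp'. rval W inp' s e1 = rval W inp s e1)"
    by blast
  moreover from Binop(2) obtain R2 where
    "certifies R2 (rcost e2) inp (\<lambda>inp'. rval W inp' s e2 = rval W inp s e2)"
    by blast
  ultimately show ?case by (rule certifies_conj) simp_all
next
  case Input_Length
  show ?case by (rule exI[of _ "{}"]) (simp add: certifies_def)
next
  case (Const c)
  show ?case by (rule exI[of _ "{}"]) (simp add: certifies_def)
next
  case (Reg r)
  show ?case by (rule exI[of _ "{}"]) (simp add: certifies_def)
qed

text \<open>Each letter read costs a time unit, and the execution depends on the input only through
  its length and the letters read. Inputs agreeing on these positions therefore run alike, with the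
  same time and final state.\<close>

lemma exec_reads:
  "exec W inp c s T s' \<Longrightarrow> \<exists>R. certifies R T inp (\<lambda>inp'. exec W inp' c s T s')"
proof (induction rule: exec.induct)
  case (Skip s)
  show ?case by (rule exI[of _ "{}"]) (simp add: certifies_def exec.Skip[simplified])
next
  case (Assign s e v r)
  obtain R where "certifies R (rcost e) inp (\<lambda>inp'. rval W inp' s e = rval W inp s e)"
    using certifies_rval by blast
  then show ?case by (rule certifies_mono) (simp, rule exec.Assign, simp add: Assign)
next
  case (Store s e1 a e2 v)
  obtain R1 where "certifies R1 (rcost e1) inp (\<lambda>inp'. rval W inp' s e1 = rval W inp s e1)"
    using certifies_rval by blast
  moreover obtain R2 where "certifies R2 (rcost e2) inp (\<lambda>inp'. rval W inp' s e2 = rval W inp s e2)"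
    using certifies_rval by blast
  ultimately show ?case by (rule certifies_conj) (simp, rule exec.Store, simp_all add: Store)
next
  case (Emit s e1 a e2 v)
  obtain R1 where "certifies R1 (rcost e1) inp (\<lambda>inp'. rval W inp' s e1 = rval W inp s e1)"
    using certifies_rval by blast
  moreover obtain R2 where "certifies R2 (rcost e2) inp (\<lambda>inp'. rval W inp' s e2 = rval W inp s e2)"
    using certifies_rval by blast
  ultimately show ?case by (rule certifies_conj) (simp, rule exec.Emit, simp_all add: Emit)
next
  case (Seq c1 s T1 s1 c2 T2 s2)
  from Seq.IH obtain R1 R2 where "certifies R1 T1 inp (\<lambda>inp'. exec W inp' c1 s T1 s1)"
    "certifies R2 T2 inp (\<lambda>inp'. exec W inp' c2 s1 T2 s2)" by blast
  then show ?case by (rule certifies_conj) (simp, erule (1) exec.Seq)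
next
  case (Cond_True s e v c1 T s' c2)
  obtain R1 where R1: "certifies R1 (rcost e) inp (\<lambda>inp'. rval W inp' s e = rval W inp s e)"
    using certifies_rval by blast
  from Cond_True.IH obtain R2 where "certifies R2 T inp (\<lambda>inp'. exec W inp' c1 s T s')" by blast
  with R1 show ?case
    by (rule certifies_conj) (simp, rule exec.Cond_True, use Cond_True.hyps(1,2) in simp_all)
next
  case (Cond_False s e c2 T s' c1)
  obtain R1 where R1: "certifies R1 (rcost e) inp (\<lambda>inp'. rval W inp' s e = rval W inp s e)"
    using certifies_rval by blast
  from Cond_False.IH obtain R2 where "certifies R2 T inp (\<lambda>inp'. exec W inp' c2 s T s')" by blast
  with R1 show ?case
    by (rule certifies_conj) (simp, rule exec.Cond_False, simp_all add: Cond_False.hyps(1))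
next
  case (While_False s e c)
  obtain R1 where "certifies R1 (rcost e) inp (\<lambda>inp'. rval W inp' s e = rval W inp s e)"
    using certifies_rval by blast
  then show ?case by (rule certifies_mono) (simp, rule exec.While_False, simp add: While_False.hyps(1))
next
  case (While_True s e v c T1 s1 T2 s2)
  obtain R1 where R1: "certifies R1 (rcost e) inp (\<lambda>inp'. rval W inp' s e = rval W inp s e)"
    using certifies_rval by blast
  from While_True.IH obtain R2 R3 where "certifies R2 T1 inp (\<lambda>inp'. exec W inp' c s T1 s1)"
    "certifies R3 T2 inp (\<lambda>inp'. exec W inp' (While e c) s1 T2 s2)" by blast
  then have "\<exists>R. certifies R (T1 + T2) inp
      (\<lambda>inp'. exec W inp' c s T1 s1 \<and> exec W inp' (While e c) s1 T2 s2)"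
    by (rule certifies_conj) simp_all
  then obtain R4 where "certifies R4 (T1 + T2) inp
      (\<lambda>inp'. exec W inp' c s T1 s1 \<and> exec W inp' (While e c) s1 T2 s2)" ..
  with R1 show ?case
  proof (rule certifies_conj)
    fix inp' assume "rval W inp' s e = rval W inp s e"
      and ex: "exec W inp' c s T1 s1 \<and> exec W inp' (While e c) s1 T2 s2"
    then have "rval W inp' s e = Some v" using While_True.hyps(1) by simp
    then show "exec W inp' (While e c) s (1 + rcost e + T1 + T2) s2"
      using While_True.hyps(2) conjunct1[OF ex] conjunct2[OF ex] by (rule exec.While_True)
  qed simp
qed

section \<open>Adversary argument on blocks of the text\<close>

text \<open>The adversary's condition on a pattern: no \<open>r\<close> letters of a block, whatever
  their values, decide whether the block is an occurrence. Quantifying over all \<open>y\<close>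
  makes the resulting bound valid for every text.\<close>

definition ambiguous :: "nat \<Rightarrow> nat \<Rightarrow> nat list \<Rightarrow> nat \<Rightarrow> bool" where
  "ambiguous \<sigma> k x r \<longleftrightarrow>
     (\<forall>P\<subseteq>{..<length x}. card P \<le> r \<longrightarrow> (\<forall>y\<in>strings \<sigma> (length x).
        \<exists>y1\<in>strings \<sigma> (length x). \<exists>y2\<in>strings \<sigma> (length x).
          (\<forall>p\<in>P. y1 ! p = y ! p \<and> y2 ! p = y ! p) \<and>
          (\<exists>i<length x. lev y1 (rotate i x) \<le> k) \<and> \<not> (\<exists>i<length x. lev y2 (rotate i x) \<le> k)))"

text \<open>The text contains \<open>n div m\<close> disjoint blocks of length \<open>m\<close>. If
  at most \<open>r\<close> letters of one of them were read, the block could be replaced by an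
  occurrence and by a non-occurrence without changing any letter read, and both texts would produce
  the same output.\<close>

lemma search_time_lower:
  assumes A: "solves_ACSM \<sigma> A" and x: "x \<in> strings \<sigma> m" and "k < m" "m < n"
    and t: "t \<in> strings \<sigma> n" and amb: "ambiguous \<sigma> k x r"
  shows "(r + 1) * (n div m) \<le> search_time A k x t"
proof -
  have lx: "length x = m" and lt: "length t = n" and st: "set t \<subseteq> {..<\<sigma>}"
    using x t by (auto simp: strings_def)
  have m0: "m > 0" using \<open>k < m\<close> by simp
  obtain T s' where run: "run_search A k x t T s'"
    using A x t \<open>k < m\<close> \<open>m < n\<close> unfolding solves_ACSM_def by blast
  let ?W = "(length t + 2) ^ word_exponent A"
  from run obtain T0 s0 where pre: "exec ?W x (preprocess A) (initial_state k) T0 s0"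
    and ex: "exec ?W t (search A) (s0\<lparr>emitted := []\<rparr>) T s'"
    unfolding run_search_def Let_def by blast
  obtain R where R: "certifies R T t (\<lambda>t'. exec ?W t' (search A) (s0\<lparr>emitted := []\<rparr>) T s')"
    using exec_reads[OF ex] by blast
  \<comment> \<open>\<open>s0\<close> depends only on the pattern, the threshold and the word size,
    and \<open>?W\<close> only on the text length. So the same execution is a run of the algorithm
    on \<open>t'\<close>, and by determinism its output is the correct one for
    \<open>t'\<close>.\<close>
  have out: "set (emitted s') = circular_occurrences k x t'"
    if "t' \<in> strings \<sigma> n" "\<forall>i\<in>R. t' ! i = t ! i" for t'
  proof -
    have l': "length t' = length t" using that lt by (simp add: strings_def)
    have ex': "exec ?W t' (search A) (s0\<lparr>emitted := []\<rparr>) T s'"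
      using R l' that(2) by (simp add: certifies_def)
    have run': "run_search A k x t' T s'"
      unfolding run_search_def Let_def l'
      by (rule exI[of _ T0], rule exI[of _ s0], rule conjI[OF pre ex'])
    from A[unfolded solves_ACSM_def] x that(1) \<open>k < m\<close> \<open>m < n\<close>
    obtain T'' s'' where run'': "run_search A k x t' T'' s''"
      and "set (emitted s'') = circular_occurrences k x t'" by blast
    then show ?thesis using run_search_deterministic[OF run' run''] by simp
  qed
  define V where "V j = {j * m..<j * m + m}" for j
  have many: "r + 1 \<le> card (R \<inter> V j)" if j: "j < n div m" for j
  proof (rule ccontr)
    assume few: "\<not> r + 1 \<le> card (R \<inter> V j)"
    have "(j + 1) * m \<le> (n div m) * m" using j by (intro mult_le_mono1) simp
    also have "\<dots> \<le> n" by simp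
    finally have jm: "j * m + m \<le> n" by simp
    define P where "P = (\<lambda>i. i - j * m) ` (R \<inter> V j)"
    have P: "P \<subseteq> {..<m}" by (auto simp: P_def V_def)
    have fin: "finite (R \<inter> V j)" by (simp add: V_def)
    have "card P \<le> card (R \<inter> V j)" unfolding P_def by (rule card_image_le[OF fin])
    then have cP: "card P \<le> r" using few by simp
    define y where "y = take m (drop (j * m) t)"
    have y: "y \<in> strings \<sigma> m" using jm lt st set_take_subset[of m "drop (j * m) t"] set_drop_subset[of "j * m" t]
      by (auto simp: y_def strings_def)
    from amb[unfolded ambiguous_def lx, rule_format, OF P cP y] obtain y1 y2 where
      y12: "y1 \<in> strings \<sigma> m" "y2 \<in> strings \<sigma> m" and
      agree: "\<And>p. p \<in> P \<Longrightarrow> y1 ! p = y ! p" "\<And>p. p \<in> P \<Longrightarrow> y2 ! p = y ! p" and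
      occ: "\<exists>i<m. lev y1 (rotate i x) \<le> k" "\<not> (\<exists>i<m. lev y2 (rotate i x) \<le> k)" by blast
    define put where "put z = take (j * m) t @ z @ drop (j * m + m) t" for z
    have lput: "length (put z) = n" if "z \<in> strings \<sigma> m" for z
      using that jm lt by (simp add: put_def strings_def)
    have sput: "put z \<in> strings \<sigma> n" if "z \<in> strings \<sigma> m" for z
      using lput[OF that] that st set_take_subset[of "j * m" t] set_drop_subset[of "j * m + m" t]
      by (auto simp: put_def strings_def)
    have aput: "put z ! i = t ! i" if z: "z \<in> strings \<sigma> m" "\<And>p. p \<in> P \<Longrightarrow> z ! p = y ! p"
      and i: "i \<in> R" for z i
    proof -
      have lz: "length z = m" using z(1) by (simp add: strings_def)
      consider "i < j * m" | "i \<in> V j" | "j * m + m \<le> i"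
        unfolding V_def by fastforce
      then show ?thesis
      proof cases
        case 1
        then show ?thesis using jm lt by (simp add: put_def nth_append)
      next
        case 2
        then have "i - j * m \<in> P" using i by (auto simp: P_def)
        then have "z ! (i - j * m) = t ! i" using z(2) 2 jm lt by (auto simp: y_def V_def)
        then show ?thesis using 2 jm lt lz by (auto simp: put_def nth_append V_def)
      next
        case 3
        have "length (take (j * m) t @ z) = j * m + m" using jm lt lz by simp
        moreover have "put z = (take (j * m) t @ z) @ drop (j * m + m) t" by (simp add: put_def)
        ultimately have "put z ! i = drop (j * m + m) t ! (i - (j * m + m))"
          using 3 by (simp only: nth_append not_less[symmetric] if_False)
        then show ?thesis using 3 jm lt by simp
      qed
    qed
    have fput: "factor (put z) (j * m) (j * m + m - 1) = z" if "z \<in> strings \<sigma> m" for z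
      using that jm lt m0 by (simp add: factor_def put_def strings_def)
    have jm': "j * m \<le> j * m + m - 1" "j * m + m - 1 < n" using jm m0 by simp_all
    \<comment> \<open>The pair delimiting block \<open>j\<close> is the output on which the two
      modified texts differ.\<close>
    have mem: "(j * m, j * m + m - 1) \<in> circular_occurrences k x (put z) \<longleftrightarrow>
        (\<exists>i<m. lev z (rotate i x) \<le> k)" if z: "z \<in> strings \<sigma> m" for z
      using jm' by (simp only: circular_occurrences_def mem_Collect_eq prod.case fput[OF z]
          lput[OF z] lx edit_distance_eq_lev simp_thms)
    have "set (emitted s') = circular_occurrences k x (put y1)"
      using out[OF sput[OF y12(1)]] aput[OF y12(1) agree(1)] by blast
    moreover have "set (emitted s') = circular_occurrences k x (put y2)"
      using out[OF sput[OF y12(2)]] aput[OF y12(2) agree(2)] by blast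
    ultimately show False using mem[OF y12(1)] mem[OF y12(2)] occ by simp
  qed
  have disj: "disjoint_family_on (\<lambda>j. R \<inter> V j) {..<n div m}"
    unfolding disjoint_family_on_def
  proof (intro ballI impI)
    fix a b :: nat assume "a \<noteq> b"
    then consider "a < b" | "b < a" by linarith
    then have "V a \<inter> V b = {}"
    proof cases
      case 1
      then have "(a + 1) * m \<le> b * m" by (intro mult_le_mono1) simp
      then show ?thesis by (auto simp: V_def)
    next
      case 2
      then have "(b + 1) * m \<le> a * m" by (intro mult_le_mono1) simp
      then show ?thesis by (auto simp: V_def)
    qed
    then show "(R \<inter> V a) \<inter> (R \<inter> V b) = {}" by blast
  qed
  have finR: "finite R" using R by (simp add: certifies_def)
  have "(r + 1) * (n div m) = (\<Sum>j<n div m. r + 1)" by simp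
  also have "\<dots> \<le> (\<Sum>j<n div m. card (R \<inter> V j))" by (rule sum_mono) (use many in simp)
  also have "\<dots> = card (\<Union>j<n div m. R \<inter> V j)"
    using disj finR by (subst card_UN_disjoint) (auto simp: disjoint_family_on_def)
  also have "\<dots> \<le> card R" using finR by (intro card_mono) auto
  also have "\<dots> \<le> T" using R by (simp add: certifies_def)
  finally show ?thesis using search_time_eq[OF run] by simp
qed

lemma set_replicate_uniform:
  assumes "\<sigma> > 0"
  shows "set_pmf (replicate_pmf n (pmf_of_set {..<\<sigma>})) = strings \<sigma> n"
  using assms by (subst set_replicate_pmf) (auto simp: strings_def set_pmf_of_set lessThan_empty_iff)

lemma finite_strings [simp]: "finite (strings \<sigma> n)"
  unfolding strings_def using finite_lists_length_eq[of "{..<\<sigma>}" n] by (simp add: conj_commute)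

lemma average_ge:
  assumes "\<sigma> > 0" and "\<And>t. t \<in> strings \<sigma> n \<Longrightarrow> B \<le> real (search_time A k x t)"
  shows "B \<le> average_search_time \<sigma> A k x n"
proof -
  let ?M = "replicate_pmf n (pmf_of_set {..<\<sigma>})"
  have "B = measure_pmf.expectation ?M (\<lambda>_. B)" by simp
  also have "\<dots> \<le> measure_pmf.expectation ?M (\<lambda>t. real (search_time A k x t))"
    using assms by (intro integral_mono_AE integrable_measure_pmf_finite)
      (auto simp: set_replicate_uniform AE_measure_pmf_iff)
  finally show ?thesis by (simp add: average_search_time_def)
qed

text \<open>\<open>n > m\<close> gives \<open>n div m \<ge> n / (2 m)\<close>, which removes the
  floor.\<close>

lemma average_lower:
  assumes "solves_ACSM \<sigma> A" "x \<in> strings \<sigma> m" "k < m" "m < n" "ambiguous \<sigma> k x r" "\<sigma> > 0"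
  shows "(real r + 1) * (real n / (2 * real m)) \<le> average_search_time \<sigma> A k x n"
proof -
  have "real n \<le> real (2 * m * (n div m))"
  proof -
    have "n < m * (n div m) + m" using assms(3) dividend_less_div_times[of m n] by (simp add: mult.commute add.commute)
    moreover have "1 \<le> n div m" using assms(3,4) by (simp add: div_greater_zero_iff Suc_le_eq)
    then have "m * 1 \<le> m * (n div m)" by (rule mult_le_mono2)
    ultimately show ?thesis unfolding of_nat_le_iff by linarith
  qed
  then have "real n / (2 * real m) \<le> real (n div m)"
    using assms(3) by (simp add: field_simps)
  then have "(real r + 1) * (real n / (2 * real m)) \<le> (real r + 1) * real (n div m)"
    by (intro mult_left_mono) auto
  also have "\<dots> = real ((r + 1) * (n div m))" by (simp add: algebra_simps)
  also have "\<dots> \<le> average_search_time \<sigma> A k x n"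
    using search_time_lower[OF assms(1-4) _ assms(5)] \<open>\<sigma> > 0\<close>
    by (intro average_ge) (auto simp only: of_nat_le_iff)
  finally show ?thesis .
qed

section \<open>Ambiguous patterns\<close>

text \<open>Filling the unread positions with \<open>a\<close> leaves at most \<open>card P\<close>
  other letters, whereas every rotation of \<open>x\<close> has more than \<open>card P + k\<close>
  of them; one edit makes up for at most one.\<close>

lemma overwrite_no_occurrence:
  fixes x y :: "nat list"
  assumes P: "P \<subseteq> {..<length x}" and y: "y \<in> strings \<sigma> (length x)" and "a < \<sigma>"
    and many: "card P + k < length (filter (\<lambda>b. b \<noteq> a) x)"
  defines "z \<equiv> map (\<lambda>p. if p \<in> P then y ! p else a) [0..<length x]"
  shows "z \<in> strings \<sigma> (length x)" and "\<And>p. p \<in> P \<Longrightarrow> z ! p = y ! p"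
    and "\<not> (\<exists>i<length x. lev z (rotate i x) \<le> k)"
proof -
  show "z \<in> strings \<sigma> (length x)"
    using y \<open>a < \<sigma>\<close> by (fastforce simp: z_def strings_def in_set_conv_nth)
  show "z ! p = y ! p" if "p \<in> P" for p
    using that P by (auto simp: z_def)
  have "length (filter (\<lambda>b. b \<noteq> a) z) = card {p. p < length z \<and> z ! p \<noteq> a}"
    by (rule length_filter_conv_card)
  also have "\<dots> \<le> card P" using P
    by (intro card_mono) (auto simp: z_def finite_subset split: if_splits)
  finally have few: "length (filter (\<lambda>b. b \<noteq> a) z) \<le> card P" .
  have rot: "length (filter (\<lambda>b. b \<noteq> a) (rotate i x)) = length (filter (\<lambda>b. b \<noteq> a) x)" for i
    by (metis rotate_drop_take append_take_drop_id filter_append length_append add.commute)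
  show "\<not> (\<exists>i<length x. lev z (rotate i x) \<le> k)"
  proof
    assume "\<exists>i<length x. lev z (rotate i x) \<le> k"
    then obtain i where "lev z (rotate i x) \<le> k" by blast
    with filter_length_le_lev[of "\<lambda>b. b \<noteq> a" "rotate i x" z] few rot[of i] many
    show False by linarith
  qed
qed

text \<open>If the unread positions are filled with 0, the revealed letters cost at most
  \<open>k\<close> substitutions. If they are filled with 1, at least \<open>m - k > k\<close> edits
  are necessary.\<close>

lemma ambiguous_replicate:
  assumes "2 * k < m" "\<sigma> \<ge> 2"
  shows "ambiguous \<sigma> k (replicate m 0) k"
  unfolding ambiguous_def length_replicate
proof (intro allI impI ballI)
  fix P y assume P: "P \<subseteq> {..<m}" "card P \<le> k" and y: "y \<in> strings \<sigma> m"
  let ?x = "replicate m (0::nat)"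
  define y1 where "y1 = map (\<lambda>p. if p \<in> P then y ! p else 0) [0..<m]"
  define y2 where "y2 = map (\<lambda>p. if p \<in> P then y ! p else 1) [0..<length ?x]"
  have fin: "finite P" using P finite_subset by blast
  have c1: "card P + k < length (filter (\<lambda>b. b \<noteq> 1) ?x)"
    using P assms by simp
  have "y1 \<in> strings \<sigma> m"
    using y assms by (fastforce simp: y1_def strings_def in_set_conv_nth)
  moreover have "\<forall>p\<in>P. y1 ! p = y ! p" using P by (auto simp: y1_def)
  moreover have "\<exists>i<m. lev y1 (rotate i ?x) \<le> k"
  proof -
    have "lev y1 ?x \<le> card {i. i < length y1 \<and> y1 ! i \<noteq> ?x ! i}"
      by (rule lev_le_mismatches) (simp add: y1_def)
    also have "\<dots> \<le> card P" by (intro card_mono fin) (auto simp: y1_def split: if_splits)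
    finally have "lev y1 (rotate 0 ?x) \<le> k" using P by simp
    moreover have "0 < m" using assms by simp
    ultimately show ?thesis by blast
  qed
  moreover have "y2 \<in> strings \<sigma> m" "\<forall>p\<in>P. y2 ! p = y ! p"
    "\<not> (\<exists>i<m. lev y2 (rotate i ?x) \<le> k)"
    using overwrite_no_occurrence[of P ?x y \<sigma> 1 k] c1 P y assms(2)
    unfolding y2_def by simp_all
  ultimately show "\<exists>y1\<in>strings \<sigma> m. \<exists>y2\<in>strings \<sigma> m. (\<forall>p\<in>P. y1 ! p = y ! p \<and> y2 ! p = y ! p) \<and>
      (\<exists>i<m. lev y1 (rotate i ?x) \<le> k) \<and> \<not> (\<exists>i<m. lev y2 (rotate i ?x) \<le> k)"
    by (rule_tac bexI[of _ y1], rule_tac bexI[of _ y2]) simp_all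
qed

section \<open>Words whose rotations match any few letters\<close>

text \<open>Take a family of pairwise disjoint translates of maximum size. Every translate
  \<open>j\<close> meets a chosen \<open>i\<close>, hence \<open>j = i + p - p'\<close> modulo
  \<open>m\<close> for some \<open>p\<close> and \<open>p'\<close> in \<open>P\<close>, which leaves
  at most \<open>card I * (card P)^2\<close> values of \<open>j\<close>.\<close>

lemma disjoint_translates:
  fixes m :: nat
  assumes P: "P \<subseteq> {..<m}" "P \<noteq> {}"
  obtains I where "I \<subseteq> {..<m}" "m \<le> card I * (card P * card P)"
    "\<And>i j. i \<in> I \<Longrightarrow> j \<in> I \<Longrightarrow> i \<noteq> j \<Longrightarrow>
       (\<lambda>p. (i + p) mod m) ` P \<inter> (\<lambda>p. (j + p) mod m) ` P = {}"
proof -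
  define T where "T i = (\<lambda>p. (i + p) mod m) ` P" for i
  define fam where "fam = {I. I \<subseteq> {..<m} \<and> (\<forall>i\<in>I. \<forall>j\<in>I. i \<noteq> j \<longrightarrow> T i \<inter> T j = {})}"
  have fin: "finite fam" unfolding fam_def by simp
  have "{} \<in> fam" by (simp add: fam_def)
  then have ne: "card ` fam \<noteq> {}" by blast
  obtain I where I: "I \<in> fam" "card I = Max (card ` fam)"
    using Max_in[OF finite_imageI[OF fin] ne] by (metis imageE)
  have max: "card J \<le> card I" if "J \<in> fam" for J
    using I(2) fin that by simp
  have finI: "finite I" and finP: "finite P"
    using I(1) P finite_subset by (auto simp: fam_def)
  \<comment> \<open>Adding \<open>m - p'\<close> subtracts \<open>p'\<close> modulo \<open>m\<close>
    within the natural numbers.\<close>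
  have "{..<m} \<subseteq> (\<lambda>(i, p, p'). (i + p + (m - p')) mod m) ` (I \<times> P \<times> P)"
  proof
    fix j assume j: "j \<in> {..<m}"
    show "j \<in> (\<lambda>(i, p, p'). (i + p + (m - p')) mod m) ` (I \<times> P \<times> P)"
    proof (cases "j \<in> I")
      case True
      from P obtain p where p: "p \<in> P" by blast
      then have "(j + p + (m - p)) mod m = j" using P j by auto
      then show ?thesis using True p by (intro image_eqI[of _ _ "(j, p, p)"]) auto
    next
      case False
      then have "card (insert j I) > card I" using finI by simp
      then have "insert j I \<notin> fam" using max leD by blast
      have "\<exists>i\<in>I. T i \<inter> T j \<noteq> {}"
      proof (rule ccontr)
        assume "\<not> (\<exists>i\<in>I. T i \<inter> T j \<noteq> {})"
        then have "\<forall>i\<in>I. T i \<inter> T j = {} \<and> T j \<inter> T i = {}" by (simp add: Int_commute)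
        then have "insert j I \<in> fam" using I(1) j by (simp add: fam_def)
        with \<open>insert j I \<notin> fam\<close> show False ..
      qed
      then obtain i where i: "i \<in> I" "T i \<inter> T j \<noteq> {}" by blast
      then obtain p p' where p: "p \<in> P" "p' \<in> P" and eq: "(i + p) mod m = (j + p') mod m"
        unfolding T_def by blast
      have "(i + p + (m - p')) mod m = ((i + p) mod m + (m - p')) mod m" by (simp add: mod_add_left_eq)
      also have "\<dots> = (j + p' + (m - p')) mod m" unfolding eq by (simp add: mod_add_left_eq)
      also have "\<dots> = j" using p(2) P(1) j by auto
      finally show ?thesis using p i(1) by (intro image_eqI[of _ _ "(i, p, p')"]) auto
    qed
  qed
  then have "card {..<m} \<le> card (I \<times> P \<times> P)"
    using finI finP by (meson card_image_le card_mono finite_SigmaI finite_imageI order_trans)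
  then have "m \<le> card I * (card P * card P)" by (simp add: card_cartesian_product)
  moreover have "I \<subseteq> {..<m}" using I(1) by (simp add: fam_def)
  moreover have "\<And>i j. i \<in> I \<Longrightarrow> j \<in> I \<Longrightarrow> i \<noteq> j \<Longrightarrow> T i \<inter> T j = {}"
    using I(1) by (simp add: fam_def)
  ultimately show thesis using that unfolding T_def by blast
qed

lemma inj_on_translate:
  fixes m :: nat
  assumes "P \<subseteq> {..<m}"
  shows "inj_on (\<lambda>p. (i + p) mod m) P"
proof (rule inj_onI)
  fix p q assume pq: "p \<in> P" "q \<in> P" and eq: "(i + p) mod m = (i + q) mod m"
  have lt: "p < m" "q < m" using pq assms by auto
  have "b \<le> a" if "(i + a) mod m = (i + b) mod m" "a < m" "b < m" for a b
  proof (rule ccontr)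
    assume "\<not> b \<le> a"
    then have "m dvd (i + b) - (i + a)"
      using that by (subst mod_eq_dvd_iff_nat[symmetric]) auto
    then show False using \<open>\<not> b \<le> a\<close> that by (auto dest: dvd_imp_le)
  qed
  from this[OF eq lt] this[OF eq[symmetric] lt(2,1)] show "p = q" by simp
qed

text \<open>Words as extensional functions: \<open>PiE\<close> supplies cardinalities, and the
  letters on a set of positions can be exchanged pointwise.\<close>

definition words :: "nat \<Rightarrow> nat \<Rightarrow> (nat \<Rightarrow> nat) set" where
  "words \<sigma> m = PiE {..<m} (\<lambda>_. {..<\<sigma>})"

lemma finite_words [simp]: "finite (words \<sigma> m)"
  unfolding words_def by (intro finite_PiE) auto

lemma card_words: "card (words \<sigma> m) = \<sigma> ^ m"
  unfolding words_def by (subst card_PiE) auto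

text \<open>For \<open>I = {..<m}\<close> these are the words no rotation of which agrees with
  \<open>y\<close> on \<open>P\<close>, the bad event of the union bound.\<close>

definition avoiding :: "nat \<Rightarrow> nat \<Rightarrow> nat set \<Rightarrow> (nat \<Rightarrow> nat) \<Rightarrow> nat set \<Rightarrow> (nat \<Rightarrow> nat) set" where
  "avoiding \<sigma> m P y I = {f \<in> words \<sigma> m. \<forall>i\<in>I. \<exists>p\<in>P. f ((i + p) mod m) \<noteq> y p}"

text \<open>Disjoint translates avoid \<open>y\<close> independently, each with probability
  \<open>1 - 1 / \<sigma> ^ card P\<close>. Denominators are cleared to stay in the natural
  numbers.\<close>

lemma card_avoiding:
  assumes P: "P \<subseteq> {..<m}" and y: "\<And>p. p \<in> P \<Longrightarrow> y p < \<sigma>"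
    and "finite I" "I \<subseteq> {..<m}" and "m > 0"
    and disj: "\<And>i j. i \<in> I \<Longrightarrow> j \<in> I \<Longrightarrow> i \<noteq> j \<Longrightarrow>
       (\<lambda>p. (i + p) mod m) ` P \<inter> (\<lambda>p. (j + p) mod m) ` P = {}"
  shows "card (avoiding \<sigma> m P y I) * (\<sigma> ^ card P) ^ card I \<le> (\<sigma> ^ card P - 1) ^ card I * \<sigma> ^ m"
  using assms(3,4) disj
proof (induction I rule: finite_induct)
  case empty
  have "avoiding \<sigma> m P y {} = words \<sigma> m" by (simp add: avoiding_def)
  then show ?case by (simp add: card_words)
next
  case (insert i I)
  let ?q = "\<sigma> ^ card P" and ?A = "avoiding \<sigma> m P y I"
  define t where "t p = (i + p) mod m" for p
  define M where "M = {f \<in> ?A. \<forall>p\<in>P. f (t p) = y p}"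
  have inj: "inj_on t P" unfolding t_def by (rule inj_on_translate[OF P])
  have finA: "finite ?A" by (simp add: avoiding_def)
  have tm: "t p < m" for p using \<open>m > 0\<close> by (simp add: t_def)
  have far: "(j + p) mod m \<notin> t ` P" if "j \<in> I" "p \<in> P" for j p
    using insert.prems(2)[of j i] that insert.hyps(2) unfolding t_def by blast
  define g where "g = inv_into P t"
  have gt: "g (t p) = p" if "p \<in> P" for p using inj that by (simp add: g_def)
  \<comment> \<open>Overwrite the translate by \<open>y\<close> and remember the letters lost: this
    is injective, and by disjointness the result still avoids \<open>y\<close> on the translates
    from \<open>I\<close>. Hence at least a fraction \<open>1 / ?q\<close> of \<open>?A\<close>
    matches at \<open>i\<close>.\<close>
  define \<phi> where "\<phi> f = ((\<lambda>z. if z \<in> t ` P then y (g z) else f z), restrict f (t ` P))"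
    for f :: "nat \<Rightarrow> nat"
  have "card ?A \<le> card (M \<times> PiE (t ` P) (\<lambda>_. {..<\<sigma>}))"
  proof (rule card_inj_on_le)
    show "inj_on \<phi> ?A"
    proof (rule inj_onI)
      fix f h assume eq: "\<phi> f = \<phi> h"
      show "f = h"
      proof
        fix z
        have "fst (\<phi> f) z = fst (\<phi> h) z" "snd (\<phi> f) z = snd (\<phi> h) z" using eq by simp_all
        then show "f z = h z" by (cases "z \<in> t ` P") (simp_all add: \<phi>_def)
      qed
    qed
    show "\<phi> ` ?A \<subseteq> M \<times> PiE (t ` P) (\<lambda>_. {..<\<sigma>})"
    proof
      fix v assume "v \<in> \<phi> ` ?A"
      then obtain f where f: "f \<in> ?A" "v = \<phi> f" by blast
      have fw: "f \<in> words \<sigma> m" using f by (simp add: avoiding_def)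
      define f' where "f' = fst (\<phi> f)"
      have f'_in: "f' (t p) = y p" if "p \<in> P" for p
        using that by (simp add: f'_def \<phi>_def gt)
      have f'_out: "f' z = f z" if "z \<notin> t ` P" for z
        using that by (simp add: f'_def \<phi>_def)
      have "f' \<in> words \<sigma> m"
        unfolding words_def
      proof (rule PiE_I)
        fix z assume "z \<in> {..<m}"
        then show "f' z \<in> {..<\<sigma>}"
          using fw y f'_in f'_out by (cases "z \<in> t ` P") (auto simp: words_def PiE_iff)
      next
        fix z assume "z \<notin> {..<m}"
        then show "f' z = undefined"
          using fw tm f'_out[of z] by (force simp: words_def PiE_def extensional_def)
      qed
      moreover have "\<forall>j\<in>I. \<exists>p\<in>P. f' ((j + p) mod m) \<noteq> y p"
        using f(1) far f'_out by (fastforce simp: avoiding_def)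
      ultimately have "f' \<in> M" using f'_in by (simp add: M_def avoiding_def)
      moreover have "snd (\<phi> f) \<in> PiE (t ` P) (\<lambda>_. {..<\<sigma>})"
        using fw tm by (auto simp: \<phi>_def words_def PiE_iff)
      ultimately show "v \<in> M \<times> PiE (t ` P) (\<lambda>_. {..<\<sigma>})"
        using f(2) by (simp add: f'_def mem_Times_iff)
    qed
    show "finite (M \<times> PiE (t ` P) (\<lambda>_. {..<\<sigma>}))"
      using finA finite_subset[OF P] by (intro finite_cartesian_product finite_PiE) (auto simp: M_def)
  qed
  also have "\<dots> = card M * ?q"
    using finite_subset[OF P] by (simp add: card_cartesian_product card_PiE card_image[OF inj])
  finally have AM: "card ?A \<le> card M * ?q" .
  have "avoiding \<sigma> m P y (insert i I) = ?A - M"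
    by (auto simp: avoiding_def M_def t_def)
  then have "card (avoiding \<sigma> m P y (insert i I)) * ?q = card ?A * ?q - card M * ?q"
    using finA by (simp add: card_Diff_subset M_def diff_mult_distrib)
  also have "\<dots> \<le> card ?A * ?q - card ?A" using AM by (rule diff_le_mono2)
  also have "\<dots> = card ?A * (?q - 1)" by (simp add: diff_mult_distrib2)
  finally have step: "card (avoiding \<sigma> m P y (insert i I)) * ?q \<le> card ?A * (?q - 1)" .
  have IH: "card ?A * ?q ^ card I \<le> (?q - 1) ^ card I * \<sigma> ^ m"
    using insert.IH insert.prems by simp
  have "card (avoiding \<sigma> m P y (insert i I)) * ?q ^ card (insert i I) =
      (card (avoiding \<sigma> m P y (insert i I)) * ?q) * ?q ^ card I"
    using insert.hyps by simp
  also have "\<dots> \<le> (card ?A * (?q - 1)) * ?q ^ card I" by (rule mult_le_mono1[OF step])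
  also have "\<dots> = (?q - 1) * (card ?A * ?q ^ card I)" by simp
  also have "\<dots> \<le> (?q - 1) * ((?q - 1) ^ card I * \<sigma> ^ m)" by (rule mult_le_mono2[OF IH])
  finally show ?case using insert.hyps by simp
qed

text \<open>There are at least \<open>m / r^2\<close> disjoint translates, and
  \<open>1 - 1 / q \<le> exp (- 1 / q)\<close> turns the product into an exponential.\<close>

lemma card_avoiding_all:
  assumes P: "P \<subseteq> {..<m}" "card P = r" and r: "r \<ge> 1" and y: "\<And>p. p \<in> P \<Longrightarrow> y p < \<sigma>" and "\<sigma> > 0"
  shows "real (card (avoiding \<sigma> m P y {..<m})) \<le> real \<sigma> ^ m * exp (- (real m / (real r ^ 2 * real \<sigma> ^ r)))"
proof -
  have "P \<noteq> {}" using P r by auto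
  then have m0: "m > 0" using P by auto
  obtain I where I: "I \<subseteq> {..<m}" "m \<le> card I * (card P * card P)"
    "\<And>i j. i \<in> I \<Longrightarrow> j \<in> I \<Longrightarrow> i \<noteq> j \<Longrightarrow>
       (\<lambda>p. (i + p) mod m) ` P \<inter> (\<lambda>p. (j + p) mod m) ` P = {}"
    using disjoint_translates[OF P(1) \<open>P \<noteq> {}\<close>] by metis
  have finI: "finite I" using I(1) finite_subset by blast
  let ?q = "real \<sigma> ^ r"
  have q: "?q > 0" and q1: "?q \<ge> 1" using \<open>\<sigma> > 0\<close> by (auto intro: one_le_power)
  have "card (avoiding \<sigma> m P y {..<m}) \<le> card (avoiding \<sigma> m P y I)"
    using I(1) by (intro card_mono) (auto simp: avoiding_def)
  then have "real (card (avoiding \<sigma> m P y {..<m})) * ?q ^ card I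
      \<le> real (card (avoiding \<sigma> m P y I)) * ?q ^ card I"
    by (intro mult_right_mono) (use q in auto)
  also have "\<dots> = real (card (avoiding \<sigma> m P y I) * (\<sigma> ^ card P) ^ card I)" using P(2) by simp
  also have "\<dots> \<le> real ((\<sigma> ^ card P - 1) ^ card I * \<sigma> ^ m)"
    unfolding of_nat_le_iff by (rule card_avoiding[OF P(1) y finI I(1) m0 I(3)])
  also have "\<dots> = (?q - 1) ^ card I * real \<sigma> ^ m"
    using P(2) \<open>\<sigma> > 0\<close> by (simp add: of_nat_diff Suc_le_eq)
  finally have 1: "real (card (avoiding \<sigma> m P y {..<m})) * ?q ^ card I \<le> (?q - 1) ^ card I * real \<sigma> ^ m" .
  have 2: "?q - 1 \<le> ?q * exp (- 1 / ?q)"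
  proof -
    have "1 + (- 1 / ?q) \<le> exp (- 1 / ?q)" by (rule exp_ge_add_one_self)
    then have "?q * (1 + (- 1 / ?q)) \<le> ?q * exp (- 1 / ?q)" using q by (intro mult_left_mono) auto
    moreover have "?q * (1 + (- 1 / ?q)) = ?q - 1" using q by (simp add: field_simps)
    ultimately show ?thesis by linarith
  qed
  have "(?q - 1) ^ card I \<le> (?q * exp (- 1 / ?q)) ^ card I"
    using q1 2 by (intro power_mono) auto
  also have "\<dots> = ?q ^ card I * exp (real (card I) * (- 1 / ?q))"
    by (simp only: power_mult_distrib exp_of_nat_mult)
  finally have "real (card (avoiding \<sigma> m P y {..<m})) * ?q ^ card I
      \<le> ?q ^ card I * exp (real (card I) * (- 1 / ?q)) * real \<sigma> ^ m"
    using 1 \<open>\<sigma> > 0\<close> by (smt (verit) mult_right_mono zero_le_power of_nat_0_le_iff)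
  then have "?q ^ card I * real (card (avoiding \<sigma> m P y {..<m}))
      \<le> ?q ^ card I * (real \<sigma> ^ m * exp (real (card I) * (- 1 / ?q)))"
    by (simp only: mult_ac)
  then have "real (card (avoiding \<sigma> m P y {..<m})) \<le> real \<sigma> ^ m * exp (real (card I) * (- 1 / ?q))"
    by (rule mult_left_le_imp_le) (use q in simp)
  also have "\<dots> \<le> real \<sigma> ^ m * exp (- (real m / (real r ^ 2 * ?q)))"
  proof -
    have "real m \<le> real (card I) * real r ^ 2"
      using I(2) P(2) by (metis of_nat_le_iff of_nat_mult power2_eq_square)
    then have "real m / (real r ^ 2 * ?q) \<le> real (card I) / ?q"
      using r q by (simp add: field_simps)
    then show ?thesis using \<open>\<sigma> > 0\<close> by (intro mult_left_mono) auto
  qed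
  finally show ?thesis .
qed

text \<open>The probabilistic method by counting: a union bound over the at most
  \<open>(m \<sigma>) ^ r\<close> choices of \<open>r\<close> positions with letters on them.
  \<open>large\<close> says, after taking logarithms, that the bad words are fewer than all
  words.\<close>

lemma universal_word_exists:
  assumes r: "1 \<le> r" "r \<le> m" and "\<sigma> > 0"
    and large: "real r * ln (real m * real \<sigma>) < real m / (real r ^ 2 * real \<sigma> ^ r)"
  obtains x where "x \<in> strings \<sigma> m"
    "\<And>P y. P \<subseteq> {..<m} \<Longrightarrow> card P \<le> r \<Longrightarrow> y \<in> strings \<sigma> m \<Longrightarrow>
       \<exists>i<m. \<forall>p\<in>P. rotate i x ! p = y ! p"
proof -
  define \<P> where "\<P> = {P. P \<subseteq> {..<m} \<and> card P = r}"
  define Y where "Y P = PiE P (\<lambda>_. {..<\<sigma>})" for P :: "nat set"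
  define Bad where "Bad = (\<Union>(P, y)\<in>Sigma \<P> Y. avoiding \<sigma> m P y {..<m})"
  have finP: "finite \<P>" unfolding \<P>_def by simp
  have finp: "finite P" if "P \<in> \<P>" for P using that finite_subset by (auto simp: \<P>_def)
  have finY: "finite (Y P)" if "P \<in> \<P>" for P
    using finp[OF that] by (auto simp: Y_def intro: finite_PiE)
  have fin: "finite (Sigma \<P> Y)" using finP finY by blast
  have "card (Sigma \<P> Y) = (\<Sum>P\<in>\<P>. card (Y P))" using finP finY by (simp add: card_SigmaI)
  also have "\<dots> = (\<Sum>P\<in>\<P>. \<sigma> ^ r)"
    by (intro sum.cong refl) (auto simp: Y_def \<P>_def card_PiE finite_subset)
  also have "\<dots> = (m choose r) * \<sigma> ^ r"
    using n_subsets[of "{..<m}" r] by (simp add: \<P>_def)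
  also have "\<dots> \<le> m ^ r * \<sigma> ^ r" by (intro mult_le_mono1 binomial_le_pow r(2))
  finally have cS: "card (Sigma \<P> Y) \<le> (m * \<sigma>) ^ r" by (simp add: power_mult_distrib)
  let ?e = "exp (- (real m / (real r ^ 2 * real \<sigma> ^ r)))"
  have "card Bad \<le> (\<Sum>(P, y)\<in>Sigma \<P> Y. card (avoiding \<sigma> m P y {..<m}))"
    unfolding Bad_def using card_UN_le[OF fin] by (simp add: case_prod_unfold)
  then have "real (card Bad) \<le> (\<Sum>(P, y)\<in>Sigma \<P> Y. real (card (avoiding \<sigma> m P y {..<m})))"
    by (simp add: case_prod_unfold flip: of_nat_sum)
  also have "\<dots> \<le> (\<Sum>(P, y)\<in>Sigma \<P> Y. real \<sigma> ^ m * ?e)"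
  proof (rule sum_mono, clarify)
    fix P y assume "P \<in> \<P>" "y \<in> Y P"
    then show "real (card (avoiding \<sigma> m P y {..<m})) \<le> real \<sigma> ^ m * ?e"
      using card_avoiding_all[of P m r y \<sigma>] r \<open>\<sigma> > 0\<close> by (auto simp: \<P>_def Y_def PiE_iff)
  qed
  also have "\<dots> = real (card (Sigma \<P> Y)) * (real \<sigma> ^ m * ?e)" by (simp add: case_prod_unfold)
  also have "\<dots> \<le> (real m * real \<sigma>) ^ r * (real \<sigma> ^ m * ?e)"
  proof (rule mult_right_mono)
    have "real (card (Sigma \<P> Y)) \<le> real ((m * \<sigma>) ^ r)" using cS unfolding of_nat_le_iff .
    then show "real (card (Sigma \<P> Y)) \<le> (real m * real \<sigma>) ^ r" by simp
  qed simp
  also have "\<dots> < real \<sigma> ^ m"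
  proof -
    have ms: "real m * real \<sigma> > 0" using r \<open>\<sigma> > 0\<close> by simp
    have "(real m * real \<sigma>) ^ r = exp (real r * ln (real m * real \<sigma>))"
      using ms by (simp add: exp_of_nat_mult)
    then have "(real m * real \<sigma>) ^ r * ?e < 1"
      using large by (simp flip: exp_add)
    then have "real \<sigma> ^ m * ((real m * real \<sigma>) ^ r * ?e) < real \<sigma> ^ m * 1"
      using \<open>\<sigma> > 0\<close> by (intro mult_strict_left_mono) auto
    then show ?thesis by (simp add: mult_ac)
  qed
  finally have "card Bad < card (words \<sigma> m)"
    unfolding card_words by (simp only: of_nat_less_iff flip: of_nat_power)
  moreover have "Bad \<subseteq> words \<sigma> m" by (auto simp: Bad_def avoiding_def)
  ultimately obtain f where f: "f \<in> words \<sigma> m" "f \<notin> Bad" by (metis order_less_irrefl subset_antisym subsetI)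
  define x where "x = map f [0..<m]"
  have x: "x \<in> strings \<sigma> m" using f(1) by (auto simp: x_def strings_def words_def PiE_iff)
  have "\<exists>i<m. \<forall>p\<in>P. rotate i x ! p = y ! p"
    if P: "P \<subseteq> {..<m}" "card P \<le> r" and y: "y \<in> strings \<sigma> m" for P y
  proof -
    \<comment> \<open>The union bound treats sets of exactly \<open>r\<close> positions, so smaller
      ones are padded.\<close>
    obtain Q where Q: "P \<subseteq> Q" "Q \<subseteq> {..<m}" "card Q = r"
      using exists_subset_between[OF P(2), of "{..<m}"] P(1) r(2) by auto
    have "Q \<in> \<P>" using Q by (simp add: \<P>_def)
    moreover have "restrict (\<lambda>p. y ! p) Q \<in> Y Q"
      unfolding Y_def
    proof (rule restrict_PiE_iff[THEN iffD2], intro ballI)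
      fix p assume "p \<in> Q"
      then have "y ! p \<in> set y" using y Q(2) by (auto simp: strings_def)
      then show "y ! p \<in> {..<\<sigma>}" using y by (auto simp: strings_def)
    qed
    ultimately have "f \<notin> avoiding \<sigma> m Q (restrict (\<lambda>p. y ! p) Q) {..<m}"
      using f(2) unfolding Bad_def by blast
    then obtain i where i: "i < m" "\<forall>p\<in>Q. f ((i + p) mod m) = y ! p"
      using f(1) by (auto simp: avoiding_def)
    have "rotate i x ! p = y ! p" if "p \<in> P" for p
    proof -
      have p: "p \<in> Q" "p < m" using that Q by auto
      then have "rotate i x ! p = x ! ((i + p) mod m)"
        by (simp add: nth_rotate x_def add.commute)
      then show ?thesis using i p by (simp add: x_def)
    qed
    then show ?thesis using i(1) by blast
  qed
  with x show thesis using that by blast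
qed

text \<open>The rotation that agrees with the revealed letters is itself an occurrence. For the
  non-occurrence, one of the letters 0 and 1 makes up at most half of \<open>x\<close>; filling the
  block with it puts \<open>overwrite_no_occurrence\<close> to work.\<close>

lemma ambiguous_universal:
  assumes x: "x \<in> strings \<sigma> m" and "2 * (r + k) < m" "\<sigma> \<ge> 2"
    and univ: "\<And>P y. P \<subseteq> {..<m} \<Longrightarrow> card P \<le> r \<Longrightarrow> y \<in> strings \<sigma> m \<Longrightarrow>
       \<exists>i<m. \<forall>p\<in>P. rotate i x ! p = y ! p"
  shows "ambiguous \<sigma> k x r"
proof -
  have lx: "length x = m" using x by (simp add: strings_def)
  have "length x \<le> length (filter (\<lambda>b. b \<noteq> 0) x) + length (filter (\<lambda>b. b \<noteq> 1) x)"
    by (induction x) auto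
  then have "m \<le> 2 * length (filter (\<lambda>b. b \<noteq> 0) x) \<or> m \<le> 2 * length (filter (\<lambda>b. b \<noteq> 1) x)"
    unfolding lx by linarith
  then obtain a :: nat where a: "a \<in> {0, 1}" and "m \<le> 2 * length (filter (\<lambda>b. b \<noteq> a) x)" by blast
  then have a': "a < \<sigma>" "r + k < length (filter (\<lambda>b. b \<noteq> a) x)" using assms by auto
  show ?thesis
    unfolding ambiguous_def lx
  proof (intro allI impI ballI)
    fix P y assume P: "P \<subseteq> {..<m}" "card P \<le> r" and y: "y \<in> strings \<sigma> m"
    obtain i where i: "i < m" "\<forall>p\<in>P. rotate i x ! p = y ! p"
      using univ[OF P y] by blast
    define y2 where "y2 = map (\<lambda>p. if p \<in> P then y ! p else a) [0..<length x]"
    have "card P + k < length (filter (\<lambda>b. b \<noteq> a) x)" using P a' by linarith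
    then have y2: "y2 \<in> strings \<sigma> m" "\<forall>p\<in>P. y2 ! p = y ! p" "\<not> (\<exists>i<m. lev y2 (rotate i x) \<le> k)"
      using overwrite_no_occurrence[of P x y \<sigma> a k] P y a'(1) unfolding y2_def lx by simp_all
    have "rotate i x \<in> strings \<sigma> m" using x by (simp add: strings_def)
    moreover have "\<exists>j<m. lev (rotate i x) (rotate j x) \<le> k" using i(1) by (intro exI[of _ i]) simp
    ultimately show "\<exists>y1\<in>strings \<sigma> m. \<exists>y2\<in>strings \<sigma> m. (\<forall>p\<in>P. y1 ! p = y ! p \<and> y2 ! p = y ! p) \<and>
      (\<exists>i<m. lev y1 (rotate i x) \<le> k) \<and> \<not> (\<exists>i<m. lev y2 (rotate i x) \<le> k)"
      using i(2) y2 by (rule_tac bexI[of _ "rotate i x"], rule_tac bexI[of _ y2]) simp_all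
  qed
qed

text \<open>With \<open>r\<close> the floor of \<open>log \<sigma> m / 2\<close>, the power
  \<open>\<sigma> ^ r\<close> is at most \<open>sqrt m\<close>. Multiplied out, the last inequality
  then compares at most \<open>2 (ln m)^4 sqrt m\<close> with \<open>m\<close>.\<close>

lemma universal_threshold:
  assumes "\<sigma> \<ge> 2"
  obtains M where "M \<ge> 1"
    "\<And>m k. m \<ge> M \<Longrightarrow> real k < log (real \<sigma>) (real m) \<Longrightarrow>
       \<exists>r. 1 \<le> r \<and> 2 * (r + k) < m \<and> log (real \<sigma>) (real m) / 2 \<le> real r + 1 \<and>
          real r * ln (real m * real \<sigma>) < real m / (real r ^ 2 * real \<sigma> ^ r)"
proof -
  have "eventually (\<lambda>m::nat. 2 * ln (real m) ^ 4 * sqrt (real m) < real m) sequentially"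
    by real_asymp
  \<comment> \<open>For \<open>2 (r + k) < m\<close>: here \<open>r \<le> ln m\<close> and
    \<open>k < log \<sigma> m \<le> 2 ln m\<close>.\<close>
  moreover have "eventually (\<lambda>m::nat. 6 * ln (real m) < real m) sequentially"
    by real_asymp
  ultimately have "eventually (\<lambda>m::nat. 2 * ln (real m) ^ 4 * sqrt (real m) < real m \<and>
      6 * ln (real m) < real m \<and> \<sigma> ^ 2 \<le> m) sequentially"
    by (intro eventually_conj eventually_ge_at_top)
  then obtain M where M: "\<And>m. m \<ge> M \<Longrightarrow> 2 * ln (real m) ^ 4 * sqrt (real m) < real m \<and>
      6 * ln (real m) < real m \<and> \<sigma> ^ 2 \<le> m"
    unfolding eventually_sequentially by blast
  have "\<exists>r. 1 \<le> r \<and> 2 * (r + k) < m \<and> log (real \<sigma>) (real m) / 2 \<le> real r + 1 \<and>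
          real r * ln (real m * real \<sigma>) < real m / (real r ^ 2 * real \<sigma> ^ r)"
    if m: "m \<ge> max M 1" and k: "real k < log (real \<sigma>) (real m)" for m k
  proof -
    let ?l = "log (real \<sigma>) (real m)"
    have h: "2 * ln (real m) ^ 4 * sqrt (real m) < real m" "6 * ln (real m) < real m" "\<sigma> ^ 2 \<le> m"
      using M[of m] m by auto
    have s: "real \<sigma> \<ge> 2" using assms by simp
    have m2: "real \<sigma> ^ 2 \<le> real m" using h(3) by (metis of_nat_le_iff of_nat_power)
    have "real \<sigma> \<le> real \<sigma> ^ 2" using s by (simp add: power2_eq_square)
    then have sm: "real \<sigma> \<le> real m" using m2 by linarith
    have ln2: "ln 2 \<ge> (1/2::real)" using ln2_ge_two_thirds by linarith
    have "ln (real \<sigma>) \<ge> ln 2" using s by simp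
    then have lns: "ln (real \<sigma>) \<ge> 1 / 2" using ln2 by linarith
    have lnm: "ln (real m) \<ge> 0" using sm s by simp
    have l_le: "?l \<le> 2 * ln (real m)"
    proof -
      have "ln (real m) * 1 \<le> ln (real m) * (2 * ln (real \<sigma>))"
        using lns lnm by (intro mult_left_mono) auto
      then show ?thesis using lns by (simp add: log_def field_simps)
    qed
    have "ln (real \<sigma> ^ 2) \<le> ln (real m)" using m2 s sm by (subst ln_le_cancel_iff) auto
    then have "2 * ln (real \<sigma>) \<le> ln (real m)" using s by (simp add: ln_realpow)
    then have l2: "2 \<le> ?l" using lns by (simp add: log_def field_simps)
    define r where "r = nat \<lfloor>?l / 2\<rfloor>"
    have r: "real r \<le> ?l / 2" "?l / 2 < real r + 1" using l2 of_nat_floor[of "?l / 2"] unfolding r_def by linarith+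
    have r1: "1 \<le> r" using l2 unfolding r_def by linarith
    have r_ln: "real r \<le> ln (real m)" using r l_le by linarith
    have "real (2 * (r + k)) < real m" using r_ln k l_le h(2) by simp
    then have c2: "2 * (r + k) < m" unfolding of_nat_less_iff .
    have "real \<sigma> ^ r = real \<sigma> powr real r" using s by (simp add: powr_realpow)
    also have "\<dots> \<le> real \<sigma> powr (?l / 2)" using r s by (intro powr_mono) auto
    also have "\<dots> = (real \<sigma> powr ?l) powr (1 / 2)" by (simp add: powr_powr)
    also have "\<dots> = sqrt (real m)" using s sm by (simp add: powr_half_sqrt)
    finally have sr: "real \<sigma> ^ r \<le> sqrt (real m)" .
    have "ln (real m * real \<sigma>) = ln (real m) + ln (real \<sigma>)" using s sm by (simp add: ln_mult)
    also have "\<dots> \<le> 2 * ln (real m)" using s sm by simp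
    finally have l3: "ln (real m * real \<sigma>) \<le> 2 * ln (real m)" .
    have l4: "0 \<le> ln (real m * real \<sigma>)" using \<open>ln (real m * real \<sigma>) = _\<close> lnm lns by linarith
    have "real r * ln (real m * real \<sigma>) * (real r ^ 2 * real \<sigma> ^ r)
        \<le> ln (real m) * (2 * ln (real m)) * (ln (real m) ^ 2 * sqrt (real m))"
      using r_ln l3 l4 sr lnm by (intro mult_mono power_mono) auto
    also have "\<dots> = 2 * ln (real m) ^ 4 * sqrt (real m)" by (simp add: power2_eq_square power4_eq_xxxx)
    also have "\<dots> < real m" by (rule h(1))
    finally have "real r * ln (real m * real \<sigma>) < real m / (real r ^ 2 * real \<sigma> ^ r)"
      using r1 s by (subst pos_less_divide_eq) auto
    then show ?thesis using r1 c2 r(2) by (intro exI[of _ r]) auto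
  qed
  then show thesis by (intro that[of "max M 1"]) auto
qed

text \<open>Unary patterns account for the term \<open>k\<close>, universal ones for the logarithm,
  and the larger term selects the pattern. If the logarithm is larger but \<open>m < M\<close>, both
  are bounded and a unary pattern suffices.\<close>

lemma average_lower_bound:
  assumes "\<sigma> \<ge> 2"
  shows "\<exists>C'::real. C' > 0 \<and> (\<forall>A. solves_ACSM \<sigma> A \<longrightarrow>
      (\<forall>n m k. 1 \<le> m \<and> m < n \<and> 2 * k < m \<longrightarrow>
         (\<exists>x \<in> strings \<sigma> m. average_search_time \<sigma> A k x n
              \<ge> C' * (real n * (real k + log (real \<sigma>) (real m)) / real m))))"
proof -
  obtain M where "M \<ge> 1" and M:
    "\<And>m k. m \<ge> M \<Longrightarrow> real k < log (real \<sigma>) (real m) \<Longrightarrow>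
       \<exists>r. 1 \<le> r \<and> 2 * (r + k) < m \<and> log (real \<sigma>) (real m) / 2 \<le> real r + 1 \<and>
          real r * ln (real m * real \<sigma>) < real m / (real r ^ 2 * real \<sigma> ^ r)"
    using universal_threshold[OF assms] by blast
  \<comment> \<open>The factor \<open>1 / M\<close> serves \<open>k < log \<sigma> m\<close> with
    \<open>m < M\<close>, where the sum of both terms is at most \<open>2 M\<close>; the factor
    \<open>1 / 8\<close> serves the other two cases.\<close>
  define C where "C = 1 / (8 * real M)"
  have C: "C > 0" "C \<le> 1 / 8" using \<open>M \<ge> 1\<close> by (auto simp: C_def field_simps)
  show ?thesis
  proof (intro exI[of _ C] conjI C(1) allI impI)
    fix A and n m k :: nat
    assume A: "solves_ACSM \<sigma> A" and mk: "1 \<le> m \<and> m < n \<and> 2 * k < m"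
    let ?l = "log (real \<sigma>) (real m)"
    let ?u = "real n / (2 * real m)"
    have l0: "?l \<ge> 0" using mk assms by simp
    have u: "?u \<ge> 0" by simp
    have fin: "\<exists>x \<in> strings \<sigma> m. average_search_time \<sigma> A k x n \<ge> C * (real n * (real k + ?l) / real m)"
      if x: "x \<in> strings \<sigma> m" "ambiguous \<sigma> k x r" and le: "2 * C * (real k + ?l) \<le> real r + 1" for x r
    proof (rule bexI[OF _ x(1)])
      have "C * (real n * (real k + ?l) / real m) = (2 * C * (real k + ?l)) * ?u"
        using mk by (simp add: field_simps)
      also have "\<dots> \<le> (real r + 1) * ?u" by (rule mult_right_mono[OF le u])
      also have "\<dots> \<le> average_search_time \<sigma> A k x n"
        using assms mk by (intro average_lower[OF A x(1) _ _ x(2)]) auto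
      finally show "C * (real n * (real k + ?l) / real m) \<le> average_search_time \<sigma> A k x n" .
    qed
    have zero: "replicate m 0 \<in> strings \<sigma> m" "ambiguous \<sigma> k (replicate m 0) k"
      using assms mk ambiguous_replicate[of k m \<sigma>] by (auto simp: strings_def)
    have C8: "2 * C * (real k + ?l) \<le> (real k + ?l) / 4"
      using C(2) l0 mult_right_mono[of "2 * C" "1 / 4" "real k + ?l"] by simp
    show "\<exists>x \<in> strings \<sigma> m. average_search_time \<sigma> A k x n \<ge> C * (real n * (real k + ?l) / real m)"
    proof (cases "real k < ?l")
      case False
      then have "(real k + ?l) / 4 \<le> real k + 1" by (simp add: field_simps)
      with C8 show ?thesis by (intro fin[OF zero]) (rule order_trans)
    next
      case k: True
      show ?thesis
      proof (cases "m \<ge> M")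
        case True
        from M[OF True k] obtain r where r: "1 \<le> r" "2 * (r + k) < m" "?l / 2 \<le> real r + 1"
          "real r * ln (real m * real \<sigma>) < real m / (real r ^ 2 * real \<sigma> ^ r)" by blast
        obtain x where x: "x \<in> strings \<sigma> m"
          "\<And>P y. P \<subseteq> {..<m} \<Longrightarrow> card P \<le> r \<Longrightarrow> y \<in> strings \<sigma> m \<Longrightarrow>
             \<exists>i<m. \<forall>p\<in>P. rotate i x ! p = y ! p"
          using universal_word_exists[of r m \<sigma>] r assms by auto
        have "(real k + ?l) / 4 \<le> real r + 1" using k r(3) by (simp add: field_simps)
        with C8 have "2 * C * (real k + ?l) \<le> real r + 1" by (rule order_trans)
        moreover have "ambiguous \<sigma> k x r"
          by (rule ambiguous_universal[OF x(1) r(2) assms]) (rule x(2))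
        ultimately show ?thesis by (intro fin[OF x(1)])
      next
        case False
        have "ln (real m) \<le> real m * ln (real \<sigma>)"
        proof -
          have "real m \<le> real \<sigma> ^ m"
            using assms by (metis less_exp less_imp_le of_nat_le_iff of_nat_power order_trans power_mono zero_le)
          then have "ln (real m) \<le> ln (real \<sigma> ^ m)"
            using mk assms by (subst ln_le_cancel_iff) auto
          also have "\<dots> = real m * ln (real \<sigma>)" using assms by (simp add: ln_realpow)
          finally show ?thesis .
        qed
        then have "?l \<le> real m" using assms by (simp add: log_def field_simps)
        then have "real k + ?l \<le> 2 * real M" using False k by simp
        then have "2 * C * (real k + ?l) \<le> 2 * C * (2 * real M)" using C(1) by (intro mult_left_mono) auto
        also have "\<dots> \<le> real k + 1" using \<open>M \<ge> 1\<close> by (simp add: C_def)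
        finally show ?thesis by (intro fin[OF zero])
      qed
    qed
  qed
qed

section \<open>Grams close to the pattern\<close>

text \<open>Indices wrap around and \<open>l\<close> may exceed the length of \<open>x\<close>: the
  factors compared with a gram have up to twice its length, however short the pattern is.\<close>

definition circ :: "'a list \<Rightarrow> nat \<Rightarrow> nat \<Rightarrow> 'a list" where
  "circ x st l = map (\<lambda>j. x ! ((st + j) mod length x)) [0..<l]"

lemma length_circ [simp]: "length (circ x st l) = l"
  by (simp add: circ_def)

lemma circ_nth [simp]: "j < l \<Longrightarrow> circ x st l ! j = x ! ((st + j) mod length x)"
  by (simp add: circ_def)

lemma subseq_circ:
  assumes "l \<le> l'"
  shows "subseq (circ x st l) (circ x st l')"
proof -
  have "circ x st l = take l (circ x st l')" using assms by (simp add: circ_def take_map)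
  then show ?thesis by (metis prefix_imp_subseq take_is_prefix)
qed

lemma sublist_rotate_circ:
  assumes "sublist y (rotate i x)" "x \<noteq> []"
  obtains st where "st < length x" "y = circ x st (length y)"
proof -
  obtain p s where ps: "rotate i x = p @ y @ s" using assms(1) by (auto simp: sublist_def)
  define st where "st = (i + length p) mod length x"
  have "y ! j = x ! ((st + j) mod length x)" if "j < length y" for j
  proof -
    have l: "length x = length p + length y + length s"
      using arg_cong[OF ps, of length] by simp
    have "y ! j = rotate i x ! (length p + j)" unfolding ps using that by (simp add: nth_append)
    also have "\<dots> = x ! ((length p + j + i) mod length x)" using that l by (subst nth_rotate) (auto simp: ac_simps)
    also have "length p + j + i = i + length p + j" by simp
    also have "\<dots> mod length x = (st + j) mod length x" by (simp only: st_def mod_add_left_eq)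
    finally show ?thesis .
  qed
  then have "y = circ x st (length y)" by (intro nth_equalityI) simp_all
  moreover have "st < length x" using assms(2) by (simp add: st_def)
  ultimately show thesis using that by blast
qed

text \<open>If \<open>\<tau> \<le> length g\<close>, a factor longer than
  \<open>2 * length g\<close> has distance more than \<open>\<tau>\<close> from \<open>g\<close>.
  The length bound thus loses nothing and makes the property finite to tabulate.\<close>

definition bad_gram :: "'a list \<Rightarrow> nat \<Rightarrow> 'a list \<Rightarrow> bool" where
  "bad_gram x \<tau> g \<longleftrightarrow> (\<exists>st<length x. \<exists>l\<le>2 * length g. lev g (circ x st l) \<le> \<tau>)"

lemma sublist_append_middle: "sublist z y \<Longrightarrow> sublist z (p @ y @ s)"
  unfolding sublist_def by (metis append.assoc)

lemma lev_concat_ge: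
  assumes "\<And>g y'. g \<in> set gs \<Longrightarrow> sublist y' y \<Longrightarrow> d \<le> lev g y'"
  shows "length gs * d \<le> lev (concat gs) y"
  using assms
proof (induction gs arbitrary: y)
  case (Cons g gs)
  obtain y1 y2 where y: "y = y1 @ y2" and le: "lev g y1 + lev (concat gs) y2 \<le> lev (g @ concat gs) y"
    using lev_split by blast
  have "d \<le> lev g y1" using Cons.prems[of g y1] y by (auto simp: sublist_def intro: exI[of _ "[]"])
  moreover have "length gs * d \<le> lev (concat gs) y2"
  proof (rule Cons.IH)
    fix g' y' assume g': "g' \<in> set gs" "sublist y' y2"
    then have "sublist y' y" using sublist_append_middle[of y' y2 y1 "[]"] by (simp add: y)
    then show "d \<le> lev g' y'" using Cons.prems[of g' y'] g' by simp
  qed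
  ultimately show ?case using le by simp
qed simp

text \<open>An alignment with a rotation matches each gram with a factor of the rotation, that is, a
  circular factor of \<open>x\<close>. A good gram pays at least \<open>Suc \<tau>\<close> there,
  and these payments add up to more than \<open>k\<close>.\<close>

lemma no_occurrence_around_good_grams:
  assumes "x \<noteq> []" and good: "\<And>g. g \<in> set gs \<Longrightarrow> \<not> bad_gram x \<tau> g \<and> \<tau> \<le> length g"
    and k: "k < length gs * Suc \<tau>"
  shows "k < lev (pre @ concat gs @ post) (rotate i x)"
proof -
  obtain y1 y' where y': "rotate i x = y1 @ y'"
    and le1: "lev pre y1 + lev (concat gs @ post) y' \<le> lev (pre @ concat gs @ post) (rotate i x)"
    using lev_split by blast
  obtain y2 y3 where y2: "y' = y2 @ y3"
    and le2: "lev (concat gs) y2 + lev post y3 \<le> lev (concat gs @ post) y'"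
    using lev_split by blast
  have "length gs * Suc \<tau> \<le> lev (concat gs) y2"
  proof (rule lev_concat_ge)
    fix g z assume g: "g \<in> set gs" and z: "sublist z y2"
    have "sublist z (rotate i x)" unfolding y' y2 by (rule sublist_append_middle[OF z])
    then obtain st where st: "st < length x" "z = circ x st (length z)"
      using sublist_rotate_circ \<open>x \<noteq> []\<close> by blast
    show "Suc \<tau> \<le> lev g z"
    proof (rule ccontr)
      assume "\<not> Suc \<tau> \<le> lev g z"
      then have "lev g z \<le> \<tau>" by simp
      then have "length z \<le> 2 * length g" using length_le_lev2[of z g] good[OF g] by linarith
      then have "bad_gram x \<tau> g" unfolding bad_gram_def using st \<open>lev g z \<le> \<tau>\<close> by metis
      then show False using good[OF g] by simp
    qed
  qed
  then show ?thesis using le1 le2 k by linarith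
qed

section \<open>Counting the grams close to the pattern\<close>

lemma card_strings [simp]: "card (strings \<sigma> n) = \<sigma> ^ n"
  unfolding strings_def using card_lists_length_eq[of "{..<\<sigma>}" n] by (simp add: conj_commute)

lemma subseqs_length_bound:
  "finite {w. length w = e \<and> subseq w y} \<and> card {w. length w = e \<and> subseq w y} \<le> length y choose e"
proof (induction y arbitrary: e)
  case Nil
  have eq: "{w. length w = e \<and> subseq w []} = (if e = 0 then {[]} else {})"
    by auto
  show ?case unfolding eq by simp
next
  case (Cons a y)
  show ?case
  proof (cases e)
    case 0
    have "{w. length w = e \<and> subseq w (a # y)} = {[]}" using 0 by auto
    then show ?thesis using 0 by simp
  next
    case (Suc d)
    let ?S = "\<lambda>e. {w. length w = e \<and> subseq w y}"
    have sub: "{w. length w = e \<and> subseq w (a # y)} \<subseteq> (#) a ` ?S d \<union> ?S e" (is "?l \<subseteq> ?r")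
    proof
      fix w assume "w \<in> ?l"
      then have w: "length w = Suc d" "subseq w (a # y)" using Suc by auto
      then obtain b v where bv: "w = b # v" by (cases w) auto
      show "w \<in> ?r"
      proof (cases "b = a")
        case True
        then show ?thesis using w bv by auto
      next
        case False
        then show ?thesis using w bv Suc by auto
      qed
    qed
    have fin: "finite (?S d)" "finite (?S e)" using Cons.IH by blast+
    have "card ?l \<le> card ?r" using fin by (intro card_mono sub) auto
    also have "\<dots> \<le> card ((#) a ` ?S d) + card (?S e)" by (rule card_Un_le)
    also have "\<dots> \<le> card (?S d) + card (?S e)" using fin by (simp add: card_image_le)
    also have "\<dots> \<le> (length y choose d) + (length y choose e)"
      using Cons.IH[of d] Cons.IH[of e] by linarith
    also have "\<dots> = length (a # y) choose e" using Suc by simp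
    finally show ?thesis using fin by (auto intro: finite_subset[OF sub])
  qed
qed

text \<open>Pascal's rule on the first letter of \<open>g\<close>: either it is the first letter of
  \<open>w\<close> and the rest of \<open>w\<close> embeds into the tail, or it is one of
  \<open>\<sigma>\<close> letters and all of \<open>w\<close> does. The bound depends on
  \<open>w\<close> only through its length.\<close>

lemma card_superseqs:
  "card {g \<in> strings \<sigma> l. subseq w g} \<le> (l choose length w) * \<sigma> ^ (l - length w)"
proof (induction l arbitrary: w)
  case 0
  have "{g \<in> strings \<sigma> 0. subseq w g} = (if w = [] then {[]} else {})"
    by (auto simp: strings_def)
  then show ?case by simp
next
  case (Suc l)
  show ?case
  proof (cases w)
    case Nil
    have "{g \<in> strings \<sigma> (Suc l). subseq w g} = strings \<sigma> (Suc l)" using Nil by auto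
    then show ?thesis using Nil by simp
  next
    case (Cons c v)
    let ?S = "\<lambda>w. {g \<in> strings \<sigma> l. subseq w g}"
    have sub: "{g \<in> strings \<sigma> (Suc l). subseq w g} \<subseteq> (#) c ` ?S v \<union> (\<lambda>(a, g). a # g) ` ({..<\<sigma>} \<times> ?S w)"
      (is "?l \<subseteq> ?r")
    proof
      fix g assume g: "g \<in> ?l"
      then obtain a h where ah: "g = a # h" by (cases g) (auto simp: strings_def)
      with g have h: "h \<in> strings \<sigma> l" "a < \<sigma>" by (auto simp: strings_def)
      show "g \<in> ?r"
        using g ah h Cons by (cases "a = c") (auto intro!: image_eqI[of _ _ "(a, h)"] split: if_splits)
    qed
    have fin: "finite (?S v)" "finite (?S w)" by simp_all
    have "card ?l \<le> card ?r" using fin by (intro card_mono sub) auto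
    also have "\<dots> \<le> card ((#) c ` ?S v) + card ((\<lambda>(a, g). a # g) ` ({..<\<sigma>} \<times> ?S w))"
      by (rule card_Un_le)
    also have "\<dots> \<le> card (?S v) + card ({..<\<sigma>} \<times> ?S w)"
      using fin by (intro add_mono card_image_le) auto
    also have "\<dots> = card (?S v) + \<sigma> * card (?S w)" by (simp add: card_cartesian_product)
    also have "\<dots> \<le> (l choose length v) * \<sigma> ^ (l - length v) +
        \<sigma> * ((l choose length w) * \<sigma> ^ (l - length w))"
      by (intro add_mono mult_le_mono2 Suc.IH)
    also have "\<sigma> * ((l choose length w) * \<sigma> ^ (l - length w)) = (l choose length w) * \<sigma> ^ (l - length v)"
    proof (cases "length w \<le> l")
      case True
      then have "l - length v = Suc (l - length w)" using Cons by simp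
      then show ?thesis by simp
    next
      case False
      then show ?thesis by (simp add: binomial_eq_0)
    qed
    also have "(l choose length v) * \<sigma> ^ (l - length v) + (l choose length w) * \<sigma> ^ (l - length v) =
        (Suc l choose length w) * \<sigma> ^ (Suc l - length w)"
      using Cons by (simp add: distrib_right)
    finally show ?thesis .
  qed
qed

text \<open>A bad gram shares a subsequence of length exactly \<open>e\<close> with a circular
  factor. Shorter factors are prefixes of the one of length \<open>2 * l\<close>, so one factor per
  start covers all lengths. The product counts starts, subsequences and supersequences.\<close>

lemma card_bad_grams:
  assumes "\<tau> \<le> l" and e: "e = l - \<tau>"
  shows "card {g \<in> strings \<sigma> l. bad_gram x \<tau> g} \<le>
    length x * ((2 * l choose e) * ((l choose e) * \<sigma> ^ (l - e)))"
proof -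
  let ?W = "\<lambda>st. {w. length w = e \<and> subseq w (circ x st (2 * l))}"
  let ?S = "\<lambda>w. {g \<in> strings \<sigma> l. subseq w g}"
  have W: "finite (?W st)" "card (?W st) \<le> 2 * l choose e" for st
    using subseqs_length_bound[of e "circ x st (2 * l)"] by auto
  have "{g \<in> strings \<sigma> l. bad_gram x \<tau> g} \<subseteq> (\<Union>st<length x. \<Union>w\<in>?W st. ?S w)"
  proof
    fix g assume "g \<in> {g \<in> strings \<sigma> l. bad_gram x \<tau> g}"
    then have g: "g \<in> strings \<sigma> l" "bad_gram x \<tau> g" by auto
    have lg: "length g = l" using g by (simp add: strings_def)
    obtain st v where st: "st < length x" "v \<le> 2 * l" "lev g (circ x st v) \<le> \<tau>"
      using g(2) lg by (auto simp: bad_gram_def)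
    obtain w where w: "subseq w g" "subseq w (circ x st v)" "length g \<le> length w + lev g (circ x st v)"
      using lev_common_subseq by blast
    have "e \<le> length w" using w(3) st(3) lg e by linarith
    then have "length (take e w) = e" by simp
    moreover have tw: "subseq (take e w) w" by (metis prefix_imp_subseq take_is_prefix)
    moreover have "subseq (take e w) (circ x st (2 * l))"
      using tw w(2) subseq_circ[OF st(2)] subseq_order.order_trans by metis
    moreover have "subseq (take e w) g" using tw w(1) subseq_order.order_trans by metis
    ultimately show "g \<in> (\<Union>st<length x. \<Union>w\<in>?W st. ?S w)"
      using g(1) st(1) by blast
  qed
  then have "card {g \<in> strings \<sigma> l. bad_gram x \<tau> g} \<le> card (\<Union>st<length x. \<Union>w\<in>?W st. ?S w)"
    using W(1) by (intro card_mono) auto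
  also have "\<dots> \<le> (\<Sum>st<length x. card (\<Union>w\<in>?W st. ?S w))" by (rule card_UN_le) simp
  also have "\<dots> \<le> (\<Sum>st<length x. (2 * l choose e) * ((l choose e) * \<sigma> ^ (l - e)))"
  proof (rule sum_mono)
    fix st
    have "card (\<Union>w\<in>?W st. ?S w) \<le> (\<Sum>w\<in>?W st. card (?S w))" by (rule card_UN_le[OF W(1)])
    also have "\<dots> \<le> (\<Sum>w\<in>?W st. (l choose e) * \<sigma> ^ (l - e))"
    proof (rule sum_mono)
      fix w assume "w \<in> ?W st"
      then show "card (?S w) \<le> (l choose e) * \<sigma> ^ (l - e)" using card_superseqs[of \<sigma> l w] by simp
    qed
    also have "\<dots> = card (?W st) * ((l choose e) * \<sigma> ^ (l - e))" by simp
    also have "\<dots> \<le> (2 * l choose e) * ((l choose e) * \<sigma> ^ (l - e))"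
      by (rule mult_le_mono1[OF W(2)])
    finally show "card (\<Union>w\<in>?W st. ?S w) \<le> (2 * l choose e) * ((l choose e) * \<sigma> ^ (l - e))" .
  qed
  also have "\<dots> = length x * ((2 * l choose e) * ((l choose e) * \<sigma> ^ (l - e)))" by simp
  finally show ?thesis .
qed

text \<open>One term of the exponential series gives \<open>e^e / fact e \<le> exp e\<close>, and
  \<open>exp 1 \<le> 3\<close>.\<close>

lemma binomial_bound:
  assumes "e \<le> n" "e > 0"
  shows "real (n choose e) \<le> (3 * real n / real e) ^ e"
proof -
  have "real e ^ e / fact e \<le> exp (real e)"
  proof -
    have "(\<Sum>i\<in>{e}. inverse (fact i) * real e ^ i) \<le> (\<Sum>i. inverse (fact i) * real e ^ i)"
      by (intro sum_le_suminf summable_exp) auto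
    then show ?thesis by (simp add: exp_def scaleR_conv_of_real field_simps)
  qed
  also have "exp (real e) = exp 1 ^ e" by (simp flip: exp_of_nat_mult)
  also have "\<dots> \<le> 3 ^ e" using exp_le by (intro power_mono) auto
  finally have "real e ^ e \<le> 3 ^ e * fact e" by (simp add: field_simps)
  then have "real e ^ e * real (n choose e) \<le> (3 ^ e * fact e) * real (n choose e)"
    by (intro mult_right_mono) auto
  also have "\<dots> = 3 ^ e * real ((n choose e) * fact e)" by simp
  also have "\<dots> \<le> 3 ^ e * real (n ^ e)"
    using binomial_fact_pow[of n e] by (intro mult_left_mono) (simp_all only: of_nat_le_iff zero_le_power zero_le_numeral)
  also have "\<dots> = (3 * real n / real e) ^ e * real e ^ e"
    using assms by (simp add: power_divide power_mult_distrib)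
  finally show ?thesis using assms by (simp add: mult.commute)
qed

text \<open>The two binomials multiply to at most \<open>(18 l^2 / e^2) ^ e\<close>. By
  \<open>small\<close> the base is at most \<open>\<sigma> / 2\<close>, so the powers of
  \<open>\<sigma>\<close> cancel and \<open>2 ^ - e\<close> remains.\<close>

lemma bad_gram_fraction:
  assumes "0 < e" "e \<le> l" "\<sigma> > 0" and small: "36 * real l ^ 2 \<le> real e ^ 2 * real \<sigma>"
  shows "real (card {g \<in> strings \<sigma> l. bad_gram x (l - e) g}) / real \<sigma> ^ l \<le> real (length x) / 2 ^ e"
proof -
  have "real (card {g \<in> strings \<sigma> l. bad_gram x (l - e) g}) \<le>
      real (length x * ((2 * l choose e) * ((l choose e) * \<sigma> ^ (l - e))))"
    using card_bad_grams[of "l - e" l e \<sigma> x] assms unfolding of_nat_le_iff by simp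
  also have "\<dots> = real (length x) * ((real (2 * l choose e) * real (l choose e)) * real \<sigma> ^ (l - e))"
    by simp
  also have "\<dots> \<le> real (length x) * (((3 * real (2 * l) / real e) ^ e * (3 * real l / real e) ^ e) * real \<sigma> ^ (l - e))"
    using assms by (intro mult_left_mono mult_right_mono mult_mono binomial_bound) auto
  also have "(3 * real (2 * l) / real e) ^ e * (3 * real l / real e) ^ e = (18 * real l ^ 2 / real e ^ 2) ^ e"
    by (simp add: power2_eq_square flip: power_mult_distrib)
  also have "real (length x) * ((18 * real l ^ 2 / real e ^ 2) ^ e * real \<sigma> ^ (l - e)) \<le>
      real (length x) * ((real \<sigma> / 2) ^ e * real \<sigma> ^ (l - e))"
    using assms by (intro mult_left_mono mult_right_mono power_mono) (auto simp: field_simps)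
  also have "\<dots> = real (length x) / 2 ^ e * real \<sigma> ^ l"
    using assms by (simp add: power_divide flip: power_add)
  finally show ?thesis using assms by (simp add: field_simps)
qed

section \<open>Program verification on the word RAM\<close>

text \<open>Evaluation without word size; on bounded states it agrees with \<open>rval\<close>
  wherever \<open>fits\<close> and \<open>reads_inside\<close> hold.\<close>

primrec val :: "nat list \<Rightarrow> state \<Rightarrow> rexp \<Rightarrow> nat" where
  "val inp s (Const c) = c"
| "val inp s Input_Length = length inp"
| "val inp s (Reg r) = regs s r"
| "val inp s (Mem e) = memory s (val inp s e)"
| "val inp s (Input e) = inp ! val inp s e"
| "val inp s (Binop f e1 e2) = apply_binop f (val inp s e1) (val inp s e2)"

primrec reads_inside :: "nat list \<Rightarrow> state \<Rightarrow> rexp \<Rightarrow> bool" where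
  "reads_inside inp s (Const c) = True"
| "reads_inside inp s Input_Length = True"
| "reads_inside inp s (Reg r) = True"
| "reads_inside inp s (Mem e) = reads_inside inp s e"
| "reads_inside inp s (Input e) = (reads_inside inp s e \<and> val inp s e < length inp)"
| "reads_inside inp s (Binop f e1 e2) = (reads_inside inp s e1 \<and> reads_inside inp s e2)"

text \<open>Bounds that are monotone in both arguments, although subtraction, division and remainder
  are not.\<close>

fun binop_bound :: "binop \<Rightarrow> nat \<Rightarrow> nat \<Rightarrow> nat" where
  "binop_bound Plus a b = a + b"
| "binop_bound Times a b = a * b"
| "binop_bound Minus a b = a"
| "binop_bound Div a b = a"
| "binop_bound Mod a b = a"
| "binop_bound Less a b = 1"
| "binop_bound Equals a b = 1"

text \<open>The bound depends only on a common bound \<open>H\<close> of all registers, memory cells and letters, so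
  that absence of overflow becomes a syntactic condition on programs.\<close>

primrec val_bound :: "nat \<Rightarrow> rexp \<Rightarrow> nat" where
  "val_bound H (Const c) = c"
| "val_bound H Input_Length = H"
| "val_bound H (Reg r) = H"
| "val_bound H (Mem e) = H"
| "val_bound H (Input e) = H"
| "val_bound H (Binop f e1 e2) = binop_bound f (val_bound H e1) (val_bound H e2)"

primrec fits :: "nat \<Rightarrow> nat \<Rightarrow> rexp \<Rightarrow> bool" where
  "fits W H (Const c) = (c < W)"
| "fits W H Input_Length = True"
| "fits W H (Reg r) = True"
| "fits W H (Mem e) = fits W H e"
| "fits W H (Input e) = fits W H e"
| "fits W H (Binop f e1 e2) =
     (fits W H e1 \<and> fits W H e2 \<and> binop_bound f (val_bound H e1) (val_bound H e2) < W)"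

definition state_bounded :: "nat \<Rightarrow> state \<Rightarrow> bool" where
  "state_bounded H s \<longleftrightarrow> (\<forall>r. regs s r < H) \<and> (\<forall>a. memory s a < H)"

lemma state_bounded_reg: "state_bounded H s \<Longrightarrow> regs s r < H"
  and state_bounded_memory: "state_bounded H s \<Longrightarrow> memory s a < H"
  by (auto simp: state_bounded_def)

lemma apply_binop_bound:
  "a \<le> a' \<Longrightarrow> b \<le> b' \<Longrightarrow> apply_binop f a b \<le> binop_bound f a' b'"
  by (cases f) (auto intro: add_mono mult_mono order_trans[OF div_le_dividend]
      order_trans[OF mod_less_eq_dividend])

definition set_reg :: "nat \<Rightarrow> nat \<Rightarrow> state \<Rightarrow> state" where
  "set_reg r v s = s\<lparr>regs := (regs s)(r := v)\<rparr>"

lemma set_reg_sel [simp]: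
  "regs (set_reg r v s) = (regs s)(r := v)" "memory (set_reg r v s) = memory s"
  "emitted (set_reg r v s) = emitted s"
  by (simp_all add: set_reg_def)

definition set_mem :: "nat \<Rightarrow> nat \<Rightarrow> state \<Rightarrow> state" where
  "set_mem a v s = s\<lparr>memory := (memory s)(a := v)\<rparr>"

lemma set_mem_sel [simp]:
  "regs (set_mem a v s) = regs s" "memory (set_mem a v s) = (memory s)(a := v)"
  "emitted (set_mem a v s) = emitted s"
  by (simp_all add: set_mem_def)

text \<open>The bound \<open>e\<close> is evaluated anew in every round; the proof rules require
  that it keeps its value.\<close>

definition For :: "nat \<Rightarrow> rexp \<Rightarrow> com \<Rightarrow> com" where
  "For r e c = Seq (Assign r (Const 0))
     (While (Binop Less (Reg r) e) (Seq c (Assign r (Binop Plus (Reg r) (Const 1)))))"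

text \<open>Two scales: stored values lie below \<open>H\<close>, intermediate ones below
  \<open>W\<close>. With \<open>W\<close> at least \<open>16 H^2\<close>, a product of two stored
  values fits even with small constants added to them.\<close>

locale ram =
  fixes W H :: nat and inp :: "nat list"
  assumes word_size: "16 * (H * H) \<le> W" and H_ge: "16 \<le> H"
    and input_bound: "length inp < H" "\<And>i. i < length inp \<Longrightarrow> inp ! i < H"
begin

lemma H_linear: "256 * H \<le> W"
proof -
  have "16 * H \<le> H * H" using H_ge by simp
  then show ?thesis using word_size by linarith
qed

lemma H_le_W: "H \<le> W"
  using H_linear by linarith

lemmas fits_arith = word_size H_linear H_ge

lemma rval_val:
  assumes "state_bounded H s" "fits W H e" "reads_inside inp s e"
  shows "rval W inp s e = Some (val inp s e) \<and> val inp s e \<le> val_bound H e"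
  using assms(2,3)
proof (induction e)
  case (Binop f e1 e2)
  then have IH: "rval W inp s e1 = Some (val inp s e1)" "val inp s e1 \<le> val_bound H e1"
    "rval W inp s e2 = Some (val inp s e2)" "val inp s e2 \<le> val_bound H e2" by auto
  have "apply_binop f (val inp s e1) (val inp s e2) \<le> binop_bound f (val_bound H e1) (val_bound H e2)"
    by (rule apply_binop_bound[OF IH(2,4)])
  moreover have "binop_bound f (val_bound H e1) (val_bound H e2) < W" using Binop.prems by simp
  ultimately show ?case using IH by (simp add: word_def)
next
  case (Reg r)
  show ?case using state_bounded_reg[OF assms(1), of r] H_le_W by (simp add: word_def)
next
  case (Mem e)
  show ?case using Mem state_bounded_memory[OF assms(1), of "val inp s e"] H_le_W by (simp add: word_def)
next
  case (Input e)
  show ?case using Input input_bound(2)[of "val inp s e"] H_le_W by (simp add: word_def)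
next
  case Input_Length
  show ?case using input_bound(1) H_le_W by (simp add: word_def)
qed (simp add: word_def)

section \<open>Weakest preconditions with running time\<close>

text \<open>Total correctness with the time as an argument of the postcondition. Preservation of the
  bound \<open>H\<close> is built in, so that overflow is settled by the syntactic check
  \<open>fits\<close>.\<close>

definition wp :: "com \<Rightarrow> state \<Rightarrow> (nat \<Rightarrow> state \<Rightarrow> bool) \<Rightarrow> bool" where
  "wp c s Q \<longleftrightarrow> (state_bounded H s \<longrightarrow> (\<exists>T s'. exec W inp c s T s' \<and> state_bounded H s' \<and> Q T s'))"

lemma wp_mono: "wp c s Q \<Longrightarrow> (\<And>T s'. state_bounded H s' \<Longrightarrow> Q T s' \<Longrightarrow> Q' T s') \<Longrightarrow> wp c s Q'"
  unfolding wp_def by blast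

lemma wp_Skip: "Q 1 s \<Longrightarrow> wp Skip s Q"
  unfolding wp_def using exec.Skip by blast

lemma wp_Assign:
  assumes "fits W H e" "reads_inside inp s e" "val inp s e = v" "state_bounded H s \<Longrightarrow> v < H"
    "Q (1 + rcost e) (set_reg r v s)"
  shows "wp (Assign r e) s Q"
  unfolding wp_def
proof
  assume b: "state_bounded H s"
  have "exec W inp (Assign r e) s (1 + rcost e) (s\<lparr>regs := (regs s)(r := v)\<rparr>)"
    using rval_val[OF b assms(1,2)] assms(3) by (intro exec.Assign) simp
  moreover have "state_bounded H (s\<lparr>regs := (regs s)(r := v)\<rparr>)"
    using b assms(4) by (simp add: state_bounded_def)
  ultimately show "\<exists>T s'. exec W inp (Assign r e) s T s' \<and> state_bounded H s' \<and> Q T s'"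
    using assms(5) unfolding set_reg_def by blast
qed

lemma wp_Store:
  assumes "fits W H e1" "reads_inside inp s e1" "fits W H e2" "reads_inside inp s e2"
    "val inp s e1 = a" "val inp s e2 = v" "state_bounded H s \<Longrightarrow> v < H"
    "Q (1 + rcost e1 + rcost e2) (set_mem a v s)"
  shows "wp (Store e1 e2) s Q"
  unfolding wp_def
proof
  assume b: "state_bounded H s"
  have "exec W inp (Store e1 e2) s (1 + rcost e1 + rcost e2) (s\<lparr>memory := (memory s)(a := v)\<rparr>)"
    using rval_val[OF b assms(1,2)] rval_val[OF b assms(3,4)] assms(5,6) by (intro exec.Store) simp_all
  moreover have "state_bounded H (s\<lparr>memory := (memory s)(a := v)\<rparr>)"
    using b assms(7) by (simp add: state_bounded_def)
  ultimately show "\<exists>T s'. exec W inp (Store e1 e2) s T s' \<and> state_bounded H s' \<and> Q T s'"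
    using assms(8) unfolding set_mem_def by blast
qed

lemma wp_Emit:
  assumes "fits W H e1" "reads_inside inp s e1" "fits W H e2" "reads_inside inp s e2"
    "val inp s e1 = a" "val inp s e2 = b"
    "Q (1 + rcost e1 + rcost e2) (s\<lparr>emitted := (a, b) # emitted s\<rparr>)"
  shows "wp (Emit e1 e2) s Q"
  unfolding wp_def
proof
  assume bd: "state_bounded H s"
  have "exec W inp (Emit e1 e2) s (1 + rcost e1 + rcost e2) (s\<lparr>emitted := (a, b) # emitted s\<rparr>)"
    using rval_val[OF bd assms(1,2)] rval_val[OF bd assms(3,4)] assms(5,6) by (intro exec.Emit) simp_all
  moreover have "state_bounded H (s\<lparr>emitted := (a, b) # emitted s\<rparr>)"
    using bd by (simp add: state_bounded_def)
  ultimately show "\<exists>T s'. exec W inp (Emit e1 e2) s T s' \<and> state_bounded H s' \<and> Q T s'"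
    using assms(7) by blast
qed

lemma wp_Seq:
  assumes "wp c1 s (\<lambda>T1 s1. wp c2 s1 (\<lambda>T2 s2. Q (1 + T1 + T2) s2))"
  shows "wp (Seq c1 c2) s Q"
  unfolding wp_def
proof
  assume b: "state_bounded H s"
  from assms b obtain T1 s1 where 1: "exec W inp c1 s T1 s1" "state_bounded H s1"
    "wp c2 s1 (\<lambda>T2 s2. Q (1 + T1 + T2) s2)" unfolding wp_def[of c1] by blast
  from 1(2,3) obtain T2 s2 where 2: "exec W inp c2 s1 T2 s2" "state_bounded H s2" "Q (1 + T1 + T2) s2"
    unfolding wp_def by blast
  show "\<exists>T s'. exec W inp (Seq c1 c2) s T s' \<and> state_bounded H s' \<and> Q T s'"
    using exec.Seq[OF 1(1) 2(1)] 2(2,3) by blast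
qed

lemma wp_Cond:
  assumes "fits W H e" "reads_inside inp s e"
    "val inp s e \<noteq> 0 \<Longrightarrow> wp c1 s (\<lambda>T. Q (1 + rcost e + T))"
    "val inp s e = 0 \<Longrightarrow> wp c2 s (\<lambda>T. Q (1 + rcost e + T))"
  shows "wp (Cond e c1 c2) s Q"
  unfolding wp_def
proof
  assume b: "state_bounded H s"
  have v: "rval W inp s e = Some (val inp s e)" using rval_val[OF b assms(1,2)] by simp
  show "\<exists>T s'. exec W inp (Cond e c1 c2) s T s' \<and> state_bounded H s' \<and> Q T s'"
  proof (cases "val inp s e = 0")
    case True
    with assms(4) b obtain T s' where "exec W inp c2 s T s'" "state_bounded H s'" "Q (1 + rcost e + T) s'"
      unfolding wp_def by blast
    with exec.Cond_False[of W inp s e c2 T s' c1] v True show ?thesis by auto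
  next
    case False
    with assms(3) b obtain T s' where "exec W inp c1 s T s'" "state_bounded H s'" "Q (1 + rcost e + T) s'"
      unfolding wp_def by blast
    with exec.Cond_True[OF v False] show ?thesis by blast
  qed
qed

lemma wp_Cond_True:
  assumes "fits W H e" "reads_inside inp s e" "val inp s e \<noteq> 0"
    "wp c1 s (\<lambda>T. Q (1 + rcost e + T))"
  shows "wp (Cond e c1 c2) s Q"
  using assms by (intro wp_Cond) auto

lemma wp_Cond_False:
  assumes "fits W H e" "reads_inside inp s e" "val inp s e = 0"
    "wp c2 s (\<lambda>T. Q (1 + rcost e + T))"
  shows "wp (Cond e c1 c2) s Q"
  using assms by (intro wp_Cond) auto

text \<open>The invariant speaks of the time already spent, so costs that vary from round to round
  can be summed; \<open>\<mu>\<close> ensures termination.\<close>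

lemma wp_While:
  fixes \<mu> :: "state \<Rightarrow> nat"
  assumes I: "I 0 s"
    and e: "\<And>T s. I T s \<Longrightarrow> state_bounded H s \<Longrightarrow> reads_inside inp s e" "fits W H e"
    and step: "\<And>T s. I T s \<Longrightarrow> state_bounded H s \<Longrightarrow> val inp s e \<noteq> 0 \<Longrightarrow>
      wp c s (\<lambda>T1 s1. \<mu> s1 < \<mu> s \<and> I (T + (1 + rcost e + T1)) s1)"
    and Q: "\<And>T s. I T s \<Longrightarrow> state_bounded H s \<Longrightarrow> val inp s e = 0 \<Longrightarrow> Q (T + (1 + rcost e)) s"
  shows "wp (While e c) s Q"
  unfolding wp_def
proof
  have "\<exists>T' s'. exec W inp (While e c) s T' s' \<and> state_bounded H s' \<and> Q (T + T') s'"
    if "I T s" "state_bounded H s" for T s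
    using that
  proof (induction "\<mu> s" arbitrary: s T rule: less_induct)
    case less
    have v: "rval W inp s e = Some (val inp s e)" using rval_val e less.prems by simp
    show ?case
    proof (cases "val inp s e = 0")
      case True
      with v have "exec W inp (While e c) s (1 + rcost e) s" by (intro exec.While_False) simp
      then show ?thesis using Q[OF less.prems True] less.prems(2) by blast
    next
      case False
      from step[OF less.prems False] less.prems(2) obtain T1 s1 where
        1: "exec W inp c s T1 s1" "state_bounded H s1" "\<mu> s1 < \<mu> s" "I (T + (1 + rcost e + T1)) s1"
        unfolding wp_def by blast
      from less.hyps[OF 1(3,4,2)] obtain T2 s2 where
        2: "exec W inp (While e c) s1 T2 s2" "state_bounded H s2" "Q (T + (1 + rcost e + T1) + T2) s2" by blast
      have "exec W inp (While e c) s (1 + rcost e + T1 + T2) s2"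
        by (rule exec.While_True[OF v False 1(1) 2(1)])
      moreover have "Q (T + (1 + rcost e + T1 + T2)) s2" using 2(3) by (simp add: add.assoc)
      ultimately show ?thesis using 2(2) by blast
    qed
  qed
  from this[OF I] show "state_bounded H s \<Longrightarrow> \<exists>T' s'. exec W inp (While e c) s T' s' \<and> state_bounded H s' \<and> Q T' s'"
    by simp
qed

text \<open>The 8 in \<open>step\<close> consists of the test without \<open>e\<close> (3), the
  sequencing (1) and the increment (4); the 6 in \<open>Q\<close> of the initialisation with its
  sequencing (3) and the last test (3).\<close>

lemma wp_For:
  assumes N: "N < H" and fits: "fits W H e"
    and base: "I 0 0 (set_reg r 0 s)"
    and counter: "\<And>i T s. I i T s \<Longrightarrow> i \<le> N \<Longrightarrow> regs s r = i \<and> val inp s e = N \<and> reads_inside inp s e"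
    and step: "\<And>i T s. i < N \<Longrightarrow> I i T s \<Longrightarrow> state_bounded H s \<Longrightarrow>
      wp c s (\<lambda>T1 s1. regs s1 r = i \<and>
        I (Suc i) (T + (T1 + rcost e + 8)) (set_reg r (Suc i) s1))"
    and Q: "\<And>T s. I N T s \<Longrightarrow> state_bounded H s \<Longrightarrow> Q (T + rcost e + 6) s"
  shows "wp (For r e c) s Q"
  unfolding For_def
proof (rule wp_Seq, rule wp_Assign)
  show "fits W H (Const 0)" "state_bounded H s \<Longrightarrow> 0 < H"
    using H_le_W H_ge by auto
  let ?b = "Binop Less (Reg r) e" and ?s0 = "set_reg r 0 s"
  show "wp (While ?b (Seq c (Assign r (Binop Plus (Reg r) (Const 1))))) ?s0
      (\<lambda>T2. Q (1 + (1 + rcost (Const 0)) + T2))"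
  proof (rule wp_While[where I = "\<lambda>T s. \<exists>i\<le>N. I i T s" and \<mu> = "\<lambda>s. N - regs s r"])
    show "\<exists>i\<le>N. I i 0 ?s0" using base by (intro exI[of _ 0]) simp
  next
    fix T s assume "\<exists>i\<le>N. I i T s"
    then show "reads_inside inp s ?b" using counter by fastforce
  next
    show "fits W H ?b" using fits H_le_W H_ge by simp
  next
    fix T s assume "\<exists>i\<le>N. I i T s" and b: "state_bounded H s" and v: "val inp s ?b \<noteq> 0"
    then obtain i where i: "i \<le> N" "I i T s" by blast
    from counter[OF i(2,1)] v have iN: "i < N" by (simp split: if_splits)
    have "Suc i < H" using iN N by simp
    have si: "regs s r = i" using counter[OF i(2,1)] by simp
    show "wp (Seq c (Assign r (Binop Plus (Reg r) (Const 1)))) s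
        (\<lambda>T1 s1. N - regs s1 r < N - regs s r \<and> (\<exists>i\<le>N. I i (T + (1 + rcost ?b + T1)) s1))"
    proof (rule wp_Seq, rule wp_mono[OF step[OF iN i(2) b]], elim conjE, rule wp_Assign)
      show "fits W H (Binop Plus (Reg r) (Const 1))" using fits_arith by simp
    next
      fix T1 s1
      assume *: "regs s1 r = i" "I (Suc i) (T + (T1 + rcost e + 8)) (set_reg r (Suc i) s1)"
      show "val inp s1 (Binop Plus (Reg r) (Const 1)) = Suc i" using * by simp
      show "Suc i < H" by fact
      let ?s2 = "set_reg r (Suc i) s1"
      have eqT: "T + (1 + rcost ?b + (1 + T1 + (1 + rcost (Binop Plus (Reg r) (Const 1))))) =
          T + (T1 + rcost e + 8)" by simp
      have "I (Suc i) (T + (1 + rcost ?b + (1 + T1 + (1 + rcost (Binop Plus (Reg r) (Const 1)))))) ?s2"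
        using *(2) unfolding eqT .
      moreover have "N - regs ?s2 r < N - regs s r" using iN si *(1) by simp
      moreover have "Suc i \<le> N" using iN by simp
      ultimately show "N - regs ?s2 r < N - regs s r \<and>
          (\<exists>i\<le>N. I i (T + (1 + rcost ?b + (1 + T1 + (1 + rcost (Binop Plus (Reg r) (Const 1)))))) ?s2)"
        by blast
    qed simp
  next
    fix T s assume "\<exists>i\<le>N. I i T s" and b: "state_bounded H s" and v: "val inp s ?b = 0"
    then obtain i where i: "i \<le> N" "I i T s" by blast
    from counter[OF i(2,1)] v have "\<not> i < N" by (auto split: if_splits)
    then have "I N T s" using i by simp
    from Q[OF this b] show "Q (1 + (1 + rcost (Const 0)) + (T + (1 + rcost ?b))) s"
      by (simp add: ac_simps numeral_eq_Suc)
  qed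
qed simp_all

lemma wp_For_time:
  assumes N: "N < H" and fits: "fits W H e"
    and base: "J 0 (set_reg r 0 s)"
    and counter: "\<And>i s. J i s \<Longrightarrow> i \<le> N \<Longrightarrow> regs s r = i \<and> val inp s e = N \<and> reads_inside inp s e"
    and step: "\<And>i s. i < N \<Longrightarrow> J i s \<Longrightarrow> state_bounded H s \<Longrightarrow>
      wp c s (\<lambda>T s1. regs s1 r = i \<and> T \<le> B \<and> J (Suc i) (set_reg r (Suc i) s1))"
    and Q: "\<And>T s. J N s \<Longrightarrow> state_bounded H s \<Longrightarrow> T \<le> N * (B + rcost e + 8) + rcost e + 6 \<Longrightarrow> Q T s"
  shows "wp (For r e c) s Q"
proof (rule wp_For[where I = "\<lambda>i T s. T \<le> i * (B + rcost e + 8) \<and> J i s", OF N fits])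
  fix i T s assume "i < N" and I: "T \<le> i * (B + rcost e + 8) \<and> J i s" and "state_bounded H s"
  then show "wp c s (\<lambda>T1 s1. regs s1 r = i \<and> T + (T1 + rcost e + 8) \<le> Suc i * (B + rcost e + 8) \<and>
      J (Suc i) (set_reg r (Suc i) s1))"
    by (intro wp_mono[OF step]) auto
qed (use base counter Q in auto)

text \<open>For the loops of the preprocessing, whose time is not counted.\<close>

lemma wp_For_plain:
  assumes N: "N < H" and fits: "fits W H e"
    and base: "J 0 (set_reg r 0 s)"
    and counter: "\<And>i s. J i s \<Longrightarrow> i \<le> N \<Longrightarrow> regs s r = i \<and> val inp s e = N \<and> reads_inside inp s e"
    and step: "\<And>i s. i < N \<Longrightarrow> J i s \<Longrightarrow> state_bounded H s \<Longrightarrow>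
      wp c s (\<lambda>T s1. regs s1 r = i \<and> J (Suc i) (set_reg r (Suc i) s1))"
    and Q: "\<And>T s. J N s \<Longrightarrow> state_bounded H s \<Longrightarrow> Q T s"
  shows "wp (For r e c) s Q"
  by (rule wp_For[where I = "\<lambda>i T s. J i s"]) (use assms in auto)

lemma set_reg_same: "set_reg r (regs s r) s = s"
  by (simp add: set_reg_def)

end

section \<open>The algorithm\<close>

text \<open>The dynamic programming table is indexed by suffixes, because \<open>lev\<close> recurses on the first
  letters: cell \<open>c\<close> belongs to the suffixes of length \<open>c div (|v| + 1)\<close> of \<open>u\<close> and
  \<open>c mod (|v| + 1)\<close> of \<open>v\<close>.\<close>

definition dp_cell :: "'a list \<Rightarrow> 'a list \<Rightarrow> nat \<Rightarrow> nat" where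
  "dp_cell u v c = lev (drop (length u - c div Suc (length v)) u) (drop (length v - c mod Suc (length v)) v)"

lemma lev_le_length: "lev u v \<le> length u + length v"
  by (induction u v rule: lev.induct) auto

lemma dp_cell_le: "dp_cell u v c \<le> length u + length v"
proof -
  have "dp_cell u v c \<le> length (drop (length u - c div Suc (length v)) u) + length (drop (length v - c mod Suc (length v)) v)"
    unfolding dp_cell_def by (rule lev_le_length)
  also have "\<dots> \<le> length u + length v" by (intro add_mono) simp_all
  finally show ?thesis .
qed

lemma dp_cell_border:
  assumes "c < Suc (length u) * Suc (length v)"
    "c div Suc (length v) = 0 \<or> c mod Suc (length v) = 0"
  shows "dp_cell u v c = c div Suc (length v) + c mod Suc (length v)"
proof -
  have "c div Suc (length v) < Suc (length u)" using assms(1) by (simp add: less_mult_imp_div_less)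
  moreover have "c mod Suc (length v) < Suc (length v)" by simp
  ultimately show ?thesis using assms(2) unfolding dp_cell_def
    by (elim disjE) (simp_all add: less_Suc_eq_le)
qed

text \<open>In row-major order with rows of length \<open>Suc (length v)\<close>, the cells required
  by the recursion of \<open>lev\<close> lie one row back, one cell back, and both.\<close>

lemma dp_cell_step:
  fixes u v :: "'a list" and c i j :: nat
  assumes i_def: "c div Suc (length v) = i" and j_def: "c mod Suc (length v) = j"
    and "c < Suc (length u) * Suc (length v)" "i \<noteq> 0" "j \<noteq> 0"
  shows "dp_cell u v c = min (Suc (dp_cell u v (c - Suc (length v))))
      (min (Suc (dp_cell u v (c - 1)))
        (dp_cell u v (c - Suc (Suc (length v))) + of_bool (u ! (length u - i) \<noteq> v ! (length v - j))))"
    and "Suc (length v) < c" "1 \<le> i" "i \<le> length u" "1 \<le> j" "j \<le> length v"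
proof -
  let ?w = "Suc (length v)"
  have c: "c = i * ?w + j" using div_mult_mod_eq[of c ?w] by (simp only: i_def j_def)
  show i: "1 \<le> i" "i \<le> length u"
    using assms(4) less_mult_imp_div_less[OF assms(3)] by (simp_all add: i_def)
  have jw: "j < ?w" unfolding j_def[symmetric] by simp
  then show j: "1 \<le> j" "j \<le> length v" using assms(5) by simp_all
  obtain i' where i': "i = Suc i'" using i by (cases i) auto
  obtain j' where j': "j = Suc j'" using j by (cases j) auto
  show "?w < c" unfolding c i' using j by simp
  have e1: "c - ?w = i' * ?w + j" "c - 1 = i * ?w + j'" "c - Suc ?w = i' * ?w + j'"
    unfolding c i' j' by simp_all
  have "(a * w + b) div w = a \<and> (a * w + b) mod w = b" if "b < w" for a b w :: nat
    using that by simp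
  note dm = this[THEN conjunct1] this[THEN conjunct2]
  have jw': "j' < ?w" using jw j' by simp
  have du: "drop (length u - i) u = u ! (length u - i) # drop (length u - i') u"
    using i i' by (subst Cons_nth_drop_Suc[symmetric]) (auto simp: Suc_diff_Suc)
  have dv: "drop (length v - j) v = v ! (length v - j) # drop (length v - j') v"
    using j j' by (subst Cons_nth_drop_Suc[symmetric]) (auto simp: Suc_diff_Suc)
  have "dp_cell u v c = lev (drop (length u - i) u) (drop (length v - j) v)"
    unfolding dp_cell_def i_def j_def ..
  moreover have "dp_cell u v (c - ?w) = lev (drop (length u - i') u) (drop (length v - j) v)"
    unfolding dp_cell_def e1 dm[OF jw] ..
  moreover have "dp_cell u v (c - 1) = lev (drop (length u - i) u) (drop (length v - j') v)"
    unfolding dp_cell_def e1 dm[OF jw'] ..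
  moreover have "dp_cell u v (c - Suc ?w) = lev (drop (length u - i') u) (drop (length v - j') v)"
    unfolding dp_cell_def e1 dm[OF jw'] ..
  moreover have "lev (drop (length u - i) u) (drop (length v - j) v) =
      min (Suc (lev (drop (length u - i') u) (drop (length v - j) v)))
        (min (Suc (lev (drop (length u - i) u) (drop (length v - j') v)))
          (lev (drop (length u - i') u) (drop (length v - j') v) + of_bool (u ! (length u - i) \<noteq> v ! (length v - j))))"
    unfolding du dv lev.simps ..
  ultimately show "dp_cell u v c = min (Suc (dp_cell u v (c - ?w)))
      (min (Suc (dp_cell u v (c - 1)))
        (dp_cell u v (c - Suc ?w) + of_bool (u ! (length u - i) \<noteq> v ! (length v - j))))"
    by (simp only:)
qed

lemma dp_cell_last: "dp_cell u v (Suc (length u) * Suc (length v) - 1) = lev u v"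
proof -
  have e: "Suc (length u) * Suc (length v) - 1 = length u * Suc (length v) + length v" by simp
  show ?thesis unfolding dp_cell_def e by (simp only: div_mult_self3 mod_mult_self3) simp
qed

text \<open>Register 0 is where \<open>initial_state\<close> puts the threshold.\<close>

abbreviation (input) "rK \<equiv> 0::nat"
abbreviation (input) "rM \<equiv> 25::nat"
abbreviation (input) "rL \<equiv> 2::nat"
abbreviation (input) "rP \<equiv> 3::nat"
abbreviation (input) "rLen \<equiv> 4::nat"
abbreviation (input) "rN \<equiv> 5::nat"
abbreviation (input) "rTau \<equiv> 6::nat"
abbreviation (input) "rQ \<equiv> 7::nat"
abbreviation (input) "rF \<equiv> 8::nat"
abbreviation (input) "rW \<equiv> 9::nat"
abbreviation (input) "rS \<equiv> 10::nat"
abbreviation (input) "rX \<equiv> 11::nat"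
abbreviation (input) "rU \<equiv> 12::nat"
abbreviation (input) "rV \<equiv> 13::nat"
abbreviation (input) "rST \<equiv> 14::nat"
abbreviation (input) "rC \<equiv> 15::nat"
abbreviation (input) "rD \<equiv> 16::nat"
abbreviation (input) "rG \<equiv> 17::nat"
abbreviation (input) "rZ \<equiv> 18::nat"
abbreviation (input) "rPos \<equiv> 19::nat"
abbreviation (input) "rBad \<equiv> 20::nat"
abbreviation (input) "rA \<equiv> 21::nat"
abbreviation (input) "rI \<equiv> 22::nat"
abbreviation (input) "rJ \<equiv> 23::nat"
abbreviation (input) "rE \<equiv> 24::nat"

text \<open>The memory holds four interleaved arrays: cell \<open>a\<close> of array \<open>r\<close> has address \<open>4 a + r\<close>.
  Array 0 is the pattern, array 1 the dynamic programming table, array 2 the powers of the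
  alphabet size and array 3 the table of bad grams.\<close>

definition addr :: "nat \<Rightarrow> rexp \<Rightarrow> rexp" where
  "addr r e = Binop Plus (Binop Times (Const 4) e) (Const r)"

text \<open>The first letter of the suffix of length \<open>rJ\<close> of the circular factor that
  starts at \<open>rST\<close> and has length \<open>rV\<close>.\<close>

definition pattern_letter :: rexp where
  "pattern_letter = Mem (addr 0 (Binop Mod (Binop Plus (Reg rST) (Binop Minus (Reg rV) (Reg rJ))) (Reg rM)))"

definition min_cmd :: com where
  "min_cmd = Cond (Binop Less (Reg rE) (Reg rD)) (Assign rD (Reg rE)) Skip"

text \<open>\<open>eu\<close> abstracts from the origin of the first string: digits of a gram code
  in the preprocessing, letters of the text in the search. The product of \<open>rI\<close> and
  \<open>rJ\<close> acts as a conjunction, and 1 minus the equality test is the cost of a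
  substitution.\<close>

definition dp_body :: "rexp \<Rightarrow> com" where
  "dp_body eu =
    Seq (Assign rI (Binop Div (Reg rC) (Binop Plus (Reg rV) (Const 1))))
    (Seq (Assign rJ (Binop Mod (Reg rC) (Binop Plus (Reg rV) (Const 1))))
    (Seq (Cond (Binop Times (Reg rI) (Reg rJ))
      (Seq (Assign rD (Binop Plus (Mem (addr 1 (Binop Minus (Reg rC) (Binop Plus (Reg rV) (Const 1))))) (Const 1)))
      (Seq (Assign rE (Binop Plus (Mem (addr 1 (Binop Minus (Reg rC) (Const 1)))) (Const 1)))
      (Seq min_cmd
      (Seq (Assign rE (Binop Plus (Mem (addr 1 (Binop Minus (Reg rC) (Binop Plus (Reg rV) (Const 2)))))
              (Binop Minus (Const 1) (Binop Equals eu pattern_letter))))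
           min_cmd))))
      (Assign rD (Binop Plus (Reg rI) (Reg rJ))))
    (Store (addr 1 (Reg rC)) (Reg rD))))"

definition dp :: "rexp \<Rightarrow> com" where
  "dp eu = For rC (Binop Times (Binop Plus (Reg rU) (Const 1)) (Binop Plus (Reg rV) (Const 1))) (dp_body eu)"

definition dp_frame :: "state \<Rightarrow> state \<Rightarrow> bool" where
  "dp_frame s s' \<longleftrightarrow> (\<forall>r. r \<notin> {rC, rD, rI, rJ, rE} \<longrightarrow> regs s' r = regs s r) \<and>
     (\<forall>a. a mod 4 \<noteq> 1 \<longrightarrow> memory s' a = memory s a) \<and> emitted s' = emitted s"

lemma dp_frame_trans: "dp_frame s s' \<Longrightarrow> dp_frame s' s'' \<Longrightarrow> dp_frame s s''"
  by (simp add: dp_frame_def)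

context ram
begin

lemma fits_dp:
  "fits W H (Binop Div (Reg rC) (Binop Plus (Reg rV) (Const 1)))"
  "fits W H (Binop Mod (Reg rC) (Binop Plus (Reg rV) (Const 1)))"
  "fits W H (Binop Times (Reg rI) (Reg rJ))"
  "fits W H (Binop Plus (Mem (addr 1 (Binop Minus (Reg rC) (Binop Plus (Reg rV) (Const 1))))) (Const 1))"
  "fits W H (Binop Plus (Mem (addr 1 (Binop Minus (Reg rC) (Const 1)))) (Const 1))"
  "fits W H (Binop Less (Reg rE) (Reg rD))"
  "fits W H (Reg r)"
  "fits W H (Binop Plus (Reg rI) (Reg rJ))"
  "fits W H (addr 1 (Reg rC))"
  "fits W H eu \<Longrightarrow> fits W H (Binop Plus (Mem (addr 1 (Binop Minus (Reg rC) (Binop Plus (Reg rV) (Const 2)))))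
              (Binop Minus (Const 1) (Binop Equals eu pattern_letter)))"
  "fits W H (Binop Times (Binop Plus (Reg rU) (Const 1)) (Binop Plus (Reg rV) (Const 1)))"
  using fits_arith by (simp_all add: addr_def pattern_letter_def)

lemma wp_min_cmd:
  assumes "regs s rE = p" "regs s rD = q" and Q: "\<And>T. T \<le> 6 \<Longrightarrow> Q T (set_reg rD (min p q) s)"
  shows "wp min_cmd s Q"
  unfolding min_cmd_def
proof (rule wp_Cond[OF fits_dp(6)])
  assume "val inp s (Binop Less (Reg rE) (Reg rD)) \<noteq> 0"
  then have "min p q = p" using assms by (simp split: if_splits)
  then have Q': "Q T (set_reg rD p s)" if "T \<le> 6" for T using Q[OF that] by simp
  show "wp (Assign rD (Reg rE)) s (\<lambda>T. Q (1 + rcost (Binop Less (Reg rE) (Reg rD)) + T))"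
    using state_bounded_reg[of H s rE]
    by (intro wp_Assign[where v = p] fits_dp) (auto intro: Q' simp: assms(1))
next
  assume "val inp s (Binop Less (Reg rE) (Reg rD)) = 0"
  then have "min p q = q" using assms by (simp split: if_splits)
  then have Q': "Q T s" if "T \<le> 6" for T using Q[OF that] assms(2) set_reg_same[of rD s] by simp
  show "wp Skip s (\<lambda>T. Q (1 + rcost (Binop Less (Reg rE) (Reg rD)) + T))"
    by (intro wp_Skip) (simp add: Q')
qed simp_all

lemma wp_dp_body_border:
  assumes regs: "regs s rC = c" "regs s rV = n" and d: "c div Suc n = i" "c mod Suc n = j"
    and b: "i < H" "j < H" "i + j < H" "i * j = 0" and eu: "fits W H eu"
    and Q: "\<And>T. T \<le> 150 + rcost eu \<Longrightarrow>
      Q T (set_mem (4 * c + 1) (i + j) (set_reg rD (i + j) (set_reg rJ j (set_reg rI i s))))"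
  shows "wp (dp_body eu) s Q"
  unfolding dp_body_def
  apply (rule wp_Seq, rule wp_Assign[where v = i], rule fits_dp, simp, simp add: regs d, rule b)
  apply (rule wp_Seq, rule wp_Assign[where v = j], rule fits_dp, simp, simp add: regs d, rule b)
  apply (rule wp_Seq, rule wp_Cond_False, rule fits_dp, simp, simp only: val.simps apply_binop.simps, simp add: b(4)[simplified])
  apply (rule wp_Assign[where v = "i + j"], rule fits_dp, simp, simp, rule b)
  apply (rule wp_Store[where a = "4 * c + 1" and v = "i + j"], rule fits_dp, simp add: addr_def,
      rule fits_dp, simp, simp add: addr_def regs, simp, rule b)
  apply (rule Q, simp add: addr_def)
  done

text \<open>\<open>eu\<close> is evaluated after scratch registers have changed, so its value is
  assumed for all states within \<open>dp_frame\<close>. The final content of \<open>rE\<close> is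
  left open.\<close>

lemma wp_dp_body_step:
  assumes regs: "regs s rC = c" "regs s rV = n" and d: "c div Suc n = i" "c mod Suc n = j"
    and b: "i < H" "j < H" "i \<noteq> 0" "j \<noteq> 0" and eu: "fits W H eu"
    and c: "memory s (4 * (c - Suc n) + 1) = d1" "memory s (4 * (c - 1) + 1) = d2"
      "memory s (4 * (c - Suc (Suc n)) + 1) = d3" "Suc d1 < H" "Suc d2 < H" "Suc d3 < H"
    and eu_val: "\<And>s'. dp_frame s s' \<Longrightarrow> regs s' rI = i \<Longrightarrow> val inp s' eu = a \<and> reads_inside inp s' eu"
    and ev_val: "memory s (4 * ((regs s rST + (n - j)) mod regs s rM)) = b"
    and x: "x = min (Suc d1) (min (Suc d2) (d3 + of_bool (a \<noteq> b)))"
    and Q: "\<And>T e. T \<le> 150 + rcost eu \<Longrightarrow>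
      Q T (set_mem (4 * c + 1) x (set_reg rD x (set_reg rE e (set_reg rD (min (Suc d2) (Suc d1))
        (set_reg rE (Suc d2) (set_reg rD (Suc d1) (set_reg rJ j (set_reg rI i s))))))))"
  shows "wp (dp_body eu) s Q"
proof -
  define e where "e = d3 + of_bool (a \<noteq> b)"
  have eH: "e < H" using c(6) unfolding e_def by (cases "a = b") auto
  define s1 where "s1 = set_reg rD (min (Suc d2) (Suc d1)) (set_reg rE (Suc d2) (set_reg rD (Suc d1) (set_reg rJ j (set_reg rI i s))))"
  have fr: "dp_frame s s1" by (simp add: dp_frame_def s1_def)
  have s1: "regs s1 rC = c" "regs s1 rV = n" "regs s1 rI = i" "regs s1 rJ = j" "regs s1 rST = regs s rST"
    "regs s1 rM = regs s rM" "memory s1 = memory s" "regs s1 rD = min (Suc d2) (Suc d1)"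
    using regs by (simp_all add: s1_def)
  note a = eu_val[OF fr s1(3)]
  have x': "x = min e (min (Suc d2) (Suc d1))" using x by (simp add: e_def min.commute min.left_commute)
  have "x \<le> e" unfolding x' by simp
  then have xH: "x < H" using eH by linarith
  show ?thesis
    unfolding dp_body_def
    apply (rule wp_Seq, rule wp_Assign[where v = i], rule fits_dp, simp, simp add: regs d, rule b)
    apply (rule wp_Seq, rule wp_Assign[where v = j], rule fits_dp, simp, simp add: regs d, rule b)
    apply (rule wp_Seq, rule wp_Cond_True, rule fits_dp, simp, simp add: b)
    apply (rule wp_Seq, rule wp_Assign[where v = "Suc d1"], rule fits_dp, simp add: addr_def, simp add: regs addr_def c(1)[simplified], rule c)
    apply (rule wp_Seq, rule wp_Assign[where v = "Suc d2"], rule fits_dp, simp add: addr_def, simp add: regs addr_def c(2)[simplified], rule c)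
    apply (rule wp_Seq, rule wp_min_cmd[where p = "Suc d2" and q = "Suc d1"], simp, simp)
    apply (fold s1_def)
    apply (rule wp_Seq, rule wp_Assign[where v = e], rule fits_dp, rule eu, simp add: addr_def pattern_letter_def a)
    subgoal by (auto simp: addr_def pattern_letter_def a s1 c(3)[simplified] ev_val[simplified] e_def)
    apply (rule eH)
    apply (rule wp_min_cmd[where p = e and q = "min (Suc d2) (Suc d1)"], simp, simp add: s1, fold x')
    apply (rule wp_Store[where a = "4 * c + 1" and v = x], rule fits_dp, simp add: addr_def,
        rule fits_dp, simp, simp add: addr_def s1, simp, rule xH)
    apply (unfold s1_def)
    apply (rule Q, simp add: addr_def pattern_letter_def)
    done
qed

text \<open>\<open>rD\<close> keeps the cell computed last, so after the loop it holds the distance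
  itself.\<close>

definition dp_inv :: "state \<Rightarrow> nat list \<Rightarrow> nat list \<Rightarrow> nat \<Rightarrow> state \<Rightarrow> bool" where
  "dp_inv s u v c s' \<longleftrightarrow> dp_frame s s' \<and> regs s' rC = c \<and>
     (\<forall>c'<c. memory s' (4 * c' + 1) = dp_cell u v c') \<and> (0 < c \<longrightarrow> regs s' rD = dp_cell u v (c - 1))"

lemma dp_inv_step:
  assumes inv: "dp_inv s u v c s'" and fr: "dp_frame s' s''"
    and C: "regs s'' rC = c" "regs s'' rD = dp_cell u v c"
    and mem: "memory s'' = (memory s')(4 * c + 1 := dp_cell u v c)"
  shows "dp_inv s u v (Suc c) (set_reg rC (Suc c) s'')"
proof -
  have "dp_frame s'' (set_reg rC (Suc c) s'')" by (simp add: dp_frame_def)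
  then have "dp_frame s (set_reg rC (Suc c) s'')"
    using inv fr dp_frame_trans unfolding dp_inv_def by blast
  then show ?thesis using inv C mem by (auto simp: dp_inv_def less_Suc_eq)
qed

text \<open>A cell costs \<open>150 + rcost eu\<close> for the body and 15 for the loop; the
  remaining 13 time units are absorbed because there is at least one cell.\<close>

lemma wp_dp:
  assumes big: "Suc (length u) * Suc (length v) < H"
    and regs: "regs s rU = length u" "regs s rV = length v"
    and eu: "fits W H eu" "\<And>s' i. dp_frame s s' \<Longrightarrow> 1 \<le> i \<Longrightarrow> i \<le> length u \<Longrightarrow> regs s' rI = i \<Longrightarrow>
       val inp s' eu = u ! (length u - i) \<and> reads_inside inp s' eu"
    and v: "\<And>j. j < length v \<Longrightarrow> memory s (4 * ((regs s rST + j) mod regs s rM)) = v ! j"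
    and Q: "\<And>T s'. T \<le> Suc (length u) * Suc (length v) * (200 + rcost eu) \<Longrightarrow> dp_frame s s' \<Longrightarrow>
       regs s' rD = lev u v \<Longrightarrow> Q T s'"
  shows "wp (dp eu) s Q"
  unfolding dp_def
proof (rule wp_For_time[where N = "Suc (length u) * Suc (length v)" and J = "dp_inv s u v" and B = "150 + rcost eu"])
  let ?N = "Suc (length u) * Suc (length v)"
  let ?e = "Binop Times (Binop Plus (Reg rU) (Const 1)) (Binop Plus (Reg rV) (Const 1))"
  show "?N < H" by (rule big)
  show "fits W H ?e" by (rule fits_dp)
  show "dp_inv s u v 0 (set_reg rC 0 s)" by (simp add: dp_inv_def dp_frame_def)
  fix c s' assume inv: "dp_inv s u v c s'"
  then have fr: "dp_frame s s'" and C: "regs s' rC = c"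
    and table: "\<And>c'. c' < c \<Longrightarrow> memory s' (4 * c' + 1) = dp_cell u v c'" by (auto simp: dp_inv_def)
  have keep: "regs s' r = regs s r" if "r \<notin> {rC, rD, rI, rJ, rE}" for r
    using fr that by (simp add: dp_frame_def)
  have V: "regs s' rV = length v" "regs s' rU = length u" using keep regs by simp_all
  show "regs s' rC = c \<and> val inp s' ?e = ?N \<and> reads_inside inp s' ?e" using C V by simp
  assume c: "c < ?N"
  let ?i = "c div Suc (length v)" and ?j = "c mod Suc (length v)"
  have cH: "c < H" using c big by simp
  have iH: "?i < H" and jH: "?j < H"
    using cH by (meson div_le_dividend le_less_trans, meson cH mod_less_eq_dividend le_less_trans)
  have "length u + length v + 1 \<le> ?N" by simp
  then have uvH: "length u + length v + 1 < H" using big by linarith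
  then have cell: "Suc (dp_cell u v c') < H" for c' using dp_cell_le[of u v c'] by linarith
  show "wp (dp_body eu) s' (\<lambda>T s1. regs s1 rC = c \<and> T \<le> 150 + rcost eu \<and> dp_inv s u v (Suc c) (set_reg rC (Suc c) s1))"
  proof (cases "?i = 0 \<or> ?j = 0")
    case True
    have v': "dp_cell u v c = ?i + ?j" by (rule dp_cell_border[OF c True])
    have "?i + ?j < H" using cell[of c] unfolding v' by linarith
    moreover have "?i * ?j = 0" using True by auto
    ultimately show ?thesis
    proof (rule wp_dp_body_border[OF C V(1) refl refl iH jH _ _ eu(1)])
      fix T assume T: "T \<le> 150 + rcost eu"
      let ?s = "set_mem (4 * c + 1) (?i + ?j) (set_reg rD (?i + ?j) (set_reg rJ ?j (set_reg rI ?i s')))"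
      have "dp_inv s u v (Suc c) (set_reg rC (Suc c) ?s)"
        by (rule dp_inv_step[OF inv]) (use C v' in \<open>auto simp: dp_frame_def mod_simps\<close>)
      then show "regs ?s rC = c \<and> T \<le> 150 + rcost eu \<and> dp_inv s u v (Suc c) (set_reg rC (Suc c) ?s)"
        using T C by simp
    qed
  next
    case False
    then have ij: "?i \<noteq> 0" "?j \<noteq> 0" by auto
    note step = dp_cell_step[OF refl refl c ij]
    let ?d1 = "dp_cell u v (c - Suc (length v))" and ?d2 = "dp_cell u v (c - 1)"
      and ?d3 = "dp_cell u v (c - Suc (Suc (length v)))"
    let ?x = "dp_cell u v c"
    show ?thesis
    proof (rule wp_dp_body_step[OF C V(1) refl refl iH jH ij eu(1), where ?d1.0 = ?d1 and ?d2.0 = ?d2 and ?d3.0 = ?d3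
          and a = "u ! (length u - ?i)" and b = "v ! (length v - ?j)" and x = ?x])
      show "memory s' (4 * (c - Suc (length v)) + 1) = ?d1" "memory s' (4 * (c - 1) + 1) = ?d2"
        "memory s' (4 * (c - Suc (Suc (length v))) + 1) = ?d3"
        using step(2) by (intro table; linarith)+
      show "Suc ?d1 < H" "Suc ?d2 < H" "Suc ?d3 < H" by (rule cell)+
      show "?x = min (Suc ?d1) (min (Suc ?d2) (?d3 + of_bool (u ! (length u - ?i) \<noteq> v ! (length v - ?j))))"
        by (rule step(1))
      have "memory s' (4 * a) = memory s (4 * a)" for a using fr by (simp add: dp_frame_def)
      moreover have "length v - ?j < length v" using step(5,6) by linarith
      ultimately show "memory s' (4 * ((regs s' rST + (length v - ?j)) mod regs s' rM)) = v ! (length v - ?j)"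
        using v[of "length v - ?j"] keep by simp
      show "val inp s'' eu = u ! (length u - ?i) \<and> reads_inside inp s'' eu"
        if "dp_frame s' s''" "regs s'' rI = ?i" for s''
        using eu(2)[OF dp_frame_trans[OF fr that(1)] step(3,4) that(2)] .
      fix T e assume T: "T \<le> 150 + rcost eu"
      let ?s = "set_mem (4 * c + 1) ?x (set_reg rD ?x (set_reg rE e (set_reg rD (min (Suc ?d2) (Suc ?d1))
        (set_reg rE (Suc ?d2) (set_reg rD (Suc ?d1) (set_reg rJ ?j (set_reg rI ?i s')))))))"
      have "dp_inv s u v (Suc c) (set_reg rC (Suc c) ?s)"
        by (rule dp_inv_step[OF inv]) (use C in \<open>auto simp: dp_frame_def\<close>)
      then show "regs ?s rC = c \<and> T \<le> 150 + rcost eu \<and> dp_inv s u v (Suc c) (set_reg rC (Suc c) ?s)"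
        using T C by simp
    qed
  qed
next
  fix T s' assume inv: "dp_inv s u v (Suc (length u) * Suc (length v)) s'"
    and T: "T \<le> Suc (length u) * Suc (length v) * (150 + rcost eu + rcost (Binop Times (Binop Plus (Reg rU) (Const 1)) (Binop Plus (Reg rV) (Const 1))) + 8)
      + rcost (Binop Times (Binop Plus (Reg rU) (Const 1)) (Binop Plus (Reg rV) (Const 1))) + 6"
  let ?N = "Suc (length u) * Suc (length v)"
  have "T \<le> ?N * (165 + rcost eu) + 13 * 1" using T by (simp add: algebra_simps)
  also have "\<dots> \<le> ?N * (165 + rcost eu) + 13 * ?N" by (intro add_left_mono mult_le_mono2) simp
  also have "\<dots> \<le> ?N * (200 + rcost eu)" by (simp add: algebra_simps)
  finally show "Q T s'" using inv by (intro Q) (auto simp: dp_inv_def dp_cell_last[simplified])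
qed

end

lemma addr_neq [simp]:
  fixes a b :: nat
  shows "4 * a \<noteq> Suc (4 * b)" "Suc (4 * b) \<noteq> 4 * a" "4 * a \<noteq> Suc (Suc (4 * b))"
    "Suc (Suc (4 * b)) \<noteq> 4 * a" "4 * a \<noteq> 4 * b + 3" "4 * b + 3 \<noteq> 4 * a"
  by presburger+

lemma addr_mod [simp]:
  fixes a :: nat
  shows "Suc (Suc (4 * a)) mod 4 = 2" "(4 * a + 3) mod 4 = 3"
  by presburger+

section \<open>Gram codes and preprocessing\<close>

text \<open>The most significant digit comes first, so that Horner's scheme yields the code of a
  gram while it is read from left to right.\<close>

definition digits :: "nat \<Rightarrow> nat \<Rightarrow> nat \<Rightarrow> nat list" where
  "digits \<sigma> l g = map (\<lambda>a. g div \<sigma> ^ (l - 1 - a) mod \<sigma>) [0..<l]"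

lemma length_digits [simp]: "length (digits \<sigma> l g) = l"
  by (simp add: digits_def)

lemma digits_nth: "1 \<le> i \<Longrightarrow> i \<le> l \<Longrightarrow> digits \<sigma> l g ! (l - i) = g div \<sigma> ^ (i - 1) mod \<sigma>"
  by (simp add: digits_def)

text \<open>The logarithm of \<open>m\<close> to base \<open>\<sigma>\<close>, rounded up and at
  least 1; the latter keeps grams non-empty for \<open>m = 1\<close>.\<close>

definition gram_exp :: "nat \<Rightarrow> nat \<Rightarrow> nat" where
  "gram_exp \<sigma> m = (LEAST L. 1 \<le> L \<and> m \<le> \<sigma> ^ L)"

lemma gram_exp:
  assumes "2 \<le> \<sigma>" "1 \<le> m"
  shows "1 \<le> gram_exp \<sigma> m" "m \<le> \<sigma> ^ gram_exp \<sigma> m" "\<sigma> ^ gram_exp \<sigma> m \<le> \<sigma> * m"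
    "\<And>L. 1 \<le> L \<Longrightarrow> L < gram_exp \<sigma> m \<Longrightarrow> \<sigma> ^ L < m"
proof -
  let ?P = "\<lambda>L. 1 \<le> L \<and> m \<le> \<sigma> ^ L"
  have "m < 2 ^ m" by (rule less_exp)
  also have "(2::nat) ^ m \<le> \<sigma> ^ m" using assms(1) by (rule power_mono) simp
  finally have "?P m" using assms(2) by simp
  then have P: "?P (gram_exp \<sigma> m)" unfolding gram_exp_def by (rule LeastI)
  show "1 \<le> gram_exp \<sigma> m" "m \<le> \<sigma> ^ gram_exp \<sigma> m" using P by auto
  show small: "\<sigma> ^ L < m" if "1 \<le> L" "L < gram_exp \<sigma> m" for L
    using not_less_Least[of L ?P] that unfolding gram_exp_def by auto
  show "\<sigma> ^ gram_exp \<sigma> m \<le> \<sigma> * m"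
  proof (cases "gram_exp \<sigma> m = 1")
    case True
    then show ?thesis using assms by simp
  next
    case False
    then obtain L where L: "gram_exp \<sigma> m = Suc L" "1 \<le> L" using P by (cases "gram_exp \<sigma> m") auto
    then show ?thesis using small[of L] by simp
  qed
qed

lemma gram_expI:
  assumes "1 \<le> L" "m \<le> \<sigma> ^ L" "\<And>L'. 1 \<le> L' \<Longrightarrow> L' < L \<Longrightarrow> \<sigma> ^ L' < m"
  shows "gram_exp \<sigma> m = L"
  unfolding gram_exp_def
proof (rule Least_equality)
  fix y assume "1 \<le> y \<and> m \<le> \<sigma> ^ y"
  then show "L \<le> y" using assms(3)[of y] by (cases "y < L") auto
qed (use assms in simp)

definition pre_copy :: com where
  "pre_copy = Seq (Assign rM Input_Length) (For rZ (Reg rM) (Store (addr 0 (Reg rZ)) (Input (Reg rZ))))"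

definition pre_exp :: "nat \<Rightarrow> nat \<Rightarrow> nat \<Rightarrow> com" where
  "pre_exp \<sigma> K D =
    Seq (Assign rP (Const \<sigma>)) (Seq (Assign rL (Const 1))
    (Seq (While (Binop Less (Reg rP) (Reg rM))
       (Seq (Assign rP (Binop Times (Reg rP) (Const \<sigma>))) (Assign rL (Binop Plus (Reg rL) (Const 1)))))
    (Seq (Assign rLen (Binop Times (Const K) (Reg rL))) (Assign rTau (Binop Times (Const D) (Reg rL))))))"

definition pre_powers :: "nat \<Rightarrow> com" where
  "pre_powers \<sigma> = Seq (Assign rN (Const 1))
     (For rZ (Reg rLen) (Seq (Store (addr 2 (Reg rZ)) (Reg rN)) (Assign rN (Binop Times (Reg rN) (Const \<sigma>)))))"

definition gram_letter :: "nat \<Rightarrow> rexp" where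
  "gram_letter \<sigma> = Binop Mod (Binop Div (Reg rG) (Mem (addr 2 (Binop Minus (Reg rI) (Const 1))))) (Const \<sigma>)"

definition table_body :: "nat \<Rightarrow> com" where
  "table_body \<sigma> =
    Seq (Assign rG (Binop Div (Reg rZ) (Reg rX)))
    (Seq (Assign rE (Binop Mod (Reg rZ) (Reg rX)))
    (Seq (Assign rST (Binop Mod (Reg rE) (Reg rM)))
    (Seq (Assign rV (Binop Div (Reg rE) (Reg rM)))
    (Seq (Assign rU (Reg rLen))
    (Seq (dp (gram_letter \<sigma>))
    (Cond (Binop Less (Reg rTau) (Reg rD)) Skip (Store (addr 3 (Reg rG)) (Const 1))))))))"

definition pre_table :: "nat \<Rightarrow> com" where
  "pre_table \<sigma> = Seq (Assign rX (Binop Times (Reg rM) (Binop Plus (Binop Times (Const 2) (Reg rLen)) (Const 1))))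
     (For rZ (Binop Times (Reg rN) (Reg rX)) (table_body \<sigma>))"

text \<open>\<open>rQ\<close> receives the least \<open>q\<close> with
  \<open>q (\<tau> + 1) > k\<close>. If \<open>q\<close> grams do not fit into the least occurrence
  length \<open>rW\<close>, there are no grams and the flag \<open>rF\<close> has every window
  verified.\<close>

definition pre_params :: com where
  "pre_params =
    Seq (Assign rQ (Binop Plus (Binop Div (Reg rK) (Binop Plus (Reg rTau) (Const 1))) (Const 1)))
    (Seq (Assign rW (Binop Minus (Reg rM) (Reg rK)))
    (Seq (Assign rF (Const 0))
    (Seq (Cond (Binop Less (Reg rW) (Binop Times (Reg rQ) (Reg rLen)))
       (Seq (Assign rQ (Const 0)) (Assign rF (Const 1))) Skip)
    (Seq (Assign rS (Binop Plus (Binop Minus (Reg rW) (Binop Times (Reg rQ) (Reg rLen))) (Const 1)))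
    (Assign rX (Binop Times (Reg rM) (Binop Plus (Binop Times (Const 2) (Reg rM)) (Const 1))))))))"

definition preprocessing :: "nat \<Rightarrow> nat \<Rightarrow> nat \<Rightarrow> com" where
  "preprocessing \<sigma> K D =
     Seq pre_copy (Seq (pre_exp \<sigma> K D) (Seq (pre_powers \<sigma>) (Seq (pre_table \<sigma>) pre_params)))"

locale acsm =
  fixes \<sigma> K D k m :: nat and x :: "nat list"
  assumes \<sigma>: "2 \<le> \<sigma>" and K: "1 \<le> K" and DK: "D \<le> K" and k: "k < m" and x: "x \<in> strings \<sigma> m"
begin

definition "glen = K * gram_exp \<sigma> m"
definition "tau = D * gram_exp \<sigma> m"
definition "wlen = m - k"
definition "grams = (if wlen < (k div (tau + 1) + 1) * glen then 0 else k div (tau + 1) + 1)"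
definition "always = (if wlen < (k div (tau + 1) + 1) * glen then 1 else 0 :: nat)"
text \<open>The block starts at offset \<open>stride - 1\<close> of the window and ends at offset
  \<open>wlen\<close>, where the shortest occurrence starting at offset 0 ends. So it lies inside
  every occurrence that starts at one of the \<open>stride\<close> offsets.\<close>

definition "stride = wlen - grams * glen + 1"

text \<open>The interface between the two programs: all that the search assumes about the state left
  by the preprocessing.\<close>

definition ready :: "state \<Rightarrow> bool" where
  "ready s \<longleftrightarrow> regs s rK = k \<and> regs s rM = m \<and> regs s rLen = glen \<and> regs s rQ = grams \<and>
     regs s rW = wlen \<and> regs s rF = always \<and> regs s rS = stride \<and> regs s rX = m * (2 * m + 1) \<and>
     (\<forall>a<m. memory s (4 * a) = x ! a) \<and>
     (\<forall>g<\<sigma> ^ glen. memory s (4 * g + 3) \<noteq> 0 \<longleftrightarrow> bad_gram x tau (digits \<sigma> glen g))"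

lemma m_pos: "1 \<le> m" using k by simp

lemmas gram_exp_m = gram_exp[OF \<sigma> m_pos]

lemma glen_pos: "1 \<le> glen" and exp_le_glen: "gram_exp \<sigma> m \<le> glen" and tau_le: "tau \<le> glen"
  using gram_exp_m(1) K DK by (auto simp: glen_def tau_def)

lemma scan_length: "grams * glen \<le> wlen"
  by (simp add: grams_def)

lemma length_x: "length x = m" using x by (simp add: strings_def)

lemma x_letter: "a < m \<Longrightarrow> x ! a < \<sigma>"
  using x by (auto simp: strings_def dest: nth_mem)

end

text \<open>\<open>big\<close> bounds the rounds of the loop that fills the table of bad grams,
  \<open>big2\<close> the number of pairs of a rotation and a length up to
  \<open>2 * m\<close>.\<close>

locale acsm_pre = acsm \<sigma> K D k m x + ram W H x for \<sigma> K D k m H x W +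
  assumes big: "\<sigma> ^ glen * (m * (2 * glen + 1)) < H" and big2: "m * (2 * m + 1) < H"
begin

lemma powers_lt: "\<sigma> ^ glen < H"
proof -
  have "\<sigma> ^ glen * 1 \<le> \<sigma> ^ glen * (m * (2 * glen + 1))" using m_pos by (intro mult_le_mono2) simp
  then show ?thesis using big by linarith
qed

lemma grid_lt: "m * (2 * glen + 1) < H"
proof -
  have "1 * (m * (2 * glen + 1)) \<le> \<sigma> ^ glen * (m * (2 * glen + 1))" using \<sigma> by (intro mult_le_mono1) simp
  then show ?thesis using big by linarith
qed

text \<open>The dynamic programming table of a gram is quadratic in \<open>glen\<close>, which is
  below the number \<open>\<sigma> ^ glen\<close> of grams; \<open>big\<close> therefore covers
  it.\<close>

lemma dp_lt: "Suc glen * Suc (2 * glen) < H"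
proof -
  have "glen < 2 ^ glen" by (rule less_exp)
  also have "(2::nat) ^ glen \<le> \<sigma> ^ glen" using \<sigma> by (rule power_mono) simp
  finally have "Suc glen * (1 * Suc (2 * glen)) \<le> \<sigma> ^ glen * (m * (2 * glen + 1))"
    using m_pos by (intro mult_le_mono) auto
  then show ?thesis using big by simp
qed

lemma small: "\<sigma> < H" "m < H" "glen < H" "tau < H" "K < H" "D < H" "\<sigma> * m < H" "Suc m < H"
proof -
  have "\<sigma> ^ 1 \<le> \<sigma> ^ glen" using \<sigma> glen_pos by (intro power_increasing) auto
  then have s: "\<sigma> \<le> \<sigma> ^ glen" by simp
  then show "\<sigma> < H" using powers_lt by linarith
  have "\<sigma> * m \<le> \<sigma> ^ glen * (m * (2 * glen + 1))" using s by (intro mult_le_mono) auto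
  then show "\<sigma> * m < H" using big by linarith
  have "m * 3 \<le> m * (2 * m + 1)" using m_pos by (intro mult_le_mono2) simp
  then have "m * 3 < H" using big2 by linarith
  then show "m < H" "Suc m < H" using m_pos by linarith+
  have "glen \<le> Suc glen * Suc (2 * glen)" by simp
  then show "glen < H" using dp_lt by linarith
  then show "tau < H" using tau_le by linarith
  have "K * 1 \<le> glen" unfolding glen_def using gram_exp_m(1) by (rule mult_le_mono2)
  then show "K < H" using \<open>glen < H\<close> by linarith
  then show "D < H" using DK by linarith
qed

lemma const_times: "\<sigma> * H < W" "K * H < W" "D * H < W" "H * \<sigma> < W"
proof -
  have "c * H < W" if "c < H" for c
  proof -
    have "c * H \<le> H * H" using that by (intro mult_le_mono1) simp
    moreover have "0 < H * H" using H_ge by simp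
    ultimately show ?thesis using word_size by linarith
  qed
  then show "\<sigma> * H < W" "K * H < W" "D * H < W" using small by auto
  then show "H * \<sigma> < W" by (simp add: mult.commute)
qed

definition copied :: "state \<Rightarrow> bool" where
  "copied s \<longleftrightarrow> regs s rK = k \<and> regs s rM = m \<and> (\<forall>a<m. memory s (4 * a) = x ! a) \<and>
  (\<forall>a. memory s (4 * a + 3) = 0)"

lemma wp_pre_copy:
  assumes s: "regs s rK = k" "memory s = (\<lambda>_. 0)" and Q: "\<And>T s'. copied s' \<Longrightarrow> Q T s'"
  shows "wp pre_copy s Q"
  unfolding pre_copy_def
proof (rule wp_Seq, rule wp_Assign[where v = m])
  let ?J = "\<lambda>i (s' :: state). regs s' rK = k \<and> regs s' rM = m \<and> regs s' rZ = i \<and>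
    (\<forall>a<i. memory s' (4 * a) = x ! a) \<and> (\<forall>a. memory s' (4 * a + 3) = 0)"
  show "wp (For rZ (Reg rM) (Store (addr 0 (Reg rZ)) (Input (Reg rZ)))) (set_reg rM m s)
      (\<lambda>T2. Q (1 + (1 + rcost Input_Length) + T2))"
  proof (rule wp_For_plain[where N = m and J = ?J])
    fix i and s' :: state assume i: "i < m" and J: "?J i s'"
    show "wp (Store (addr 0 (Reg rZ)) (Input (Reg rZ))) s' (\<lambda>T s1. regs s1 rZ = i \<and> ?J (Suc i) (set_reg rZ (Suc i) s1))"
    proof (rule wp_Store[where a = "4 * i" and v = "x ! i"])
      show "fits W H (addr 0 (Reg rZ))" "fits W H (Input (Reg rZ))" using fits_arith by (simp_all add: addr_def)
      show "x ! i < H" using x_letter[OF i] small(1) by simp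
      show "regs (set_mem (4 * i) (x ! i) s') rZ = i \<and> ?J (Suc i) (set_reg rZ (Suc i) (set_mem (4 * i) (x ! i) s'))"
        using J by (auto simp: less_Suc_eq)
    qed (use J i in \<open>auto simp: addr_def length_x\<close>)
  qed (use small s Q in \<open>auto simp: copied_def\<close>)
qed (use small in \<open>auto simp: length_x\<close>)

definition sized :: "state \<Rightarrow> bool" where
  "sized s \<longleftrightarrow> copied s \<and> regs s rLen = glen \<and> regs s rTau = tau"

text \<open>The loop invariant includes minimality, so at exit \<open>rL\<close> is the least
  admissible exponent. Its distance to \<open>gram_exp \<sigma> m\<close> is the termination
  measure.\<close>

lemma wp_pre_exp:
  assumes s: "copied s" and Q: "\<And>T s'. sized s' \<Longrightarrow> Q T s'"
  shows "wp (pre_exp \<sigma> K D) s Q"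
proof -
  let ?I = "\<lambda>(T::nat) (s' :: state). copied s' \<and> 1 \<le> regs s' rL \<and> regs s' rP = \<sigma> ^ regs s' rL \<and>
    (\<forall>L. 1 \<le> L \<longrightarrow> L < regs s' rL \<longrightarrow> \<sigma> ^ L < m) \<and> regs s' rL \<le> gram_exp \<sigma> m"
  have fits: "fits W H (Const \<sigma>)" "fits W H (Const 1)" "fits W H (Binop Less (Reg rP) (Reg rM))"
    "fits W H (Binop Times (Reg rP) (Const \<sigma>))" "fits W H (Binop Plus (Reg rL) (Const 1))"
    "fits W H (Binop Times (Const K) (Reg rL))" "fits W H (Binop Times (Const D) (Reg rL))"
    using fits_arith const_times small by simp_all
  show ?thesis
    unfolding pre_exp_def
    apply (rule wp_Seq, rule wp_Assign[where v = \<sigma>], rule fits, simp, simp, rule small)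
    apply (rule wp_Seq, rule wp_Assign[where v = 1], rule fits, simp, simp, use H_ge in linarith)
    apply (rule wp_Seq, rule wp_While[where I = ?I and \<mu> = "\<lambda>s. gram_exp \<sigma> m - regs s rL"])
    subgoal using s gram_exp_m(1) by (simp add: copied_def)
    subgoal by simp
    subgoal by (rule fits)
    subgoal for T s'
    proof -
      assume I: "?I T s'" and "val x s' (Binop Less (Reg rP) (Reg rM)) \<noteq> 0"
      then have lt: "\<sigma> ^ regs s' rL < m" by (auto simp: copied_def split: if_splits)
      then have ne: "regs s' rL \<noteq> gram_exp \<sigma> m" using gram_exp_m(2) by auto
      have pH: "\<sigma> ^ regs s' rL * \<sigma> < H"
        using lt small(7) by (metis mult.commute mult_le_mono2 le_less_trans less_imp_le)
      have LH: "regs s' rL + 1 < H" using ne I exp_le_glen small(3) by linarith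
      show ?thesis
        apply (rule wp_Seq, rule wp_Assign[where v = "\<sigma> ^ regs s' rL * \<sigma>"], rule fits, simp, use I in simp, rule pH)
        apply (rule wp_Assign[where v = "regs s' rL + 1"], rule fits, simp, simp, rule LH)
        using I ne lt by (auto simp: copied_def less_Suc_eq)
    qed
    subgoal for T s'
    proof -
      assume I: "?I T s'" and "val x s' (Binop Less (Reg rP) (Reg rM)) = 0"
      then have "m \<le> \<sigma> ^ regs s' rL" by (auto simp: copied_def split: if_splits)
      then have L: "regs s' rL = gram_exp \<sigma> m" using I gram_expI[of "regs s' rL" m \<sigma>] by simp
      show ?thesis
        apply (rule wp_Seq, rule wp_Assign[where v = glen], rule fits, simp, simp add: L glen_def, rule small)
        apply (rule wp_Assign[where v = tau], rule fits, simp, simp add: L tau_def, rule small)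
        apply (rule Q)
        using I by (simp add: sized_def copied_def)
    qed
    done
qed

definition powers_stored :: "state \<Rightarrow> bool" where
  "powers_stored s \<longleftrightarrow> sized s \<and> regs s rN = \<sigma> ^ glen \<and> (\<forall>a<glen. memory s (4 * a + 2) = \<sigma> ^ a)"

lemma wp_pre_powers:
  assumes s: "sized s" and Q: "\<And>T s'. powers_stored s' \<Longrightarrow> Q T s'"
  shows "wp (pre_powers \<sigma>) s Q"
  unfolding pre_powers_def
proof (rule wp_Seq, rule wp_Assign[where v = 1])
  let ?J = "\<lambda>i (s' :: state). sized s' \<and> regs s' rZ = i \<and> regs s' rN = \<sigma> ^ i \<and> (\<forall>a<i. memory s' (4 * a + 2) = \<sigma> ^ a)"
  let ?c = "Seq (Store (addr 2 (Reg rZ)) (Reg rN)) (Assign rN (Binop Times (Reg rN) (Const \<sigma>)))"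
  show "wp (For rZ (Reg rLen) ?c) (set_reg rN 1 s) (\<lambda>T2. Q (1 + (1 + rcost (Const 1)) + T2))"
  proof (rule wp_For_plain[where N = glen and J = ?J])
    fix i and s' :: state assume i: "i < glen" and J: "?J i s'"
    have le: "\<sigma> ^ j < H" if "j \<le> glen" for j
      using power_increasing[OF that, of \<sigma>] \<sigma> powers_lt by linarith
    show "wp ?c s' (\<lambda>T s1. regs s1 rZ = i \<and> ?J (Suc i) (set_reg rZ (Suc i) s1))"
    proof (rule wp_Seq, rule wp_Store[where a = "4 * i + 2" and v = "\<sigma> ^ i"])
      show "fits W H (addr 2 (Reg rZ))" "fits W H (Reg rN)" using fits_arith by (simp_all add: addr_def)
      show "\<sigma> ^ i < H" using le i by simp
      show "wp (Assign rN (Binop Times (Reg rN) (Const \<sigma>))) (set_mem (4 * i + 2) (\<sigma> ^ i) s')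
        (\<lambda>T2 s2. regs s2 rZ = i \<and> ?J (Suc i) (set_reg rZ (Suc i) s2))"
      proof (rule wp_Assign[where v = "\<sigma> ^ Suc i"])
        show "fits W H (Binop Times (Reg rN) (Const \<sigma>))"
          using fits_arith const_times small by simp_all
        show "\<sigma> ^ Suc i < H" using i by (intro le) simp
        show "regs (set_reg rN (\<sigma> ^ Suc i) (set_mem (4 * i + 2) (\<sigma> ^ i) s')) rZ = i \<and>
          ?J (Suc i) (set_reg rZ (Suc i) (set_reg rN (\<sigma> ^ Suc i) (set_mem (4 * i + 2) (\<sigma> ^ i) s')))"
          using J by (auto simp: sized_def copied_def less_Suc_eq)
      qed (use J in \<open>auto simp: mult.commute\<close>)
    qed (use J in \<open>auto simp: addr_def\<close>)
  qed (use s small Q fits_arith in \<open>auto simp: powers_stored_def sized_def copied_def\<close>)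
qed (use fits_arith in auto)

definition grid :: nat where
  "grid = m * (2 * glen + 1)"

definition table_context :: "state \<Rightarrow> bool" where
  "table_context s \<longleftrightarrow> regs s rK = k \<and> regs s rM = m \<and> regs s rLen = glen \<and> regs s rTau = tau \<and>
     regs s rN = \<sigma> ^ glen \<and> regs s rX = grid \<and>
     (\<forall>a<m. memory s (4 * a) = x ! a) \<and> (\<forall>a<glen. memory s (4 * a + 2) = \<sigma> ^ a)"

text \<open>Loop index \<open>z\<close> encodes a gram \<open>z div grid\<close> together with start and length of a
  circular factor of the pattern.\<close>

definition close_at :: "nat \<Rightarrow> bool" where
  "close_at z \<longleftrightarrow> lev (digits \<sigma> glen (z div grid)) (circ x (z mod grid mod m) (z mod grid div m)) \<le> tau"

text \<open>Cells of array 3 are set but never cleared, so a non-zero cell records that some factor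
  visited so far is close. This is why \<open>copied\<close> demands that the array starts out
  zero.\<close>

definition table :: "nat \<Rightarrow> state \<Rightarrow> bool" where
  "table z s \<longleftrightarrow> (\<forall>g. memory s (4 * g + 3) \<noteq> 0 \<longleftrightarrow> (\<exists>z'<z. z' div grid = g \<and> close_at z'))"

text \<open>Surjectivity of the encoding: gram \<open>g\<close>, start \<open>st\<close> and length
  \<open>l\<close> are visited in round \<open>g * grid + (l * m + st)\<close>, which lies below the
  loop bound.\<close>

lemma table_complete:
  assumes "table (\<sigma> ^ glen * grid) s" and g: "g < \<sigma> ^ glen"
  shows "memory s (4 * g + 3) \<noteq> 0 \<longleftrightarrow> bad_gram x tau (digits \<sigma> glen g)"
proof -
  have "(\<exists>z<\<sigma> ^ glen * grid. z div grid = g \<and> close_at z) \<longleftrightarrow> bad_gram x tau (digits \<sigma> glen g)"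
  proof
    assume "\<exists>z<\<sigma> ^ glen * grid. z div grid = g \<and> close_at z"
    then obtain z where z: "z div grid = g" "close_at z" by blast
    have "grid > 0" using m_pos by (simp add: grid_def)
    then have "z mod grid < (2 * glen + 1) * m" by (simp add: grid_def mult.commute)
    then have "z mod grid div m < 2 * glen + 1" by (rule less_mult_imp_div_less)
    moreover have "z mod grid mod m < m" using m_pos by simp
    ultimately show "bad_gram x tau (digits \<sigma> glen g)"
      using z unfolding bad_gram_def close_at_def length_x length_digits
      by (intro exI[of _ "z mod grid mod m"] conjI exI[of _ "z mod grid div m"]) auto
  next
    assume "bad_gram x tau (digits \<sigma> glen g)"
    then obtain st l where st: "st < m" "l \<le> 2 * glen" "lev (digits \<sigma> glen g) (circ x st l) \<le> tau"
      unfolding bad_gram_def length_x length_digits by blast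
    define y where "y = l * m + st"
    have ym: "y mod m = st" "y div m = l" using st(1) by (simp_all add: y_def)
    have "y < Suc l * m" using st(1) by (simp add: y_def)
    also have "Suc l * m \<le> (2 * glen + 1) * m" using st(2) by (intro mult_le_mono1) simp
    finally have yg: "y < grid" by (simp add: grid_def mult.commute)
    define z where "z = g * grid + y"
    have zm: "z mod grid = y" "z div grid = g" using yg by (simp_all add: z_def)
    have "z < Suc g * grid" using yg by (simp add: z_def)
    also have "\<dots> \<le> \<sigma> ^ glen * grid" using g by (intro mult_le_mono1) simp
    finally have "z < \<sigma> ^ glen * grid" .
    moreover have "close_at z" unfolding close_at_def zm ym by (rule st(3))
    ultimately show "\<exists>z<\<sigma> ^ glen * grid. z div grid = g \<and> close_at z" using zm by blast
  qed
  then show ?thesis using assms(1) by (simp add: table_def)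
qed

lemma fits_table:
  "fits W H (Binop Div (Reg rZ) (Reg rX))" "fits W H (Binop Mod (Reg rZ) (Reg rX))"
  "fits W H (Binop Mod (Reg rE) (Reg rM))" "fits W H (Binop Div (Reg rE) (Reg rM))"
  "fits W H (gram_letter \<sigma>)" "fits W H (Binop Less (Reg rTau) (Reg rD))"
  "fits W H (addr 3 (Reg rG))" "fits W H (Const 1)" "fits W H (Reg r)"
  using fits_arith small by (simp_all add: gram_letter_def addr_def)

lemma wp_table_body:
  assumes s: "table_context s" "table z s" "regs s rZ = z" and z: "z < \<sigma> ^ glen * grid"
  shows "wp (table_body \<sigma>) s (\<lambda>T s1. regs s1 rZ = z \<and>
    (table_context (set_reg rZ (Suc z) s1) \<and> table (Suc z) (set_reg rZ (Suc z) s1) \<and>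
      regs (set_reg rZ (Suc z) s1) rZ = Suc z))"
proof -
  define g where "g = z div grid"
  define y where "y = z mod grid"
  define st where "st = y mod m"
  define l where "l = y div m"
  have grid: "grid > 0" "grid < H" using m_pos grid_lt by (simp_all add: grid_def)
  have g: "g < \<sigma> ^ glen" unfolding g_def by (rule less_mult_imp_div_less[OF z])
  then have gH: "g < H" using powers_lt by linarith
  have y: "y < grid" using grid by (simp add: y_def)
  then have yH: "y < H" using grid by linarith
  have st: "st < m" using m_pos by (simp add: st_def)
  then have stH: "st < H" using small by linarith
  have "y < (2 * glen + 1) * m" using y by (simp add: grid_def mult.commute)
  then have l: "l \<le> 2 * glen" unfolding l_def using less_mult_imp_div_less[of y "2 * glen + 1" m] by simp
  have lH: "l < H" using l dp_lt by simp
  let ?u = "digits \<sigma> glen g" and ?v = "circ x st l"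
  define s1 where "s1 = set_reg rU glen (set_reg rV l (set_reg rST st (set_reg rE y (set_reg rG g s))))"
  have r: "regs s rX = grid" "regs s rM = m" "regs s rLen = glen" using s by (simp_all add: table_context_def)
  have r1: "regs s1 rG = g" "regs s1 rM = m" "regs s1 rST = st" "regs s1 rV = l" "regs s1 rU = glen"
    "regs s1 rTau = tau" "regs s1 rZ = z" "memory s1 = memory s"
    using s by (simp_all add: s1_def table_context_def)
  have T1: "table_context s1" using s(1) by (simp add: s1_def table_context_def)
  \<comment> \<open>Covers both outcomes of the final test: the cell of \<open>g\<close> is written
    exactly if the factor of round \<open>z\<close> is close.\<close>
  have step: "table_context (set_reg rZ (Suc z) s2) \<and> table (Suc z) (set_reg rZ (Suc z) s2)"
    if fr: "dp_frame s1 s'" and s2: "s2 = (if lev ?u ?v \<le> tau then set_mem (4 * g + 3) 1 s' else s')" for s' s2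
  proof
    have m0: "memory s' (4 * a) = memory s (4 * a)" "memory s' (4 * a + 2) = memory s (4 * a + 2)"
      "memory s' (4 * a + 3) = memory s (4 * a + 3)" for a
      using fr r1(8) by (simp_all add: dp_frame_def)
    have "regs s' r = regs s1 r" if "r \<notin> {rC, rD, rI, rJ, rE}" for r
      using fr that by (simp add: dp_frame_def)
    then have "table_context s'" using T1 m0 r1(8) unfolding table_context_def by auto
    then show "table_context (set_reg rZ (Suc z) s2)" by (auto simp: s2 table_context_def)
    have "close_at z \<longleftrightarrow> lev ?u ?v \<le> tau" by (simp add: close_at_def g_def y_def st_def l_def)
    moreover have "z div grid = g" by (simp add: g_def)
    moreover have "4 * a + 3 = 4 * g + 3 \<longleftrightarrow> a = g" for a by simp
    ultimately show "table (Suc z) (set_reg rZ (Suc z) s2)"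
      using s(2) m0(3) unfolding table_def by (auto simp: s2 less_Suc_eq)
  qed
  show ?thesis
    unfolding table_body_def
    apply (rule wp_Seq, rule wp_Assign[where v = g], rule fits_table, simp, simp add: s(3) r g_def, rule gH)
    apply (rule wp_Seq, rule wp_Assign[where v = y], rule fits_table, simp, simp add: s(3) r y_def, rule yH)
    apply (rule wp_Seq, rule wp_Assign[where v = st], rule fits_table, simp, simp add: r st_def, rule stH)
    apply (rule wp_Seq, rule wp_Assign[where v = l], rule fits_table, simp, simp add: r l_def, rule lH)
    apply (rule wp_Seq, rule wp_Assign[where v = glen], rule fits_table, simp, simp add: r, rule small)
    apply (fold s1_def)
    apply (rule wp_Seq, rule wp_dp[where u = ?u and v = ?v])
    subgoal
    proof -
      have "Suc glen * Suc l \<le> Suc glen * Suc (2 * glen)" using l by (intro mult_le_mono2) simp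
      then show ?thesis using dp_lt by simp
    qed
    subgoal by (simp add: r1)
    subgoal by (simp add: r1)
    subgoal by (rule fits_table)
    subgoal for s' i
    proof -
      assume fr: "dp_frame s1 s'" and i: "1 \<le> i" "i \<le> length ?u" "regs s' rI = i"
      have "i - 1 < glen" using i by simp
      then have "memory s' (4 * (i - 1) + 2) = \<sigma> ^ (i - 1)"
        using fr T1 by (simp add: dp_frame_def table_context_def)
      moreover have "regs s' rG = g" using fr r1 by (simp add: dp_frame_def)
      ultimately show ?thesis using digits_nth[of i glen \<sigma> g] i by (simp add: gram_letter_def addr_def)
    qed
    subgoal for j using s(1) m_pos by (simp add: r1 length_x table_context_def)
    subgoal premises p for T s'
    proof -
      have keep: "regs s' rG = g" "regs s' rTau = tau" "regs s' rZ = z" using p(2) r1 by (simp_all add: dp_frame_def)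
      show ?thesis
      proof (rule wp_Cond)
        assume "val x s' (Binop Less (Reg rTau) (Reg rD)) \<noteq> 0"
        then have "\<not> lev ?u ?v \<le> tau" using p(3) keep by (simp split: if_splits)
        then show "wp Skip s' (\<lambda>T s1. regs s1 rZ = z \<and>
          (table_context (set_reg rZ (Suc z) s1) \<and> table (Suc z) (set_reg rZ (Suc z) s1) \<and>
            regs (set_reg rZ (Suc z) s1) rZ = Suc z))"
          using step[OF p(2), of s'] keep by (intro wp_Skip) simp
      next
        assume "val x s' (Binop Less (Reg rTau) (Reg rD)) = 0"
        then have "lev ?u ?v \<le> tau" using p(3) keep by (simp split: if_splits)
        then show "wp (Store (addr 3 (Reg rG)) (Const 1)) s' (\<lambda>T s1. regs s1 rZ = z \<and>
          (table_context (set_reg rZ (Suc z) s1) \<and> table (Suc z) (set_reg rZ (Suc z) s1) \<and>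
            regs (set_reg rZ (Suc z) s1) rZ = Suc z))"
          using step[OF p(2), of "set_mem (4 * g + 3) 1 s'"] keep H_ge
          by (intro wp_Store[where a = "4 * g + 3" and v = 1] fits_table) (simp_all add: addr_def)
      qed (use fits_arith in simp_all)
    qed
    done
qed

definition table_stored :: "state \<Rightarrow> bool" where
  "table_stored s \<longleftrightarrow> table_context s \<and> table (\<sigma> ^ glen * grid) s"

lemma wp_pre_table:
  assumes s: "powers_stored s" and Q: "\<And>T s'. table_stored s' \<Longrightarrow> Q T s'"
  shows "wp (pre_table \<sigma>) s Q"
  unfolding pre_table_def
proof (rule wp_Seq, rule wp_Assign[where v = grid])
  show "grid < H" using grid_lt by (simp add: grid_def)
  have s': "regs s rM = m" "regs s rLen = glen" using s by (simp_all add: powers_stored_def sized_def copied_def)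
  then show "val x s (Binop Times (Reg rM) (Binop Plus (Binop Times (Const 2) (Reg rLen)) (Const 1))) = grid"
    by (simp add: grid_def)
  show "fits W H (Binop Times (Reg rM) (Binop Plus (Binop Times (Const 2) (Reg rLen)) (Const 1)))"
    using fits_arith by simp
  show "wp (For rZ (Binop Times (Reg rN) (Reg rX)) (table_body \<sigma>)) (set_reg rX grid s)
      (\<lambda>T2. Q (1 + (1 + rcost (Binop Times (Reg rM) (Binop Plus (Binop Times (Const 2) (Reg rLen)) (Const 1)))) + T2))"
  proof (rule wp_For_plain[where N = "\<sigma> ^ glen * grid" and
        J = "\<lambda>z s'. table_context s' \<and> table z s' \<and> regs s' rZ = z"])
    show "\<sigma> ^ glen * grid < H" using big by (simp add: grid_def)
    show "fits W H (Binop Times (Reg rN) (Reg rX))" using fits_arith by simp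
    show "table_context (set_reg rZ 0 (set_reg rX grid s)) \<and> table 0 (set_reg rZ 0 (set_reg rX grid s)) \<and>
        regs (set_reg rZ 0 (set_reg rX grid s)) rZ = 0"
      using s by (simp add: powers_stored_def sized_def copied_def table_context_def table_def)
  next
    fix z and s' :: state assume "table_context s' \<and> table z s' \<and> regs s' rZ = z"
    then show "regs s' rZ = z \<and> val x s' (Binop Times (Reg rN) (Reg rX)) = \<sigma> ^ glen * grid \<and>
        reads_inside x s' (Binop Times (Reg rN) (Reg rX))" by (simp add: table_context_def)
  next
    fix z and s' :: state
    assume "z < \<sigma> ^ glen * grid" "table_context s' \<and> table z s' \<and> regs s' rZ = z"
    then show "wp (table_body \<sigma>) s' (\<lambda>T s1. regs s1 rZ = z \<and>
        (table_context (set_reg rZ (Suc z) s1) \<and> table (Suc z) (set_reg rZ (Suc z) s1) \<and>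
          regs (set_reg rZ (Suc z) s1) rZ = Suc z))"
      by (intro wp_table_body) auto
  qed (use Q in \<open>auto simp: table_stored_def\<close>)
qed simp

lemma wp_pre_params:
  assumes s: "table_stored s" and Q: "\<And>T s'. ready s' \<Longrightarrow> Q T s'"
  shows "wp pre_params s Q"
proof -
  let ?q = "k div (tau + 1) + 1"
  have r: "regs s rK = k" "regs s rM = m" "regs s rLen = glen" "regs s rTau = tau"
    using s by (simp_all add: table_stored_def table_context_def)
  have fits: "fits W H (Binop Plus (Binop Div (Reg rK) (Binop Plus (Reg rTau) (Const 1))) (Const 1))"
    "fits W H (Binop Minus (Reg rM) (Reg rK))" "fits W H (Const 0)" "fits W H (Const 1)"
    "fits W H (Binop Less (Reg rW) (Binop Times (Reg rQ) (Reg rLen)))"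
    "fits W H (Binop Plus (Binop Minus (Reg rW) (Binop Times (Reg rQ) (Reg rLen))) (Const 1))"
    "fits W H (Binop Times (Reg rM) (Binop Plus (Binop Times (Const 2) (Reg rM)) (Const 1)))"
    using fits_arith by simp_all
  have "k div (tau + 1) \<le> k" by (rule div_le_dividend)
  then have qH: "?q < H" using k small by linarith
  have wH: "wlen < H" using small by (simp add: wlen_def)
  have sH: "stride < H" using small m_pos unfolding stride_def wlen_def by linarith
  have final: "wp (Seq (Assign rS (Binop Plus (Binop Minus (Reg rW) (Binop Times (Reg rQ) (Reg rLen))) (Const 1)))
      (Assign rX (Binop Times (Reg rM) (Binop Plus (Binop Times (Const 2) (Reg rM)) (Const 1))))) s' Q'"
    if s': "regs s' rQ = grams" "regs s' rF = always" "regs s' rW = wlen"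
      "regs s' rM = m" "regs s' rLen = glen" "regs s' rK = k" "memory s' = memory s"
      and Q': "\<And>T s'. ready s' \<Longrightarrow> Q' T s'" for s' Q'
    apply (rule wp_Seq, rule wp_Assign[where v = stride], rule fits, simp, simp add: s' stride_def, rule sH)
    apply (rule wp_Assign[where v = "m * (2 * m + 1)"], rule fits, simp, simp add: s', rule big2)
    apply (rule Q')
    using s table_complete[of s] by (simp add: ready_def s' table_stored_def table_context_def)
  show ?thesis
    unfolding pre_params_def
    apply (rule wp_Seq, rule wp_Assign[where v = ?q], rule fits, simp, simp add: r, rule qH)
    apply (rule wp_Seq, rule wp_Assign[where v = wlen], rule fits, simp, simp add: r wlen_def, rule wH)
    apply (rule wp_Seq, rule wp_Assign[where v = 0], rule fits, simp, simp, use H_ge in linarith)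
    apply (rule wp_Seq, rule wp_Cond, rule fits, simp)
    subgoal premises p
    proof -
      have "wlen < ?q * glen" using p r by (simp split: if_splits)
      then have g: "grams = 0" "always = 1" by (simp_all add: grams_def always_def)
      show ?thesis
        apply (rule wp_Seq, rule wp_Assign[where v = 0], rule fits, simp, simp, use H_ge in linarith)
        apply (rule wp_Assign[where v = 1], rule fits, simp, simp, use H_ge in linarith)
        by (rule final) (simp_all add: g r Q)
    qed
    subgoal premises p
    proof -
      have "\<not> wlen < ?q * glen" using p r by (simp split: if_splits)
      then have g: "grams = ?q" "always = 0" by (simp_all add: grams_def always_def)
      show ?thesis
        apply (rule wp_Skip)
        by (rule final) (simp_all add: g r Q)
    qed
    done
qed

lemma wp_preprocessing:
  assumes "regs s rK = k" "memory s = (\<lambda>_. 0)" and Q: "\<And>T s'. ready s' \<Longrightarrow> Q T s'"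
  shows "wp (preprocessing \<sigma> K D) s Q"
  unfolding preprocessing_def
  apply (rule wp_Seq, rule wp_pre_copy[OF assms(1,2)])
  apply (rule wp_Seq, erule wp_pre_exp)
  apply (rule wp_Seq, erule wp_pre_powers)
  apply (rule wp_Seq, erule wp_pre_table)
  apply (erule wp_pre_params)
  apply (erule Q)
  done

end

section \<open>The search program\<close>

text \<open>Left inverse of \<open>digits\<close> up to \<open>digits_horner\<close>: the code under
  which the scan looks up a gram in the table.\<close>

definition horner :: "nat \<Rightarrow> nat list \<Rightarrow> nat" where
  "horner \<sigma> w = foldl (\<lambda>c a. c * \<sigma> + a) 0 w"

lemma horner_Nil [simp]: "horner \<sigma> [] = 0"
  and horner_snoc [simp]: "horner \<sigma> (w @ [a]) = horner \<sigma> w * \<sigma> + a"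
  by (simp_all add: horner_def)

lemma horner_less: "set w \<subseteq> {..<\<sigma>} \<Longrightarrow> horner \<sigma> w < \<sigma> ^ length w"
proof (induction w rule: rev_induct)
  case (snoc a w)
  then have "horner \<sigma> w + 1 \<le> \<sigma> ^ length w" "a < \<sigma>" by auto
  then have "(horner \<sigma> w + 1) * \<sigma> \<le> \<sigma> ^ length w * \<sigma>" by (intro mult_le_mono1)
  then show ?case using \<open>a < \<sigma>\<close> by (simp add: mult.commute)
qed simp

lemma digits_nth': "b < l \<Longrightarrow> digits \<sigma> l g ! b = g div \<sigma> ^ (l - 1 - b) mod \<sigma>"
  by (simp add: digits_def)

lemma digits_horner:
  assumes "set w \<subseteq> {..<\<sigma>}"
  shows "digits \<sigma> (length w) (horner \<sigma> w) = w"
  using assms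
proof (induction w rule: rev_induct)
  case (snoc a w)
  have a: "a < \<sigma>" and IH: "digits \<sigma> (length w) (horner \<sigma> w) = w" using snoc by auto
  have "digits \<sigma> (length (w @ [a])) (horner \<sigma> (w @ [a])) ! b = (w @ [a]) ! b" if b: "b < length (w @ [a])" for b
  proof (cases "b = length w")
    case True
    then show ?thesis using a by (simp add: digits_nth')
  next
    case False
    then have bw: "b < length w" using b by simp
    then have e: "length w - b = Suc (length w - 1 - b)" by simp
    have "(horner \<sigma> w * \<sigma> + a) div \<sigma> ^ (length w - b) = (horner \<sigma> w * \<sigma> + a) div \<sigma> div \<sigma> ^ (length w - 1 - b)"
      unfolding e by (simp add: div_mult2_eq)
    also have "(horner \<sigma> w * \<sigma> + a) div \<sigma> = horner \<sigma> w" using a by simp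
    finally have "digits \<sigma> (length (w @ [a])) (horner \<sigma> (w @ [a])) ! b = digits \<sigma> (length w) (horner \<sigma> w) ! b"
      using bw by (simp add: digits_nth')
    then show ?thesis using IH bw by (simp add: nth_append)
  qed
  then show ?case by (intro nth_equalityI) simp_all
qed (simp add: digits_def)

lemma concat_blocks:
  assumes "P + q * l \<le> length t"
  shows "concat (map (\<lambda>g. take l (drop (P + l * g) t)) [0..<q]) = take (q * l) (drop P t)"
  using assms
proof (induction q)
  case (Suc q)
  have "take (Suc q * l) (drop P t) = take (q * l) (drop P t) @ take l (drop (q * l) (drop P t))"
    by (metis add.commute mult_Suc take_add)
  then show ?case using Suc by (simp add: mult.commute add.commute)
qed simp

text \<open>The first letter of the suffix of length \<open>rI\<close> of the text factor that
  starts at \<open>rA\<close> and has length \<open>rU\<close>.\<close>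

definition text_letter :: rexp where
  "text_letter = Input (Binop Plus (Reg rA) (Binop Minus (Reg rU) (Reg rI)))"

text \<open>After the last letter of a gram its table entry is added to \<open>rBad\<close>; the
  comparison with 0 reduces the sum to a bit again.\<close>

definition scan_body :: "nat \<Rightarrow> com" where
  "scan_body \<sigma> =
    Seq (Assign rG (Binop Plus (Binop Times (Reg rG) (Const \<sigma>))
           (Input (Binop Plus (Binop Plus (Reg rPos) (Binop Minus (Reg rS) (Const 1))) (Reg rZ)))))
    (Cond (Binop Mod (Binop Plus (Reg rZ) (Const 1)) (Reg rLen)) Skip
      (Seq (Assign rBad (Binop Less (Const 0) (Binop Plus (Reg rBad) (Mem (addr 3 (Reg rG))))))
           (Assign rG (Const 0))))"

text \<open>A round decodes an offset, a rotation and a length. The product in the test is a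
  conjunction: the length is non-zero and the factor ends within the text. A factor close to several
  rotations is emitted several times; the output is compared as a set.\<close>

definition check_body :: com where
  "check_body =
    Seq (Assign rA (Binop Plus (Reg rPos) (Binop Div (Reg rZ) (Reg rX))))
    (Seq (Assign rE (Binop Mod (Reg rZ) (Reg rX)))
    (Seq (Assign rST (Binop Mod (Reg rE) (Reg rM)))
    (Seq (Assign rU (Binop Div (Reg rE) (Reg rM)))
    (Seq (Assign rV (Reg rM))
    (Cond (Binop Times (Reg rU) (Binop Less (Binop Plus (Reg rA) (Reg rU)) (Binop Plus Input_Length (Const 1))))
      (Seq (dp text_letter)
        (Cond (Binop Less (Reg rK) (Reg rD)) Skip
          (Emit (Reg rA) (Binop Minus (Binop Plus (Reg rA) (Reg rU)) (Const 1)))))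
      Skip)))))"

text \<open>The scan is linear in the block. Only a bad gram or the flag \<open>rF\<close> triggers
  the verification of all starts before the next window.\<close>

definition window :: "nat \<Rightarrow> com" where
  "window \<sigma> =
    Seq (Assign rBad (Reg rF))
    (Seq (Assign rG (Const 0))
    (Seq (For rZ (Binop Times (Reg rQ) (Reg rLen)) (scan_body \<sigma>))
    (Seq (Cond (Reg rBad) (For rZ (Binop Times (Reg rS) (Reg rX)) check_body) Skip)
    (Assign rPos (Binop Plus (Reg rPos) (Reg rS))))))"

definition searching :: "nat \<Rightarrow> com" where
  "searching \<sigma> = Seq (Assign rPos (Const 0))
    (While (Binop Less (Binop Plus (Reg rPos) (Reg rW)) (Binop Plus Input_Length (Const 1))) (window \<sigma>))"

text \<open>\<open>cube\<close> bounds the rounds of a verification, as the stride is at most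
  \<open>m + 1\<close>; \<open>nH\<close> leaves room for a text position plus a stride.\<close>

locale acsm_search = acsm \<sigma> K D k m x + ram W H t for \<sigma> K D k m H x W t +
  fixes n :: nat
  assumes t: "t \<in> strings \<sigma> n" and mn: "m < n"
    and pow: "\<sigma> ^ glen < H" and cube: "(m + 1) * (m * (2 * m + 1)) < H" and nH: "2 * n + 5 < H"
begin

definition "gram p g = take glen (drop (p + stride - 1 + glen * g) t)"
definition "bad_window p \<longleftrightarrow> always \<noteq> 0 \<or> (\<exists>g<grams. bad_gram x tau (gram p g))"
definition "combos = m * (2 * m + 1)"

lemma length_t: "length t = n" and t_letter: "i < n \<Longrightarrow> t ! i < \<sigma>"
  using t by (auto simp: strings_def dest: nth_mem)

lemma wlen: "1 \<le> wlen" "wlen \<le> m" using k by (auto simp: wlen_def)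

lemma stride: "1 \<le> stride" "stride \<le> m + 1" "stride - 1 + grams * glen = wlen"
  using scan_length wlen by (auto simp: stride_def)

lemma gram:
  assumes p: "p + wlen \<le> n" and g: "g < grams"
  shows "length (gram p g) = glen" "set (gram p g) \<subseteq> {..<\<sigma>}"
proof -
  have "Suc g * glen \<le> grams * glen" using g by (intro mult_le_mono1) simp
  then have "p + stride - 1 + glen * g + glen \<le> n"
    using stride p by (simp add: mult.commute)
  then show "length (gram p g) = glen" using length_t by (simp add: gram_def)
  show "set (gram p g) \<subseteq> {..<\<sigma>}"
    using t set_take_subset[of glen "drop (p + stride - 1 + glen * g) t"]
      set_drop_subset[of "p + stride - 1 + glen * g" t]
    by (auto simp: gram_def strings_def)
qed

text \<open>Distance at most \<open>k\<close> to a string of length \<open>m\<close> confines the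
  length to the range from \<open>m - k\<close> to \<open>m + k\<close>. The lower end is
  \<open>wlen\<close>; the upper end, below \<open>2 * m\<close>, limits the lengths to be
  tried.\<close>

lemma occurrence:
  assumes "(a, b) \<in> circular_occurrences k x t"
  obtains i l where "i < m" "l = b + 1 - a" "a \<le> b" "b < n" "1 \<le> l" "l \<le> 2 * m" "wlen \<le> l" "a + l \<le> n"
    "lev (take l (drop a t)) (rotate i x) \<le> k"
proof -
  obtain i where i: "i < m" "a \<le> b" "b < n" "lev (take (b + 1 - a) (drop a t)) (rotate i x) \<le> k"
    using assms by (auto simp: circular_occurrences_def length_x length_t edit_distance_eq_lev factor_def)
  define l where "l = b + 1 - a"
  have len: "length (take l (drop a t)) = l" using i length_t by (simp add: l_def)
  have "m \<le> l + lev (take l (drop a t)) (rotate i x)"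
    using length_le_lev2[of "rotate i x" "take l (drop a t)"] len length_x by simp
  then have "wlen \<le> l" using i(4) by (simp add: l_def wlen_def)
  moreover have "l \<le> m + lev (take l (drop a t)) (rotate i x)"
    using length_le_lev1[of "take l (drop a t)" "rotate i x"] len length_x by simp
  then have "l \<le> 2 * m" using i(4) k by (simp add: l_def)
  ultimately show thesis using i that[of i l] by (simp add: l_def)
qed

text \<open>Correctness of the filter: an occurrence starting before the next window would contain
  the whole block. The block consists of good grams with \<open>grams * Suc tau > k\<close>, so the
  distance of the factor to each rotation would exceed \<open>k\<close>.\<close>

lemma good_window:
  assumes good: "\<not> bad_window p" and p: "p + wlen \<le> n"
    and occ: "(a, b) \<in> circular_occurrences k x t" and a: "p \<le> a"
  shows "p + stride \<le> a"
proof (rule ccontr)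
  assume "\<not> p + stride \<le> a"
  then have a': "a \<le> p + stride - 1" by simp
  obtain i l where o: "i < m" "wlen \<le> l" "a + l \<le> n" "lev (take l (drop a t)) (rotate i x) \<le> k"
    using occurrence[OF occ] by metis
  have nf: "\<not> wlen < (k div (tau + 1) + 1) * glen" using good by (auto simp: bad_window_def always_def)
  then have q: "grams = k div (tau + 1) + 1" by (simp add: grams_def)
  define P where "P = p + stride - 1"
  have Pq: "P + grams * glen = p + wlen" using stride by (simp add: P_def)
  define gs where "gs = map (gram p) [0..<grams]"
  have cat: "concat gs = take (grams * glen) (drop P t)"
    unfolding gs_def gram_def P_def[symmetric] by (rule concat_blocks) (use Pq p length_t in simp)
  have "k < (k div (tau + 1) + 1) * (tau + 1)"
    using dividend_less_div_times[of "tau + 1" k] by simp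
  then have kq: "k < length gs * Suc tau" by (simp add: gs_def q)
  \<comment> \<open>The \<open>e\<close> letters by which the occurrence precedes the block.\<close>
  define e where "e = P - a"
  have Pa: "P = a + e" using a' by (simp add: e_def P_def)
  have el: "e + grams * glen \<le> l" using Pq Pa o(2) a by linarith
  have "take l (drop a t) = take e (drop a t) @ take (grams * glen) (drop P t) @ drop (e + grams * glen) (take l (drop a t))"
  proof -
    have "take l (drop a t) = take (e + grams * glen) (take l (drop a t)) @ drop (e + grams * glen) (take l (drop a t))"
      by (rule append_take_drop_id[symmetric])
    also have "take (e + grams * glen) (take l (drop a t)) = take (e + grams * glen) (drop a t)"
      using el by (simp add: min_def)
    also have "\<dots> = take e (drop a t) @ take (grams * glen) (drop P t)"
      by (simp add: take_add Pa add.commute)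
    finally show ?thesis by simp
  qed
  moreover have "k < lev (take e (drop a t) @ concat gs @ drop (e + grams * glen) (take l (drop a t))) (rotate i x)"
  proof (rule no_occurrence_around_good_grams[OF _ _ kq])
    show "x \<noteq> []" using length_x m_pos by auto
    fix g assume "g \<in> set gs"
    then obtain j where j: "j < grams" "g = gram p j" by (auto simp: gs_def)
    then show "\<not> bad_gram x tau g \<and> tau \<le> length g"
      using good gram(1)[OF p j(1)] tau_le by (auto simp: bad_window_def)
  qed
  ultimately show False using o(4) cat by simp
qed

lemma bounds: "\<sigma> < H" "m < H" "k < H" "n < H" "glen < H" "combos < H" "stride * combos < H" "H * \<sigma> \<le> H * H"
  "Suc (2 * m) * Suc m < H" "grams * glen < H"
proof -
  have "\<sigma> ^ 1 \<le> \<sigma> ^ glen" using \<sigma> glen_pos by (intro power_increasing) auto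
  then show s: "\<sigma> < H" using pow by simp
  show "m < H" "k < H" "n < H" using nH mn k by auto
  have "glen < 2 ^ glen" by (rule less_exp)
  also have "(2::nat) ^ glen \<le> \<sigma> ^ glen" using \<sigma> by (rule power_mono) simp
  finally show "glen < H" using pow by linarith
  have "stride * combos \<le> (m + 1) * combos" using stride(2) by (rule mult_le_mono1)
  then show "stride * combos < H" using cube by (simp add: combos_def)
  have "1 * combos \<le> (m + 1) * combos" by (rule mult_le_mono1) simp
  then show "combos < H" using cube by (simp add: combos_def)
  show "H * \<sigma> \<le> H * H" using s by (intro mult_le_mono2) simp
  have "(m + 1) * (1 * (2 * m + 1)) \<le> (m + 1) * (m * (2 * m + 1))"
    using m_pos by (intro mult_le_mono2 mult_le_mono1)
  then show "Suc (2 * m) * Suc m < H" using cube by (simp add: mult.commute)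
  show "grams * glen < H" using scan_length wlen \<open>m < H\<close> by linarith
qed

lemma H\<sigma>_lt: "H * \<sigma> + H < W" "H * \<sigma> < W"
proof -
  have "0 < H * H" using H_ge by simp
  then show "H * \<sigma> < W" using bounds(8) word_size by linarith
  have "H \<le> H * H" by simp
  then show "H * \<sigma> + H < W" using bounds(8) word_size \<open>0 < H * H\<close> by linarith
qed

lemma fits_search:
  "fits W H (Binop Plus (Binop Times (Reg rG) (Const \<sigma>))
           (Input (Binop Plus (Binop Plus (Reg rPos) (Binop Minus (Reg rS) (Const 1))) (Reg rZ))))"
  "fits W H (Binop Mod (Binop Plus (Reg rZ) (Const 1)) (Reg rLen))"
  "fits W H (Binop Less (Const 0) (Binop Plus (Reg rBad) (Mem (addr 3 (Reg rG)))))"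
  "fits W H (Const 0)"
  "fits W H (Binop Plus (Reg rPos) (Binop Div (Reg rZ) (Reg rX)))"
  "fits W H (Binop Mod (Reg rZ) (Reg rX))"
  "fits W H (Binop Mod (Reg rE) (Reg rM))" "fits W H (Binop Div (Reg rE) (Reg rM))" "fits W H (Reg r)"
  "fits W H (Binop Times (Reg rU) (Binop Less (Binop Plus (Reg rA) (Reg rU)) (Binop Plus Input_Length (Const 1))))"
  "fits W H (Binop Less (Reg rK) (Reg rD))"
  "fits W H (Binop Minus (Binop Plus (Reg rA) (Reg rU)) (Const 1))"
  "fits W H (Binop Times (Reg rQ) (Reg rLen))" "fits W H (Binop Times (Reg rS) (Reg rX))"
  "fits W H (Binop Plus (Reg rPos) (Reg rS))"
  "fits W H (Binop Less (Binop Plus (Reg rPos) (Reg rW)) (Binop Plus Input_Length (Const 1)))"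
  "fits W H text_letter"
  using fits_arith bounds(1) H\<sigma>_lt by (simp_all add: addr_def text_letter_def)

definition base :: "nat \<Rightarrow> state \<Rightarrow> bool" where
  "base p s \<longleftrightarrow> ready s \<and> regs s rPos = p"

definition scan_inv :: "nat \<Rightarrow> state \<Rightarrow> nat \<Rightarrow> state \<Rightarrow> bool" where
  "scan_inv p s0 z s \<longleftrightarrow> base p s \<and> emitted s = emitted s0 \<and> regs s rZ = z \<and>
     regs s rG = horner \<sigma> (take (z mod glen) (drop (p + stride - 1 + glen * (z div glen)) t)) \<and>
     (regs s rBad \<noteq> 0 \<longleftrightarrow> always \<noteq> 0 \<or> (\<exists>g<z div glen. bad_gram x tau (gram p g)))"

lemma wp_scan_body:
  assumes s: "scan_inv p s0 z s" and z: "z < grams * glen" and p: "p + wlen \<le> n"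
  shows "wp (scan_body \<sigma>) s (\<lambda>T s1. regs s1 rZ = z \<and> T \<le> 60 \<and> scan_inv p s0 (Suc z) (set_reg rZ (Suc z) s1))"
proof -
  define P where "P = p + stride - 1"
  define g where "g = z div glen"
  define j where "j = z mod glen"
  have zgj: "z = glen * g + j" by (simp add: g_def j_def)
  have j: "j < glen" using glen_pos by (simp add: j_def)
  have g: "g < grams" unfolding g_def by (rule less_mult_imp_div_less[OF z])
  let ?w = "take j (drop (P + glen * g) t)"
  have r: "regs s rG = horner \<sigma> ?w" "regs s rPos = p" "regs s rS = stride" "regs s rZ = z" "regs s rLen = glen"
    using s by (simp_all add: scan_inv_def base_def ready_def P_def g_def j_def)
  have Pz: "P + z < n"
    using z p stride by (simp add: P_def)
  let ?c = "horner \<sigma> (take (Suc j) (drop (P + glen * g) t))"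
  have tk: "take (Suc j) (drop (P + glen * g) t) = ?w @ [t ! (P + z)]"
    using Pz length_t by (subst take_Suc_conv_app_nth) (simp_all add: zgj add.assoc)
  have set: "set (take i (drop q t)) \<subseteq> {..<\<sigma>}" for i q
    using t set_take_subset[of i "drop q t"] set_drop_subset[of q t] by (auto simp: strings_def)
  have "?c < \<sigma> ^ length (take (Suc j) (drop (P + glen * g) t))" by (rule horner_less[OF set])
  also have "\<dots> \<le> \<sigma> ^ glen" using \<sigma> j by (intro power_increasing) auto
  finally have cN: "?c < \<sigma> ^ glen" .
  then have cH: "?c < H" using pow by linarith
  define s1 where "s1 = set_reg rG ?c s"
  have pos: "p + (stride - 1) + z = P + z" using stride(1) by (simp add: P_def)
  have base1: "base p (set_reg rZ (Suc z) (set_reg rG c s))" "base p (set_reg rZ (Suc z) (set_reg rG c (set_reg rBad b (set_reg rG c' s))))" for b c c'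
    using s by (simp_all add: scan_inv_def base_def ready_def)
  show ?thesis
    unfolding scan_body_def
    apply (rule wp_Seq, rule wp_Assign[where v = ?c], rule fits_search)
    subgoal using Pz by (simp add: r pos[simplified] length_t)
    subgoal by (simp only: val.simps apply_binop.simps r pos tk horner_snoc)
    subgoal by (rule cH)
    apply (rule wp_Cond, rule fits_search, simp)
    subgoal premises q
    proof -
      have "Suc z mod glen \<noteq> 0" using q by (simp add: r)
      then have "Suc z mod glen = Suc j" "Suc z div glen = g"
        by (simp_all add: mod_Suc div_Suc j_def g_def split: if_splits)
      then have "scan_inv p s0 (Suc z) (set_reg rZ (Suc z) (set_reg rG ?c s))"
        using s base1(1) unfolding scan_inv_def by (simp add: P_def g_def)
      then show ?thesis by (intro wp_Skip) (simp add: r)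
    qed
    \<comment> \<open>The last letter of a gram: the code is complete and below
      \<open>\<sigma> ^ glen\<close>, where \<open>ready\<close> determines the table entry.\<close>
    subgoal premises q
    proof -
      have "Suc z mod glen = 0" using q by (simp add: r)
      then have sj: "Suc j = glen" and m0: "Suc z mod glen = 0" "Suc z div glen = Suc g"
        using glen_pos by (auto simp: mod_Suc div_Suc j_def g_def split: if_splits)
      have c: "?c = horner \<sigma> (gram p g)" by (simp add: gram_def P_def sj)
      have "digits \<sigma> glen ?c = gram p g"
        using digits_horner[of "gram p g" \<sigma>] gram[OF p g] c by simp
      then have mem: "memory s (4 * ?c + 3) \<noteq> 0 \<longleftrightarrow> bad_gram x tau (gram p g)"
        using s cN by (simp add: scan_inv_def base_def ready_def)
      define b where "b = (of_bool (0 < regs s rBad + memory s (4 * ?c + 3)) :: nat)"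
      have b: "b \<noteq> 0 \<longleftrightarrow> always \<noteq> 0 \<or> (\<exists>g'<Suc g. bad_gram x tau (gram p g'))"
        using s mem by (auto simp: b_def scan_inv_def g_def less_Suc_eq)
      have bH: "b < H" using H_ge by (simp add: b_def)
      have "scan_inv p s0 (Suc z) (set_reg rZ (Suc z) (set_reg rG 0 (set_reg rBad b (set_reg rG ?c s))))"
        using s base1(2) b unfolding scan_inv_def by (simp add: m0)
      then show ?thesis
        apply -
        apply (rule wp_Seq, rule wp_Assign[where v = b], rule fits_search, simp add: addr_def)
        subgoal by (simp add: addr_def b_def)
        apply (rule bH)
        apply (rule wp_Assign[where v = 0], rule fits_search, simp, simp, use H_ge in linarith)
        by (simp add: r addr_def)
    qed
    done
qed

text \<open>71 per letter: 60 for the body, 3 for the loop bound and 8 for the loop.\<close>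

lemma wp_scan:
  assumes s: "scan_inv p s0 0 (set_reg rZ 0 s)" and p: "p + wlen \<le> n"
    and Q: "\<And>T s1. T \<le> 71 * (grams * glen) + 9 \<Longrightarrow> base p s1 \<Longrightarrow> emitted s1 = emitted s0 \<Longrightarrow>
      (regs s1 rBad \<noteq> 0 \<longleftrightarrow> bad_window p) \<Longrightarrow> Q T s1"
  shows "wp (For rZ (Binop Times (Reg rQ) (Reg rLen)) (scan_body \<sigma>)) s Q"
proof (rule wp_For_time[where N = "grams * glen" and J = "scan_inv p s0" and B = 60])
  show "grams * glen < H" by (rule bounds)
  show "fits W H (Binop Times (Reg rQ) (Reg rLen))" by (rule fits_search)
  show "scan_inv p s0 0 (set_reg rZ 0 s)" by (rule s)
next
  fix z and s' :: state assume "scan_inv p s0 z s'"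
  then show "regs s' rZ = z \<and> val t s' (Binop Times (Reg rQ) (Reg rLen)) = grams * glen \<and>
      reads_inside t s' (Binop Times (Reg rQ) (Reg rLen))"
    by (simp add: scan_inv_def base_def ready_def)
next
  fix z and s' :: state assume "z < grams * glen" "scan_inv p s0 z s'"
  then show "wp (scan_body \<sigma>) s' (\<lambda>T s1. regs s1 rZ = z \<and> T \<le> 60 \<and> scan_inv p s0 (Suc z) (set_reg rZ (Suc z) s1))"
    using wp_scan_body p by blast
next
  fix T and s' :: state assume "scan_inv p s0 (grams * glen) s'"
    and "T \<le> grams * glen * (60 + rcost (Binop Times (Reg rQ) (Reg rLen)) + 8) + rcost (Binop Times (Reg rQ) (Reg rLen)) + 6"
  moreover have "grams * glen div glen = grams" using glen_pos by simp
  ultimately show "Q T s'"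
    by (intro Q) (auto simp: scan_inv_def bad_window_def)
qed

definition occ_start :: "nat \<Rightarrow> nat \<Rightarrow> nat" where
  "occ_start p z = p + z div combos"

definition occ_length :: "nat \<Rightarrow> nat" where
  "occ_length z = z mod combos div m"

definition occ_rot :: "nat \<Rightarrow> nat" where
  "occ_rot z = z mod combos mod m"

definition found :: "nat \<Rightarrow> nat \<Rightarrow> bool" where
  "found p z \<longleftrightarrow> 0 < occ_length z \<and> occ_start p z + occ_length z \<le> n \<and>
     lev (take (occ_length z) (drop (occ_start p z) t)) (rotate (occ_rot z) x) \<le> k"

text \<open>Soundness of all reports, completeness for starts before \<open>p\<close>. Once
  \<open>p\<close> is beyond every possible start, the two give equality.\<close>

definition correct_below :: "nat \<Rightarrow> state \<Rightarrow> bool" where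
  "correct_below p s \<longleftrightarrow> set (emitted s) \<subseteq> circular_occurrences k x t \<and>
     (\<forall>a b. (a, b) \<in> circular_occurrences k x t \<longrightarrow> a < p \<longrightarrow> (a, b) \<in> set (emitted s))"

definition check_inv :: "nat \<Rightarrow> nat \<Rightarrow> state \<Rightarrow> bool" where
  "check_inv p z s \<longleftrightarrow> base p s \<and> regs s rZ = z \<and> correct_below p s \<and>
     (\<forall>z'<z. found p z' \<longrightarrow> (occ_start p z', occ_start p z' + occ_length z' - 1) \<in> set (emitted s))"

lemma found_occurrence:
  assumes "found p z"
  shows "(occ_start p z, occ_start p z + occ_length z - 1) \<in> circular_occurrences k x t"
proof -
  have "occ_rot z < m" using m_pos by (simp add: occ_rot_def)
  moreover have "occ_start p z + occ_length z - 1 + 1 - occ_start p z = occ_length z"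
    using assms by (simp add: found_def)
  moreover have "occ_start p z \<le> occ_start p z + occ_length z - 1"
    "occ_start p z + occ_length z - 1 < n" using assms by (auto simp: found_def)
  ultimately show ?thesis
    using assms unfolding circular_occurrences_def mem_Collect_eq prod.case length_x length_t
      edit_distance_eq_lev factor_def found_def by metis
qed

text \<open>An occurrence of length \<open>l\<close> starting at \<open>a\<close> and close to
  rotation \<open>i\<close> is met in round \<open>(a - p) * combos + (l * m + i)\<close>, which
  lies below the loop bound.\<close>

lemma all_found:
  assumes inv: "check_inv p (stride * combos) s"
  shows "correct_below (p + stride) s"
  unfolding correct_below_def
proof (intro conjI allI impI)
  show "set (emitted s) \<subseteq> circular_occurrences k x t"
    using inv by (simp add: check_inv_def correct_below_def)
  fix a b assume occ: "(a, b) \<in> circular_occurrences k x t" and a: "a < p + stride"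
  show "(a, b) \<in> set (emitted s)"
  proof (cases "a < p")
    case True
    then show ?thesis using inv occ by (simp add: check_inv_def correct_below_def)
  next
    case False
    obtain i l where o: "i < m" "l = b + 1 - a" "a \<le> b" "1 \<le> l" "l \<le> 2 * m" "a + l \<le> n"
      "lev (take l (drop a t)) (rotate i x) \<le> k"
      using occurrence[OF occ] by metis
    define y where "y = l * m + i"
    have ym: "y mod m = i" "y div m = l" using o(1) by (simp_all add: y_def)
    have "y < Suc l * m" using o(1) by (simp add: y_def)
    also have "Suc l * m \<le> (2 * m + 1) * m" using o(5) by (intro mult_le_mono1) simp
    finally have ys: "y < combos" by (simp add: combos_def mult.commute)
    define z where "z = (a - p) * combos + y"
    have zm: "z mod combos = y" "z div combos = a - p" using ys by (simp_all add: z_def)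
    have "z < Suc (a - p) * combos" using ys by (simp add: z_def)
    also have "\<dots> \<le> stride * combos" using a False by (intro mult_le_mono1) simp
    finally have zl: "z < stride * combos" .
    have e: "occ_start p z = a" "occ_length z = l" "occ_rot z = i"
      using False zm ym by (simp_all add: occ_start_def occ_length_def occ_rot_def)
    have "found p z" unfolding found_def e using o by simp
    then have "(a, a + l - 1) \<in> set (emitted s)" using inv zl e by (auto simp: check_inv_def)
    moreover have "a + l - 1 = b" using o by simp
    ultimately show ?thesis by simp
  qed
qed

text \<open>206 is the cost per cell in \<open>wp_dp\<close>, with 6 for \<open>text_letter\<close>;
  100 covers decoding, test and report.\<close>

definition check_time :: nat where
  "check_time = Suc (2 * m) * Suc m * 206 + 100"

lemma ready_dp_frame: "ready s \<Longrightarrow> dp_frame s s' \<Longrightarrow> ready s'"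
  by (simp add: ready_def dp_frame_def)

lemma wp_check_body:
  assumes s: "check_inv p z s" and z: "z < stride * combos" and p: "p + wlen \<le> n"
  shows "wp check_body s (\<lambda>T s1. regs s1 rZ = z \<and> T \<le> check_time \<and> check_inv p (Suc z) (set_reg rZ (Suc z) s1))"
proof -
  define A where "A = occ_start p z"
  define y where "y = z mod combos"
  define U where "U = occ_length z"
  define i where "i = occ_rot z"
  have r: "regs s rPos = p" "regs s rZ = z" "regs s rX = combos" "regs s rM = m" "regs s rK = k"
    using s by (simp_all add: check_inv_def base_def ready_def combos_def)
  have combos: "combos > 0" using m_pos by (simp add: combos_def)
  have "z div combos < stride" by (rule less_mult_imp_div_less[OF z])
  then have AH: "A < H" using p stride nH mn by (simp add: A_def occ_start_def)
  have y: "y < combos" using combos by (simp add: y_def)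
  then have yH: "y < H" using bounds(6) by linarith
  have "i < m" using m_pos by (simp add: i_def occ_rot_def)
  then have iH: "i < H" using bounds(2) by linarith
  have "y < (2 * m + 1) * m" using y by (simp add: combos_def mult.commute)
  then have U: "U \<le> 2 * m" using less_mult_imp_div_less[of y "2 * m + 1" m] by (simp add: U_def occ_length_def y_def)
  have UH: "U < H" using U bounds(9) by simp
  define s1 where "s1 = set_reg rV m (set_reg rU U (set_reg rST i (set_reg rE y (set_reg rA A s))))"
  have r1: "regs s1 rA = A" "regs s1 rU = U" "regs s1 rV = m" "regs s1 rST = i" "regs s1 rM = m"
    "regs s1 rK = k" "regs s1 rZ = z" "memory s1 = memory s" "emitted s1 = emitted s" "regs s1 rPos = p"
    using r by (simp_all add: s1_def)
  have ready1: "ready s1" using s by (simp add: s1_def check_inv_def base_def ready_def)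
  have step: "check_inv p (Suc z) (set_reg rZ (Suc z) s2)"
    if "ready s2" "regs s2 rPos = p" "emitted s2 = (if found p z then (A, A + U - 1) # emitted s else emitted s)" for s2
  proof -
    have "ready (set_reg rZ (Suc z) s2)" using that(1) by (simp add: ready_def)
    then show ?thesis
      using s that(2,3) found_occurrence[of p z]
      by (auto simp: check_inv_def base_def correct_below_def less_Suc_eq A_def U_def)
  qed
  have cost: "rcost text_letter = 6" by (simp add: text_letter_def)
  have Ur: "Suc U * Suc m \<le> Suc (2 * m) * Suc m" using U by (intro mult_le_mono1) simp
  show ?thesis
    unfolding check_body_def
    apply (rule wp_Seq, rule wp_Assign[where v = A], rule fits_search, simp, simp add: r A_def occ_start_def, rule AH)
    apply (rule wp_Seq, rule wp_Assign[where v = y], rule fits_search, simp, simp add: r y_def, rule yH)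
    apply (rule wp_Seq, rule wp_Assign[where v = i], rule fits_search, simp, simp add: r i_def y_def occ_rot_def, rule iH)
    apply (rule wp_Seq, rule wp_Assign[where v = U], rule fits_search, simp, simp add: r U_def y_def occ_length_def, rule UH)
    apply (rule wp_Seq, rule wp_Assign[where v = m], rule fits_search, simp, simp add: r, rule bounds)
    apply (fold s1_def)
    apply (rule wp_Cond, rule fits_search, simp)
    subgoal premises q
    proof -
      have U0: "0 < U" and AU: "A + U \<le> n" using q by (auto simp: r1 length_t split: if_splits)
      let ?u = "take U (drop A t)" and ?v = "rotate i x"
      have lu: "length ?u = U" using AU length_t by simp
      have lv: "length ?v = m" by (simp add: length_x)
      have fnd: "found p z \<longleftrightarrow> lev ?u ?v \<le> k" using U0 AU by (simp add: found_def A_def U_def i_def)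
      show ?thesis
        apply (rule wp_Seq, rule wp_dp[where u = ?u and v = ?v])
        subgoal unfolding lu lv using Ur bounds(9) by linarith
        subgoal by (simp only: lu r1)
        subgoal by (simp only: lv r1)
        subgoal by (rule fits_search)
        subgoal premises e for s' i'
        proof -
          have "regs s' rA = A" "regs s' rU = U" using e(1) r1 by (simp_all add: dp_frame_def)
          moreover have "U - i' < U" "A + (U - i') < n" using e(2,3) AU U0 unfolding lu by linarith+
          ultimately show ?thesis using e AU unfolding lu by (simp add: text_letter_def length_t)
        qed
        subgoal premises e for j
        proof -
          have "j < m" using e lv by simp
          then have "?v ! j = x ! ((i + j) mod m)" by (simp add: nth_rotate length_x add.commute)
          moreover have "(i + j) mod m < m" using m_pos by simp
          ultimately show ?thesis using ready1 r1 by (simp add: ready_def)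
        qed
        subgoal premises e for T s'
        proof -
          have T: "T \<le> Suc (2 * m) * Suc m * 206"
          proof -
            have c: "200 + rcost text_letter = 206" by (simp add: cost)
            have "T \<le> Suc U * Suc m * 206" using e(1) unfolding lu lv c .
            also have "\<dots> \<le> Suc (2 * m) * Suc m * 206" by (rule mult_le_mono1[OF Ur])
            finally show ?thesis .
          qed
          have k1: "regs s' rK = k" "regs s' rA = A" "regs s' rU = U" "regs s' rZ = z" "regs s' rPos = p"
            "emitted s' = emitted s"
            using e(2) r1 by (simp_all add: dp_frame_def)
          have rd: "ready s'" by (rule ready_dp_frame[OF ready1 e(2)])
          show ?thesis
          proof (rule wp_Cond[OF fits_search(11)], goal_cases)
            case 1
            show ?case by simp
          next
            case 2
            then have "\<not> found p z" using e(3) k1 fnd by (simp split: if_splits)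
            then have "check_inv p (Suc z) (set_reg rZ (Suc z) s')" using rd k1 by (intro step) auto
            then show ?case using T k1 by (intro wp_Skip) (simp add: check_time_def)
          next
            case 3
            then have f: "found p z" using e(3) k1 fnd by (simp split: if_splits)
            let ?s2 = "s'\<lparr>emitted := (A, A + U - 1) # emitted s'\<rparr>"
            have "check_inv p (Suc z) (set_reg rZ (Suc z) ?s2)"
            proof (rule step)
              show "ready ?s2" using rd by (simp add: ready_def)
            qed (use k1 f in simp_all)
            then show ?case using T k1 by (intro wp_Emit[where a = A and b = "A + U - 1"] fits_search) (simp_all add: check_time_def)
          qed
        qed
        done
    qed
    subgoal premises q
    proof -
      have "\<not> found p z" using q by (auto simp: r1 length_t found_def A_def U_def split: if_splits)
      then have "check_inv p (Suc z) (set_reg rZ (Suc z) s1)" using ready1 r1 by (intro step) auto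
      then show ?thesis by (intro wp_Skip) (simp add: r1 check_time_def)
    qed
    done
qed

definition check_all_time :: nat where
  "check_all_time = stride * combos * (check_time + 11) + 9"

definition window_time :: "nat \<Rightarrow> nat" where
  "window_time p = 71 * (grams * glen) + 40 + (if bad_window p then check_all_time else 0)"

lemma wp_check_all:
  assumes s: "base p s" "correct_below p s" and p: "p + wlen \<le> n"
    and Q: "\<And>T s1. T \<le> check_all_time \<Longrightarrow> base p s1 \<Longrightarrow> correct_below (p + stride) s1 \<Longrightarrow> Q T s1"
  shows "wp (For rZ (Binop Times (Reg rS) (Reg rX)) check_body) s Q"
proof (rule wp_For_time[where N = "stride * combos" and J = "check_inv p" and B = check_time])
  show "stride * combos < H" by (rule bounds)
  show "fits W H (Binop Times (Reg rS) (Reg rX))" by (rule fits_search)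
  show "check_inv p 0 (set_reg rZ 0 s)"
    using s by (simp add: check_inv_def base_def ready_def correct_below_def)
next
  fix z and s' :: state assume "check_inv p z s'"
  then show "regs s' rZ = z \<and> val t s' (Binop Times (Reg rS) (Reg rX)) = stride * combos \<and>
      reads_inside t s' (Binop Times (Reg rS) (Reg rX))"
    by (simp add: check_inv_def base_def ready_def combos_def)
next
  fix z and s' :: state assume "z < stride * combos" "check_inv p z s'"
  then show "wp check_body s' (\<lambda>T s1. regs s1 rZ = z \<and> T \<le> check_time \<and> check_inv p (Suc z) (set_reg rZ (Suc z) s1))"
    using wp_check_body p by blast
next
  fix T and s' :: state assume inv: "check_inv p (stride * combos) s'"
    and T: "T \<le> stride * combos * (check_time + rcost (Binop Times (Reg rS) (Reg rX)) + 8) + rcost (Binop Times (Reg rS) (Reg rX)) + 6"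
  show "Q T s'"
  proof (rule Q)
    show "T \<le> check_all_time" using T by (simp add: check_all_time_def ac_simps)
    show "base p s'" using inv by (simp add: check_inv_def)
    show "correct_below (p + stride) s'" by (rule all_found[OF inv])
  qed
qed

text \<open>A verified window extends \<open>correct_below\<close> by enumeration; a skipped one
  extends it by \<open>good_window\<close>, because no occurrence starts before the next
  window.\<close>

lemma wp_window:
  assumes s: "base p s" "correct_below p s" and p: "p + wlen \<le> n"
  shows "wp (window \<sigma>) s (\<lambda>T s1. T \<le> window_time p \<and> base (p + stride) s1 \<and> correct_below (p + stride) s1)"
proof -
  have aH: "always < H" using H_ge by (simp add: always_def)
  have r: "regs s rF = always" using s by (simp add: base_def ready_def)
  have psH: "p + stride < H" using p stride nH mn by linarith
  have finish: "wp (Assign rPos (Binop Plus (Reg rPos) (Reg rS))) s' Q'"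
    if s': "base p s'" and Q': "\<And>s1. base (p + stride) s1 \<Longrightarrow> emitted s1 = emitted s' \<Longrightarrow>
        Q' (1 + rcost (Binop Plus (Reg rPos) (Reg rS))) s1" for s' Q'
    apply (rule wp_Assign[where v = "p + stride"], rule fits_search, simp)
    subgoal using s' by (simp add: base_def ready_def)
    apply (rule psH)
    apply (rule Q')
    using s' by (simp_all add: base_def ready_def)
  show ?thesis
    unfolding window_def
    apply (rule wp_Seq, rule wp_Assign[where v = always], rule fits_search, simp, simp add: r, rule aH)
    apply (rule wp_Seq, rule wp_Assign[where v = 0], rule fits_search, simp, simp, use H_ge in linarith)
    apply (rule wp_Seq, rule wp_scan[where ?s0.0 = s, OF _ p])
    subgoal using s(1) by (simp add: scan_inv_def base_def ready_def)
    subgoal premises q for T s1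
    proof -
      have cb: "correct_below p s1" using s(2) q(3) by (simp add: correct_below_def)
      show ?thesis
        apply (rule wp_Seq, rule wp_Cond, rule fits_search, simp)
        subgoal premises b
          apply (rule wp_check_all[OF q(2) cb p])
          apply (rule finish, assumption)
          using b q(1,4) by (simp add: window_time_def correct_below_def)
        subgoal premises b
        proof -
          have good: "\<not> bad_window p" using b q(4) by simp
          have "correct_below (p + stride) s1"
            unfolding correct_below_def
          proof (intro conjI allI impI)
            show "set (emitted s1) \<subseteq> circular_occurrences k x t" using cb by (simp add: correct_below_def)
            fix a b assume o: "(a, b) \<in> circular_occurrences k x t" "a < p + stride"
            then have "a < p" using good_window[OF good p o(1)] by linarith
            then show "(a, b) \<in> set (emitted s1)" using cb o(1) by (simp add: correct_below_def)
          qed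
          then show ?thesis
            apply -
            apply (rule wp_Skip)
            apply (rule finish[OF q(2)])
            using q(1) by (simp add: window_time_def correct_below_def)
        qed
        done
    qed
    done
qed

definition windows :: nat where
  "windows = Suc ((n - wlen) div stride)"

text \<open>When the loop stops, fewer than \<open>wlen\<close> letters remain, so every occurrence
  starts earlier and has been reported. The 8 per window is the loop test.\<close>

lemma wp_searching:
  assumes s: "ready s" "emitted s = []"
    and Q: "\<And>T s1. T \<le> (\<Sum>j<windows. window_time (j * stride) + 8) + 20 \<Longrightarrow>
      set (emitted s1) = circular_occurrences k x t \<Longrightarrow> Q T s1"
  shows "wp (searching \<sigma>) s Q"
proof -
  let ?e = "Binop Less (Binop Plus (Reg rPos) (Reg rW)) (Binop Plus Input_Length (Const 1))"
  let ?I = "\<lambda>T (s' :: state). \<exists>j. base (j * stride) s' \<and> correct_below (j * stride) s' \<and> j \<le> windows \<and>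
    T \<le> (\<Sum>i<j. window_time (i * stride) + 8)"
  have wn: "wlen \<le> n" using wlen mn by linarith
  have lt_windows: "j < windows" if "j * stride + wlen \<le> n" for j
  proof -
    have "j * stride \<le> n - wlen" using that by linarith
    then have "j \<le> (n - wlen) div stride" using stride(1) by (simp add: less_eq_div_iff_mult_less_eq)
    then show ?thesis by (simp add: windows_def)
  qed
  have ev: "val t s' ?e = of_bool (p + wlen \<le> n)" if "base p s'" for s' p
    using that length_t by (auto simp: base_def ready_def)
  show ?thesis
    unfolding searching_def
  proof (rule wp_Seq, rule wp_Assign[where v = 0], rule fits_search, simp, simp, use H_ge in linarith,
      rule wp_While[where I = ?I and \<mu> = "\<lambda>s. n + 1 - regs s rPos"])
    show "?I 0 (set_reg rPos 0 s)"
      using s by (intro exI[of _ 0]) (simp add: base_def ready_def correct_below_def)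
    show "fits W H ?e" by (rule fits_search)
  next
    fix T and s' :: state assume "?I T s'"
    then show "reads_inside t s' ?e" by simp
  next
    fix T and s' :: state assume I: "?I T s'" and v: "val t s' ?e \<noteq> 0"
    then obtain j where j: "base (j * stride) s'" "correct_below (j * stride) s'"
      "T \<le> (\<Sum>i<j. window_time (i * stride) + 8)" by blast
    have p: "j * stride + wlen \<le> n" using v unfolding ev[OF j(1)] by simp
    show "wp (window \<sigma>) s' (\<lambda>T1 s1. n + 1 - regs s1 rPos < n + 1 - regs s' rPos \<and> ?I (T + (1 + rcost ?e + T1)) s1)"
    proof (rule wp_mono[OF wp_window[OF j(1,2) p]], elim conjE)
      fix T1 and s1 :: state
      assume T1: "T1 \<le> window_time (j * stride)" and b: "base (j * stride + stride) s1"
        and c: "correct_below (j * stride + stride) s1"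
      have "n + 1 - regs s1 rPos < n + 1 - regs s' rPos"
        using j(1) b p stride(1) by (simp add: base_def)
      moreover have "?I (T + (1 + rcost ?e + T1)) s1"
      proof (intro exI[of _ "Suc j"] conjI)
        show "base (Suc j * stride) s1" "correct_below (Suc j * stride) s1"
          using b c by (simp_all add: add.commute)
        show "Suc j \<le> windows" using lt_windows[OF p] by simp
        show "T + (1 + rcost ?e + T1) \<le> (\<Sum>i<Suc j. window_time (i * stride) + 8)"
          using j(3) T1 by simp
      qed
      ultimately show "n + 1 - regs s1 rPos < n + 1 - regs s' rPos \<and> ?I (T + (1 + rcost ?e + T1)) s1" ..
    qed
  next
    fix T and s' :: state assume I: "?I T s'" and v: "val t s' ?e = 0"
    then obtain j where j: "base (j * stride) s'" "correct_below (j * stride) s'" "j \<le> windows"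
      "T \<le> (\<Sum>i<j. window_time (i * stride) + 8)" by blast
    have p: "\<not> j * stride + wlen \<le> n" using v unfolding ev[OF j(1)] by simp
    show "Q (1 + (1 + rcost (Const 0)) + (T + (1 + rcost ?e))) s'"
    proof (rule Q)
      have "(\<Sum>i<j. window_time (i * stride) + 8) \<le> (\<Sum>i<windows. window_time (i * stride) + 8)"
        using j(3) by (intro sum_mono2) auto
      then show "1 + (1 + rcost (Const 0)) + (T + (1 + rcost ?e)) \<le> (\<Sum>j<windows. window_time (j * stride) + 8) + 20"
        using j(4) by simp
      show "set (emitted s') = circular_occurrences k x t"
      proof (intro equalityI subsetI)
        fix ab assume "ab \<in> circular_occurrences k x t"
        moreover obtain a b where ab: "ab = (a, b)" by (cases ab)
        ultimately have occ: "(a, b) \<in> circular_occurrences k x t" by simp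
        obtain l where "wlen \<le> l" "a + l \<le> n" using occurrence[OF occ] by metis
        then have "a < j * stride" using p by linarith
        then show "ab \<in> set (emitted s')" using j(2) occ ab by (simp add: correct_below_def)
      qed (use j(2) in \<open>auto simp: correct_below_def\<close>)
    qed
  qed
qed

end

section \<open>Correctness and running time of the algorithm\<close>

text \<open>The word exponent is \<open>2 e + 4\<close> where \<open>H = (n + 2) ^ e\<close>:
  doubling covers \<open>H * H\<close>, and \<open>(n + 2) ^ 4\<close> covers the factor 16. It
  depends on \<open>\<sigma>\<close> and \<open>K\<close> only.\<close>

definition acsm_algorithm :: "nat \<Rightarrow> nat \<Rightarrow> nat \<Rightarrow> algorithm" where
  "acsm_algorithm \<sigma> K D = \<lparr>preprocess = preprocessing \<sigma> K D, search = searching \<sigma>,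
     word_exponent = 2 * ((\<sigma> + 1) * K + 2 * K + \<sigma> + 10) + 4\<rparr>"

text \<open>Turns constants such as \<open>\<sigma>\<close> and \<open>K\<close> into exponents of
  \<open>n + 2\<close>, so that size bounds become comparisons of exponents.\<close>

lemma two_power_le: "(2::nat) \<le> N \<Longrightarrow> c \<le> N ^ c"
  by (meson less_exp less_imp_le order_trans power_mono zero_le)

context acsm
begin

lemma word_bounds:
  assumes mn: "m < n" and H: "H = (n + 2) ^ ((\<sigma> + 1) * K + 2 * K + \<sigma> + 10)"
  shows "\<sigma> ^ glen * (m * (2 * glen + 1)) < H" "m * (2 * m + 1) < H"
    "(m + 1) * (m * (2 * m + 1)) < H" "2 * n + 5 < H" "16 \<le> H"
    "\<sigma> ^ glen < H"
proof -
  define N where "N = n + 2"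
  have N: "2 \<le> N" "m \<le> N" "m + 1 \<le> N" using mn by (auto simp: N_def)
  have HN: "H = N ^ ((\<sigma> + 1) * K + 2 * K + \<sigma> + 10)" by (simp add: H N_def)
  have less: "a < H" if "a \<le> N ^ i" "i < (\<sigma> + 1) * K + 2 * K + \<sigma> + 10" for a i
  proof -
    have "N ^ i < H" unfolding HN using N that(2) by (intro power_strict_increasing) auto
    then show ?thesis using that(1) by linarith
  qed
  let ?L = "gram_exp \<sigma> m"
  have "\<sigma> ^ ?L \<le> \<sigma> * m" by (rule gram_exp_m)
  also have "\<dots> \<le> N ^ \<sigma> * N" using N two_power_le[OF N(1)] by (intro mult_le_mono)
  also have "\<dots> = N ^ (\<sigma> + 1)" by simp
  finally have sL: "\<sigma> ^ ?L \<le> N ^ (\<sigma> + 1)" .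
  have "\<sigma> ^ glen = (\<sigma> ^ ?L) ^ K" by (simp add: glen_def power_mult mult.commute flip: power_mult)
  also have "\<dots> \<le> (N ^ (\<sigma> + 1)) ^ K" using sL by (rule power_mono) simp
  also have "\<dots> = N ^ ((\<sigma> + 1) * K)" by (simp only: power_mult)
  finally have sg: "\<sigma> ^ glen \<le> N ^ ((\<sigma> + 1) * K)" .
  have L1: "1 \<le> ?L" by (rule gram_exp_m)
  have "?L \<le> \<sigma> ^ ?L" using two_power_le[OF \<sigma>] .
  then have LN: "?L \<le> N ^ (\<sigma> + 1)" using sL by linarith
  have "2 * glen + 1 \<le> (2 * K + 1) * ?L" using L1 by (simp add: glen_def)
  also have "\<dots> \<le> N ^ (2 * K + 1) * N ^ (\<sigma> + 1)" using two_power_le[OF N(1)] LN by (intro mult_le_mono)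
  also have "\<dots> = N ^ (2 * K + \<sigma> + 2)" by (simp flip: power_add)
  finally have g: "2 * glen + 1 \<le> N ^ (2 * K + \<sigma> + 2)" .
  have "\<sigma> ^ glen * (m * (2 * glen + 1)) \<le> N ^ ((\<sigma> + 1) * K) * (N ^ 1 * N ^ (2 * K + \<sigma> + 2))"
    using sg g N by (intro mult_le_mono) simp_all
  also have "\<dots> = N ^ ((\<sigma> + 1) * K + (1 + (2 * K + \<sigma> + 2)))" by (simp only: power_add)
  finally show "\<sigma> ^ glen * (m * (2 * glen + 1)) < H" by (rule less) simp
  show "\<sigma> ^ glen < H" by (rule less[OF sg]) simp
  have m2: "2 * m + 1 \<le> N ^ 2"
  proof -
    have "2 * m + 1 \<le> 2 * N" using N by linarith
    also have "\<dots> \<le> N * N" using N by (intro mult_le_mono1)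
    finally show ?thesis by (simp add: power2_eq_square)
  qed
  have "m * (2 * m + 1) \<le> N ^ 1 * N ^ 2" using N m2 by (intro mult_le_mono) simp_all
  also have "\<dots> = N ^ 3" by (simp add: eval_nat_numeral)
  finally show "m * (2 * m + 1) < H" by (rule less) simp
  have "(m + 1) * (m * (2 * m + 1)) \<le> N ^ 1 * (N ^ 1 * N ^ 2)" using N m2 by (intro mult_le_mono) simp_all
  also have "\<dots> = N ^ 4" by (simp add: eval_nat_numeral)
  finally show "(m + 1) * (m * (2 * m + 1)) < H" by (rule less) simp
  have "2 * n + 5 \<le> 4 * N" by (simp add: N_def)
  also have "4 * N \<le> N ^ 2 * N ^ 1" using power_mono[OF N(1), of 2] by (intro mult_le_mono) simp_all
  also have "\<dots> = N ^ 3" by (simp add: eval_nat_numeral)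
  finally show "2 * n + 5 < H" by (rule less) simp
  have "(2::nat) ^ 4 \<le> N ^ 4" using N by (intro power_mono) auto
  then have "16 \<le> N ^ 4" by simp
  then show "16 \<le> H" using less[of 16 4] by simp
qed

text \<open>From here on the quantities of the search take the text as an argument, because the
  expectation ranges over all texts.\<close>

definition bad_at :: "nat list \<Rightarrow> nat \<Rightarrow> bool" where
  "bad_at t p \<longleftrightarrow> always \<noteq> 0 \<or> (\<exists>g<grams. bad_gram x tau (take glen (drop (p + stride - 1 + glen * g) t)))"

definition window_count :: "nat \<Rightarrow> nat" where
  "window_count n = Suc ((n - wlen) div stride)"

definition verify_time :: nat where
  "verify_time = (m + 1) * (m * (2 * m + 1)) * (Suc (2 * m) * Suc m * 206 + 111) + 9"

definition time_bound :: "nat \<Rightarrow> nat list \<Rightarrow> nat" where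
  "time_bound n t =
     (\<Sum>j<window_count n. 71 * (grams * glen) + 48 + (if bad_at t (j * stride) then verify_time else 0)) + 20"

text \<open>Both locales are instantiated with the same \<open>H\<close> and \<open>W\<close>, so
  the bounds holding after the preprocessing are those with which the search starts.\<close>

lemma run_bound:
  assumes mn: "m < n" and t: "t \<in> strings \<sigma> n"
  shows "\<exists>T s'. run_search (acsm_algorithm \<sigma> K D) k x t T s' \<and>
    set (emitted s') = circular_occurrences k x t \<and> T \<le> time_bound n t"
proof -
  define e where "e = (\<sigma> + 1) * K + 2 * K + \<sigma> + 10"
  define H where "H = (n + 2) ^ e"
  define W where "W = (n + 2) ^ (2 * e + 4)"
  note b = word_bounds[OF mn H_def[unfolded e_def]]
  have WH: "16 * (H * H) \<le> W"
  proof -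
    have "(2::nat) ^ 4 \<le> (n + 2) ^ 4" by (intro power_mono) auto
    then have "16 * (H * H) \<le> (n + 2) ^ 4 * (H * H)" by (intro mult_le_mono1) simp
    also have "\<dots> = W" by (simp add: W_def H_def power_add power_mult power2_eq_square mult_2 mult.commute)
    finally show ?thesis .
  qed
  have sH: "\<sigma> < H"
  proof -
    have "\<sigma> ^ 1 \<le> \<sigma> ^ glen" using \<sigma> glen_pos by (intro power_increasing) auto
    then show ?thesis using b(6) by simp
  qed
  have letters: "\<And>i. i < length x \<Longrightarrow> x ! i < H" using x_letter length_x sH by (metis less_trans)
  interpret P: acsm_pre \<sigma> K D k m H x W
    by unfold_locales (use WH b letters mn length_x in auto)
  have tl: "length t = n" "\<And>i. i < length t \<Longrightarrow> t ! i < H"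
    using t sH by (auto simp: strings_def dest!: nth_mem intro: less_trans)
  interpret S: acsm_search \<sigma> K D k m H x W t n
    by unfold_locales (use WH b tl mn t in auto)
  have "state_bounded H (initial_state k)"
    using b(4,5) mn k by (auto simp: state_bounded_def initial_state_def)
  moreover have "P.wp (preprocessing \<sigma> K D) (initial_state k) (\<lambda>_ s0. ready s0)"
    by (rule P.wp_preprocessing) (auto simp: initial_state_def)
  ultimately obtain T0 s0 where pre: "exec W x (preprocessing \<sigma> K D) (initial_state k) T0 s0"
    "state_bounded H s0" "ready s0" unfolding P.wp_def by blast
  let ?s = "s0\<lparr>emitted := []\<rparr>"
  have "state_bounded H ?s" using pre(2) by (simp add: state_bounded_def)
  moreover have "ready ?s" using pre(3) by (simp add: ready_def)
  then have "S.wp (searching \<sigma>) ?s (\<lambda>T s1. T \<le> (\<Sum>j<S.windows. S.window_time (j * stride) + 8) + 20 \<and>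
      set (emitted s1) = circular_occurrences k x t)"
    by (rule S.wp_searching) auto
  ultimately obtain T s1 where run: "exec W t (searching \<sigma>) ?s T s1"
    "T \<le> (\<Sum>j<S.windows. S.window_time (j * stride) + 8) + 20"
    "set (emitted s1) = circular_occurrences k x t" unfolding S.wp_def by blast
  have "run_search (acsm_algorithm \<sigma> K D) k x t T s1"
    unfolding run_search_def Let_def tl(1)
  proof (rule exI[of _ T0], rule exI[of _ s0], rule conjI)
    have W: "(n + 2) ^ word_exponent (acsm_algorithm \<sigma> K D) = W"
      by (simp add: acsm_algorithm_def W_def e_def)
    show "exec ((n + 2) ^ word_exponent (acsm_algorithm \<sigma> K D)) x (preprocess (acsm_algorithm \<sigma> K D))
        (initial_state k) T0 s0" unfolding W using pre(1) by (simp add: acsm_algorithm_def)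
    show "exec ((n + 2) ^ word_exponent (acsm_algorithm \<sigma> K D)) t (search (acsm_algorithm \<sigma> K D)) ?s T s1"
      unfolding W using run(1) by (simp add: acsm_algorithm_def)
  qed
  moreover have "T \<le> time_bound n t"
  proof -
    have "stride * S.combos \<le> (m + 1) * (m * (2 * m + 1))"
      unfolding S.combos_def using S.stride(2) by (rule mult_le_mono1)
    then have "S.check_all_time \<le> verify_time"
      unfolding S.check_all_time_def S.check_time_def verify_time_def by (simp add: add.assoc)
    moreover have "S.bad_window p = bad_at t p" for p
      by (simp only: bad_at_def S.bad_window_def S.gram_def)
    ultimately have "S.window_time p + 8 \<le> 71 * (grams * glen) + 48 + (if bad_at t p then verify_time else 0)" for p
      by (simp add: S.window_time_def)
    then have "(\<Sum>j<S.windows. S.window_time (j * stride) + 8) \<le>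
        (\<Sum>j<window_count n. 71 * (grams * glen) + 48 + (if bad_at t (j * stride) then verify_time else 0))"
      unfolding S.windows_def window_count_def by (intro sum_mono)
    then show ?thesis using run(2) by (simp add: time_bound_def)
  qed
  ultimately show ?thesis using run(3) by blast
qed

end

lemma acsm_algorithm_solves:
  assumes "2 \<le> \<sigma>" "1 \<le> K" "D \<le> K"
  shows "solves_ACSM \<sigma> (acsm_algorithm \<sigma> K D)"
  unfolding solves_ACSM_def
proof (intro allI ballI impI)
  fix n m k x t
  assume *: "x \<in> strings \<sigma> m" "t \<in> strings \<sigma> n" "k < m" "m < n"
  interpret acsm \<sigma> K D k m x
    using assms * by unfold_locales auto
  show "\<exists>T s'. run_search (acsm_algorithm \<sigma> K D) k x t T s' \<and>
      set (emitted s') = circular_occurrences k x t"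
    using run_bound[of n t] * by blast
qed

section \<open>Average search time\<close>

lemma map_drop_replicate_pmf: "map_pmf (drop a) (replicate_pmf (a + c) p) = replicate_pmf c p"
proof (induction a)
  case (Suc a)
  have "map_pmf (drop (Suc a)) (replicate_pmf (Suc a + c) p) =
      bind_pmf p (\<lambda>_. map_pmf (drop a) (replicate_pmf (a + c) p))"
    by (simp add: map_bind_pmf) (simp add: map_pmf_def)
  then show ?case using Suc by simp
qed (simp add: map_pmf_ident)

lemma map_take_replicate_pmf: "map_pmf (take l) (replicate_pmf (l + b) p) = replicate_pmf l p"
proof (induction l)
  case 0
  have "map_pmf (take 0) (replicate_pmf b p) = return_pmf []" by (simp add: map_pmf_const)
  then show ?case by simp
next
  case (Suc l)
  have "map_pmf (take (Suc l)) (replicate_pmf (Suc l + b) p) =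
      bind_pmf p (\<lambda>x. map_pmf (\<lambda>xs. x # xs) (map_pmf (take l) (replicate_pmf (l + b) p)))"
    by (simp add: map_bind_pmf map_pmf_comp) (simp add: map_pmf_def)
  then show ?case using Suc by (simp add: map_pmf_def)
qed

lemma pmf_replicate_uniform:
  assumes "\<sigma> > 0" "w \<in> strings \<sigma> l"
  shows "pmf (replicate_pmf l (pmf_of_set {..<\<sigma>})) w = 1 / real \<sigma> ^ l"
  using assms(2)
proof (induction l arbitrary: w)
  case 0
  then show ?case by (simp add: strings_def)
next
  case (Suc l)
  obtain a v where w: "w = a # v" "a < \<sigma>" "v \<in> strings \<sigma> l"
    using Suc.prems by (cases w) (auto simp: strings_def)
  let ?p = "pmf_of_set {..<\<sigma>}"
  have "replicate_pmf (Suc l) ?p = map_pmf (\<lambda>(x, xs). x # xs) (pair_pmf ?p (replicate_pmf l ?p))"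
    by (simp add: pair_pmf_def map_bind_pmf)
  moreover have "inj (\<lambda>(x :: nat, xs). x # xs)" by (auto simp: inj_def)
  ultimately have "pmf (replicate_pmf (Suc l) ?p) w = pmf (pair_pmf ?p (replicate_pmf l ?p)) (a, v)"
    using pmf_map_inj'[of "\<lambda>(x :: nat, xs). x # xs" _ "(a, v)"] w(1) by simp
  also have "\<dots> = 1 / real \<sigma> * (1 / real \<sigma> ^ l)"
    using Suc.IH[OF w(3)] w(2) assms(1) by (simp add: pmf_pair pmf_of_set lessThan_empty_iff)
  finally show ?case by simp
qed

text \<open>A factor at a fixed position of the random text is uniform among the strings of its
  length, so the probability is a fraction of a finite set.\<close>

lemma prob_factor:
  assumes "\<sigma> > 0" "a + l \<le> n"
  shows "measure_pmf.prob (replicate_pmf n (pmf_of_set {..<\<sigma>})) {t. P (take l (drop a t))}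
    = real (card {w \<in> strings \<sigma> l. P w}) / real \<sigma> ^ l"
proof -
  let ?p = "pmf_of_set {..<\<sigma>}"
  obtain b where n: "n = a + (l + b)" using assms(2) by (metis add.assoc le_Suc_ex)
  have "replicate_pmf l ?p = map_pmf (\<lambda>t. take l (drop a t)) (replicate_pmf n ?p)"
    unfolding n map_take_replicate_pmf[of l b ?p, symmetric] map_drop_replicate_pmf[of a "l + b" ?p, symmetric]
    by (simp only: map_pmf_comp)
  then have "measure_pmf.prob (replicate_pmf n ?p) {t. P (take l (drop a t))} =
      measure_pmf.prob (replicate_pmf l ?p) {w. P w}"
    by (simp add: vimage_def)
  also have "\<dots> = measure_pmf.prob (replicate_pmf l ?p) ({w. P w} \<inter> set_pmf (replicate_pmf l ?p))"
    by (simp add: measure_Int_set_pmf)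
  also have "set_pmf (replicate_pmf l ?p) = strings \<sigma> l" by (rule set_replicate_uniform[OF assms(1)])
  also have "{w. P w} \<inter> strings \<sigma> l = {w \<in> strings \<sigma> l. P w}" by blast
  also have "measure_pmf.prob (replicate_pmf l ?p) {w \<in> strings \<sigma> l. P w} = (\<Sum>w\<in>{w \<in> strings \<sigma> l. P w}. pmf (replicate_pmf l ?p) w)"
    by (rule measure_measure_pmf_finite) simp
  also have "\<dots> = (\<Sum>w\<in>{w \<in> strings \<sigma> l. P w}. 1 / real \<sigma> ^ l)"
    using assms(1) by (intro sum.cong refl pmf_replicate_uniform) auto
  finally show ?thesis by simp
qed

context acsm
begin

text \<open>Linearity of expectation over the windows, whose blocks may overlap.
  \<open>\<beta>\<close> bounds the probability that a window is verified; the bound on the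
  remaining time is the same for all texts.\<close>

lemma average_bound:
  fixes \<beta> :: real
  defines "M n \<equiv> replicate_pmf n (pmf_of_set {..<\<sigma>})"
  assumes mn: "m < n" and \<beta>: "\<And>p. p + wlen \<le> n \<Longrightarrow> measure_pmf.prob (M n) {t. bad_at t p} \<le> \<beta>"
  shows "average_search_time \<sigma> (acsm_algorithm \<sigma> K D) k x n \<le>
    real (window_count n) * (71 * real (grams * glen) + 48 + real verify_time * \<beta>) + 20"
proof -
  have set_M: "set_pmf (M n) = strings \<sigma> n" unfolding M_def using \<sigma> by (intro set_replicate_uniform) simp
  have int: "integrable (measure_pmf (M n)) f" for f :: "nat list \<Rightarrow> real"
    by (rule integrable_measure_pmf_finite) (simp add: set_M)
  let ?f = "\<lambda>j t. 71 * real (grams * glen) + 48 + real verify_time * indicator {t. bad_at t (j * stride)} t"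
  have tb: "real (time_bound n t) = (\<Sum>j<window_count n. ?f j t) + 20" for t
    unfolding time_bound_def of_nat_add of_nat_sum
    by (intro arg_cong2[where f = "(+)"] sum.cong) (auto simp: indicator_def)
  have "average_search_time \<sigma> (acsm_algorithm \<sigma> K D) k x n \<le>
      measure_pmf.expectation (M n) (\<lambda>t. real (time_bound n t))"
    unfolding average_search_time_def M_def[symmetric]
  proof (intro integral_mono_AE int)
    show "AE t in measure_pmf (M n). real (search_time (acsm_algorithm \<sigma> K D) k x t) \<le> real (time_bound n t)"
      unfolding AE_measure_pmf_iff set_M
    proof
      fix t assume "t \<in> strings \<sigma> n"
      from run_bound[OF mn this] show "real (search_time (acsm_algorithm \<sigma> K D) k x t) \<le> real (time_bound n t)"
        using search_time_eq by fastforce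
    qed
  qed
  also have "\<dots> = (\<Sum>j<window_count n. measure_pmf.expectation (M n) (?f j)) + 20"
    unfolding tb using int by (subst Bochner_Integration.integral_add) (auto simp: Bochner_Integration.integral_sum)
  also have "\<dots> \<le> (\<Sum>j<window_count n. 71 * real (grams * glen) + 48 + real verify_time * \<beta>) + 20"
  proof (intro add_right_mono sum_mono)
    fix j assume "j \<in> {..<window_count n}"
    then have "j \<le> (n - wlen) div stride" by (simp add: window_count_def)
    then have "j * stride \<le> n - wlen" by (simp add: less_eq_div_iff_mult_less_eq stride_def)
    then have p: "j * stride + wlen \<le> n" using mn by (simp add: wlen_def)
    have "measure_pmf.expectation (M n) (?f j) =
        71 * real (grams * glen) + 48 + real verify_time * measure_pmf.prob (M n) {t. bad_at t (j * stride)}"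
      using int by (subst Bochner_Integration.integral_add) simp_all
    also have "\<dots> \<le> 71 * real (grams * glen) + 48 + real verify_time * \<beta>"
      using \<beta>[OF p] by (intro add_left_mono mult_left_mono) auto
    finally show "measure_pmf.expectation (M n) (?f j) \<le> 71 * real (grams * glen) + 48 + real verify_time * \<beta>" .
  qed
  also have "\<dots> = real (window_count n) * (71 * real (grams * glen) + 48 + real verify_time * \<beta>) + 20" by simp
  finally show ?thesis .
qed

text \<open>A union bound over the grams of the block, each of which sits at a fixed position of the
  text.\<close>

lemma prob_bad:
  assumes "always = 0" and e: "0 < e" "e \<le> glen" "tau = glen - e" and small: "36 * real glen ^ 2 \<le> real e ^ 2 * real \<sigma>"
    and p: "p + wlen \<le> n"
  shows "measure_pmf.prob (replicate_pmf n (pmf_of_set {..<\<sigma>})) {t. bad_at t p} \<le> real grams * (real m / 2 ^ e)"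
proof -
  let ?M = "replicate_pmf n (pmf_of_set {..<\<sigma>})"
  let ?B = "\<lambda>g. {t. bad_gram x tau (take glen (drop (p + stride - 1 + glen * g) t))}"
  have scan: "stride - 1 + grams * glen = wlen"
    by (auto simp: stride_def grams_def)
  have "{t. bad_at t p} = (\<Union>g<grams. ?B g)" using assms(1) by (auto simp: bad_at_def)
  then have "measure_pmf.prob ?M {t. bad_at t p} \<le> (\<Sum>g<grams. measure_pmf.prob ?M (?B g))"
    by (simp add: measure_pmf.finite_measure_subadditive_finite)
  also have "\<dots> \<le> (\<Sum>g<grams. real m / 2 ^ e)"
  proof (rule sum_mono)
    fix g assume "g \<in> {..<grams}"
    then have "Suc g * glen \<le> grams * glen" by (intro mult_le_mono1) simp
    then have fit: "p + stride - 1 + glen * g + glen \<le> n"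
      using scan p by (simp add: mult.commute stride_def)
    have "measure_pmf.prob ?M (?B g) = real (card {w \<in> strings \<sigma> glen. bad_gram x (glen - e) w}) / real \<sigma> ^ glen"
      unfolding e(3) using \<sigma> fit by (intro prob_factor) auto
    also have "\<dots> \<le> real (length x) / 2 ^ e"
      using e \<sigma> small by (intro bad_gram_fraction) auto
    finally show "measure_pmf.prob ?M (?B g) \<le> real m / 2 ^ e" by (simp add: length_x)
  qed
  finally show ?thesis by simp
qed

text \<open>Of order \<open>m\<close> starts, \<open>m ^ 2\<close> pairs of a length and a rotation,
  and \<open>m ^ 2\<close> table cells for each. This degree is what the rarity of bad windows has
  to outweigh.\<close>

lemma verify_time_le: "real verify_time \<le> 10000 * real m ^ 5"
proof -
  have a: "m + 1 \<le> 2 * m" "2 * m + 1 \<le> 3 * m" "Suc (2 * m) \<le> 3 * m" "Suc m \<le> 2 * m" using m_pos by linarith+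
  have b: "1 \<le> m * m" "1 \<le> m ^ 5" using m_pos by simp_all
  have "(m + 1) * (m * (2 * m + 1)) \<le> 2 * m * (m * (3 * m))"
    by (rule mult_le_mono[OF a(1) mult_le_mono2[OF a(2)]])
  moreover have "Suc (2 * m) * Suc m * 206 + 111 \<le> 3 * m * (2 * m) * 206 + 111 * (m * m)"
    using mult_le_mono[OF a(3,4)] b(1) by linarith
  ultimately have "(m + 1) * (m * (2 * m + 1)) * (Suc (2 * m) * Suc m * 206 + 111) \<le>
      2 * m * (m * (3 * m)) * (3 * m * (2 * m) * 206 + 111 * (m * m))" by (rule mult_le_mono)
  then have "verify_time \<le> 2 * m * (m * (3 * m)) * (3 * m * (2 * m) * 206 + 111 * (m * m)) + 9 * m ^ 5"
    unfolding verify_time_def using b(2) by linarith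
  also have "\<dots> = 8091 * m ^ 5"
  proof -
    have "m ^ 5 = m * m * m * (m * m)" by (simp add: eval_nat_numeral mult_ac)
    then show ?thesis by (simp add: algebra_simps)
  qed
  finally have "real verify_time \<le> real (8091 * m ^ 5)" unfolding of_nat_le_iff .
  then show ?thesis by simp
qed

text \<open>Since \<open>stride \<le> n\<close>, the factor 2 absorbs the additional window.\<close>

lemma window_count_le: "m < n \<Longrightarrow> window_count n \<le> n" "m < n \<Longrightarrow> real (window_count n) \<le> 2 * real n / real stride"
proof -
  assume mn: "m < n"
  have "(n - wlen) div stride \<le> n - wlen" by (rule div_le_dividend)
  moreover have "1 \<le> wlen" "wlen \<le> n" using mn k by (auto simp: wlen_def)
  ultimately show "window_count n \<le> n" unfolding window_count_def by linarith
  have s: "1 \<le> stride" "stride \<le> n" using mn k by (auto simp: stride_def wlen_def)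
  have "real ((n - wlen) div stride) \<le> real (n - wlen) / real stride" by (rule of_nat_div_le_of_nat)
  also have "\<dots> \<le> real n / real stride" using s by (intro divide_right_mono) auto
  finally have "real (window_count n) \<le> real n / real stride + 1" by (simp add: window_count_def)
  moreover have "1 \<le> real n / real stride" using s by simp
  ultimately show "real (window_count n) \<le> 2 * real n / real stride" by simp
qed

end

section \<open>Choice of the constants\<close>

lemma log_below_linear:
  fixes a b d :: real
  assumes "a > 0" "b > 0" "d > 0"
  shows "eventually (\<lambda>m::nat. b * (a * ln (real m) + 1) \<le> d * real m) sequentially"
  using assms by real_asymp

text \<open>Origin of the constant 7: \<open>(1/2 - 7/r) (2 + 12/r) = 1 - 8/r - 84/r^2\<close>. On
  the left, \<open>k\<close> is lost to \<open>wlen = m - k\<close> and \<open>k (1 + 12/r)\<close>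
  to the grams charged to edits; \<open>8 m / r\<close> letters are left over.\<close>

lemma long_pattern_arith:
  fixes r k m :: real
  assumes r: "r > 14" and k: "0 \<le> k" and m: "m > 0" and km: "k / m < 1 / 2 - 7 / r"
  shows "k * (2 + 12 / r) \<le> m * (1 - 8 / r)"
proof -
  have "k \<le> m * (1 / 2 - 7 / r)" using km m by (simp add: field_simps)
  then have "k * (2 + 12 / r) \<le> m * (1 / 2 - 7 / r) * (2 + 12 / r)"
    using r by (intro mult_right_mono) auto
  also have "\<dots> = m * (1 - 8 / r - 84 / r\<^sup>2)"
    using r by (simp add: field_simps power2_eq_square)
  also have "\<dots> \<le> m * (1 - 8 / r)" using m by (intro mult_left_mono) auto
  finally show ?thesis .
qed

text \<open>\<open>C1\<close> serves long patterns, where scans with a stride of at least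
  \<open>4 m / r\<close> dominate; \<open>C2\<close> serves \<open>m < M\<close>, where every window
  may have to be verified.\<close>

lemma average_upper_bound:
  fixes \<sigma> :: nat
  assumes \<sigma>: "sqrt (real \<sigma>) > 14"
  shows "\<exists>K D. 1 \<le> K \<and> D \<le> K \<and> (\<exists>C::real. C > 0 \<and> (\<forall>n m k. \<forall>x \<in> strings \<sigma> m.
     2 \<le> m \<and> m < n \<and> k < m \<and> real k / real m < 1 / 2 - 7 / sqrt (real \<sigma>) \<longrightarrow>
     average_search_time \<sigma> (acsm_algorithm \<sigma> K D) k x n
       \<le> C * (real n * (real k + log (real \<sigma>) (real m)) / real m)))"
proof -
  define r where "r = sqrt (real \<sigma>)"
  have r: "r > 14" using \<sigma> by (simp add: r_def)
  have r2: "r\<^sup>2 = real \<sigma>" by (simp add: r_def)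
  have "real \<sigma> > 14\<^sup>2" unfolding r2[symmetric] using r by (intro power_strict_mono) auto
  then have s2: "2 \<le> \<sigma>" "real \<sigma> > 1" by auto
  \<comment> \<open>An integer approximation of \<open>r\<close> from below, so that
    \<open>K\<close> and \<open>D\<close> are natural numbers. Then \<open>E / K = 6 / h\<close> is
    at least \<open>6 / r\<close>, as \<open>bad_gram_fraction\<close> requires, and
    \<open>D / K = 1 - 6 / h\<close>.\<close>
  define h where "h = nat \<lfloor>r\<rfloor>"
  have h: "real h \<le> r" "r < real h + 1" using r by (auto simp: h_def)
  then have h14: "14 \<le> h" using r by linarith
  \<comment> \<open>With \<open>L\<close> the integer logarithm, the common subsequence has length
    \<open>E * L = 12 \<sigma> L\<close>, and
    \<open>2 ^ (12 \<sigma> L) \<ge> \<sigma> ^ (12 L) \<ge> m ^ 12\<close>.\<close>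
  define B where "B = 2 * \<sigma>"
  define E where "E = 6 * B"
  define K where "K = B * h"
  define D where "D = K - E"
  have B1: "1 \<le> B" using s2 by (simp add: B_def)
  have EK: "E \<le> K" using h14 by (simp add: E_def K_def mult.commute)
  have DB: "D = B * (h - 6)" by (simp add: D_def K_def E_def diff_mult_distrib2 mult.commute)
  have K1: "1 \<le> K" using B1 h14 by (simp add: K_def)
  \<comment> \<open>As \<open>m \<ge> 2\<close>, the logarithm of \<open>m\<close> is at least
    \<open>l0 > 0\<close>, and additive constants can be charged to it.\<close>
  define l0 where "l0 = log (real \<sigma>) 2"
  have l0: "l0 > 0" using s2 by (simp add: l0_def)
  have lns: "ln (real \<sigma>) > 0" using s2 by simp
  have "eventually (\<lambda>m::nat. real K * (1 / ln (real \<sigma>) * ln (real m) + 1) \<le> 4 / r * real m) sequentially"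
    using r lns K1 by (intro log_below_linear) auto
  then obtain M where M: "\<And>m. m \<ge> M \<Longrightarrow> real K * (log (real \<sigma>) (real m) + 1) \<le> 4 * real m / r"
    unfolding eventually_sequentially log_def by auto
  \<comment> \<open>\<open>r / 2\<close> stems from the number of windows, 142 and 71 from the scan
    time per letter, and 10048 from the 48 units per window plus an expected verification time of at
    most 10000.\<close>
  define C1 where "C1 = r / 2 * (142 + 71 * real K + (71 * real K + 10048) / l0) + 20 / l0"
  define C2 where "C2 = (71 * real M + 68 + 10000 * real M ^ 5) * real M / l0"
  have "0 \<le> r / 2 * (142 + 71 * real K + (71 * real K + 10048) / l0)"
    using r l0 by (intro mult_nonneg_nonneg add_nonneg_nonneg divide_nonneg_nonneg) auto
  moreover have "0 < 20 / l0" using l0 by simp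
  ultimately have C1: "C1 > 0" unfolding C1_def by linarith
  have C2: "C2 \<ge> 0"
    unfolding C2_def using l0 by (intro mult_nonneg_nonneg add_nonneg_nonneg divide_nonneg_nonneg) auto
  note C = C1 C2
  have main: "average_search_time \<sigma> (acsm_algorithm \<sigma> K D) k x n
       \<le> (C1 + C2) * (real n * (real k + log (real \<sigma>) (real m)) / real m)"
    if x: "x \<in> strings \<sigma> m" and m2: "2 \<le> m" and mn: "m < n" and km: "k < m"
      and ratio: "real k / real m < 1 / 2 - 7 / sqrt (real \<sigma>)" for n m k x
  proof -
    interpret acsm \<sigma> K D k m x
      using s2 K1 km x by unfold_locales (auto simp: D_def)
    let ?l = "log (real \<sigma>) (real m)"
    let ?L = "gram_exp \<sigma> m"
    have l: "l0 \<le> ?l" unfolding l0_def using m2 s2 by simp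
    have one: "1 \<le> ?l / l0" using l l0 by simp
    have nm: "1 \<le> real n / real m" using mn km by simp
    have posm: "real m > 0" using m2 by simp
    let ?A = "average_search_time \<sigma> (acsm_algorithm \<sigma> K D) k x n"
    have nmkl: "0 \<le> real n / real m * (real k + ?l)" using l l0 by (intro mult_nonneg_nonneg) auto
    show ?thesis
    proof (cases "m \<ge> M")
      case True
      have L: "real ?L \<le> ?l + 1"
      proof -
        have "real \<sigma> ^ (?L - 1) * real \<sigma> = real (\<sigma> ^ ?L)"
          using gram_exp_m(1) by (simp flip: power_Suc2)
        also have "\<dots> \<le> real (\<sigma> * m)" unfolding of_nat_le_iff by (rule gram_exp_m)
        finally have "real \<sigma> ^ (?L - 1) \<le> real m" using s2 by simp
        then have "real (?L - 1) \<le> ?l" using s2 by (intro le_log_of_power) auto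
        then show ?thesis using gram_exp_m(1) by simp
      qed
      have gl: "real glen \<le> real K * (?l + 1)"
        unfolding glen_def of_nat_mult using L by (intro mult_left_mono) auto
      then have gm: "real glen \<le> 4 * real m / r" using M[OF True] by linarith
      let ?q = "k div (tau + 1) + 1"
      have gt: "real glen * (real h - 6) = real tau * real h"
        unfolding glen_def tau_def using h14 by (simp add: K_def DB of_nat_diff)
      have h6: "real h - 6 > 0" "real h - 6 \<ge> r / 2" using h h14 r by linarith+
      \<comment> \<open>A gram of \<open>glen\<close> letters accounts for \<open>tau + 1\<close>
        edits; this quotient is the number of letters spent per edit. It is at most
        \<open>h / (h - 6)\<close>, and \<open>h - 6 \<ge> r / 2\<close>.\<close>
      have frac: "real glen / real (tau + 1) \<le> 1 + 12 / r"
      proof -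
        have "real glen * (real h - 6) \<le> real (tau + 1) * real h" unfolding gt by (intro mult_right_mono) auto
        then have "real glen / real (tau + 1) \<le> real h / (real h - 6)"
          using h6(1) by (simp add: field_simps)
        also have "\<dots> = 1 + 6 / (real h - 6)" using h6(1) by (simp add: field_simps)
        also have "6 / (real h - 6) \<le> 6 / (r / 2)" using h6(2) r by (intro divide_left_mono) auto
        finally show ?thesis by simp
      qed
      have qg: "real (?q * glen) \<le> real k * (1 + 12 / r) + real glen"
      proof -
        have "real (k div (tau + 1)) \<le> real k / real (tau + 1)" by (rule of_nat_div_le_of_nat)
        then have "real (k div (tau + 1)) * real glen \<le> real k / real (tau + 1) * real glen"
          by (rule mult_right_mono) simp
        also have "\<dots> = real k * (real glen / real (tau + 1))" by simp
        also have "\<dots> \<le> real k * (1 + 12 / r)" using frac by (rule mult_left_mono) simp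
        finally show ?thesis by (simp add: algebra_simps)
      qed
      have ka: "real k * (2 + 12 / r) \<le> real m * (1 - 8 / r)"
        using ratio r posm by (intro long_pattern_arith) (auto simp: r_def)
      \<comment> \<open>Of the \<open>8 m / r\<close> letters left over, the gram added by rounding
        up takes at most half; the rest remains for the stride.\<close>
      have room: "real (?q * glen) + 4 * real m / r \<le> real wlen"
      proof -
        have "a + real glen + 4 * z \<le> real wlen"
          if "a = real k * (1 + 12 / r)" "z = real m / r" for a z
        proof -
          have "a + real k \<le> real m - 8 * z" using ka unfolding that by (simp add: algebra_simps)
          moreover have "real wlen = real m - real k" using km by (simp add: wlen_def)
          moreover have "real glen \<le> 4 * z" using gm unfolding that by simp
          ultimately show ?thesis by linarith
        qed
        from this[OF refl refl] have "real k * (1 + 12 / r) + real glen + 4 * (real m / r) \<le> real wlen" .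
        moreover have "4 * (real m / r) = 4 * real m / r" by simp
        ultimately show ?thesis using qg by (metis add_right_mono order_trans)
      qed
      have mr: "4 * real m / r > 0" using posm r by simp
      then have "real (?q * glen) \<le> real wlen" using room by linarith
      then have "\<not> wlen < ?q * glen" by (simp only: of_nat_le_iff not_less)
      then have al: "always = 0" and gr: "grams = ?q" by (simp_all add: always_def grams_def)
      have st: "4 * real m / r \<le> real stride"
      proof -
        have "real stride = real wlen - real (grams * glen) + 1"
          unfolding stride_def using scan_length by (simp only: of_nat_add of_nat_diff of_nat_1)
        moreover have "real (grams * glen) + 4 * real m / r \<le> real wlen" using room unfolding gr .
        ultimately show ?thesis by linarith
      qed
      define e where "e = E * ?L"
      have e: "0 < e" "e \<le> glen" "tau = glen - e"
        unfolding e_def glen_def tau_def using B1 gram_exp_m(1) EK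
        by (auto simp: E_def D_def diff_mult_distrib)
      have small: "36 * real glen ^ 2 \<le> real e ^ 2 * real \<sigma>"
      proof -
        have "real h ^ 2 \<le> r ^ 2" using h(1) by (intro power_mono) auto
        then have "36 * (real B * real ?L) ^ 2 * real h ^ 2 \<le> 36 * (real B * real ?L) ^ 2 * real \<sigma>"
          unfolding r2 by (intro mult_left_mono) auto
        then show ?thesis unfolding glen_def e_def by (simp add: K_def E_def power_mult_distrib mult_ac)
      qed
      have m12: "real m ^ 12 \<le> 2 ^ e"
      proof -
        have "m ^ 12 \<le> (\<sigma> ^ ?L) ^ 12" using gram_exp_m(2) by (rule power_mono) simp
        also have "\<dots> = \<sigma> ^ (12 * ?L)" by (simp add: mult.commute flip: power_mult)
        also have "\<dots> \<le> (2 ^ \<sigma>) ^ (12 * ?L)" by (intro power_mono) (simp_all add: less_imp_le)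
        also have "\<dots> = 2 ^ e" by (simp add: e_def E_def B_def mult_ac flip: power_mult)
        finally have "real (m ^ 12) \<le> real (2 ^ e)" unfolding of_nat_le_iff .
        then show ?thesis by simp
      qed
      have q_m: "real grams \<le> real m"
      proof -
        have "k div (tau + 1) \<le> k" by (rule div_le_dividend)
        then have "grams \<le> m" unfolding gr using km by linarith
        then show ?thesis by simp
      qed
      define \<beta> where "\<beta> = real grams * (real m / 2 ^ e)"
      \<comment> \<open>At most \<open>m\<close> grams, each bad with probability at most
        \<open>m / m ^ 12\<close>, against a verification time of order
        \<open>m ^ 5\<close>.\<close>
      have ver: "real verify_time * \<beta> \<le> 10000"
      proof -
        have "\<beta> \<le> real m * (real m / real m ^ 12)"
          unfolding \<beta>_def using q_m m12 posm by (intro mult_mono divide_left_mono) auto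
        also have "\<dots> = 1 / real m ^ 10"
        proof -
          have "real m ^ 12 = real m ^ 10 * (real m * real m)"
            by (simp flip: power_add power2_eq_square)
          then show ?thesis using posm by simp
        qed
        also have "\<dots> \<le> 1 / real m ^ 5"
          using m2 posm by (intro divide_left_mono power_increasing) auto
        finally have "real verify_time * \<beta> \<le> 10000 * real m ^ 5 * (1 / real m ^ 5)"
          using verify_time_le by (intro mult_mono) (auto simp: \<beta>_def)
        then show ?thesis using posm by simp
      qed
      have "?A \<le> real (window_count n) * (71 * real (grams * glen) + 48 + real verify_time * \<beta>) + 20"
        using prob_bad[OF al e small] unfolding \<beta>_def by (intro average_bound[OF mn]) auto
      also have "\<dots> \<le> (2 * real n / (4 * real m / r)) * (142 * real k + 71 * (real K * (?l + 1)) + 10048) + 20"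
      proof (intro add_right_mono mult_mono)
        have "real (window_count n) \<le> 2 * real n / real stride" by (rule window_count_le[OF mn])
        also have "\<dots> \<le> 2 * real n / (4 * real m / r)" using st mr by (intro frac_le) auto
        finally show "real (window_count n) \<le> 2 * real n / (4 * real m / r)" .
        have "12 / r \<le> 1" using r by simp
        then have "real k * (1 + 12 / r) \<le> real k * 2" by (intro mult_left_mono) auto
        then have "real (grams * glen) \<le> 2 * real k + real K * (?l + 1)" unfolding gr using qg gl by linarith
        then show "71 * real (grams * glen) + 48 + real verify_time * \<beta> \<le> 142 * real k + 71 * (real K * (?l + 1)) + 10048"
          using ver by linarith
      qed (use r in \<open>auto simp: \<beta>_def\<close>)
      also have "\<dots> = real n / real m * (r / 2 * (142 * real k + 71 * real K * ?l + (71 * real K + 10048) * 1)) + 20 * 1"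
        using r posm by (simp add: field_simps)
      also have "\<dots> \<le> real n / real m * (r / 2 * (142 * real k + 71 * real K * ?l + (71 * real K + 10048) * (?l / l0)))
          + real n / real m * (20 * (?l / l0))"
      proof (intro add_mono mult_left_mono order_refl)
        have "1 * 1 \<le> real n / real m * (?l / l0)" using nm one by (intro mult_mono) auto
        then have "20 * (1 * 1) \<le> 20 * (real n / real m * (?l / l0))" by (intro mult_left_mono) auto
        also have "\<dots> = real n / real m * (20 * (?l / l0))" by (rule mult.left_commute)
        finally show "20 * 1 \<le> real n / real m * (20 * (?l / l0))" by (simp only: mult_1_right)
      qed (use one r in auto)
      also have "\<dots> = real n / real m * (r / 2 * (142 * real k + 71 * real K * ?l + (71 * real K + 10048) * (?l / l0)) + 20 * (?l / l0))"
        by (simp add: algebra_simps)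
      also have "\<dots> \<le> real n / real m * (C1 * (real k + ?l))"
      proof (rule mult_left_mono)
        have a: "142 * real k + 71 * real K * ?l + (71 * real K + 10048) * (?l / l0) \<le>
            (142 + 71 * real K + (71 * real K + 10048) / l0) * (real k + ?l)"
        proof -
          have "142 * a + P * b + S * b \<le> (142 + P + S) * (a + b)"
            if "0 \<le> a" "0 \<le> b" "0 \<le> P" "0 \<le> S" for a b P S :: real
            using that by (simp add: algebra_simps)
          from this[of "real k" ?l "71 * real K" "(71 * real K + 10048) / l0"]
          show ?thesis using l l0 by simp
        qed
        have b: "20 * (?l / l0) \<le> 20 / l0 * (real k + ?l)" using l0 by (simp add: field_simps)
        have "r / 2 * (142 * real k + 71 * real K * ?l + (71 * real K + 10048) * (?l / l0)) \<le>
            r / 2 * ((142 + 71 * real K + (71 * real K + 10048) / l0) * (real k + ?l))"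
          using a r by (intro mult_left_mono) auto
        then show "r / 2 * (142 * real k + 71 * real K * ?l + (71 * real K + 10048) * (?l / l0)) + 20 * (?l / l0) \<le> C1 * (real k + ?l)"
          using b unfolding C1_def by (simp only: distrib_right mult.assoc)
      qed simp
      also have "\<dots> = C1 * (real n / real m * (real k + ?l))" by simp
      also have "\<dots> \<le> (C1 + C2) * (real n / real m * (real k + ?l))" using C nmkl by (intro mult_right_mono) auto
      finally show ?thesis by simp
    next
      case False
      \<comment> \<open>The trivial probability bound 1 suffices: for \<open>m < M\<close> the cost
        of a window is bounded in terms of \<open>M\<close>, and there are at most \<open>n\<close>
        windows.\<close>
      have "?A \<le> real (window_count n) * (71 * real (grams * glen) + 48 + real verify_time * 1) + 20"
        by (intro average_bound[OF mn]) simp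
      also have "\<dots> \<le> real n * (71 * real M + 48 + 10000 * real M ^ 5 * 1) + 20 * real n"
      proof (intro add_mono mult_mono order_refl)
        show "real (window_count n) \<le> real n" using window_count_le(1)[OF mn] by simp
        have "grams * glen \<le> M" using scan_length False by (simp add: wlen_def)
        then show "real (grams * glen) \<le> real M" unfolding of_nat_le_iff .
        have "real m ^ 5 \<le> real M ^ 5" using False by (intro power_mono) auto
        then show "real verify_time \<le> 10000 * real M ^ 5" using verify_time_le by linarith
        show "20 \<le> 20 * real n" using mn by simp
      qed auto
      also have "\<dots> = (71 * real M + 68 + 10000 * real M ^ 5) * (real n * 1)" by (simp add: algebra_simps)
      also have "\<dots> \<le> (71 * real M + 68 + 10000 * real M ^ 5) * (real n / real m * (real M * ((real k + ?l) / l0)))"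
      proof (intro mult_left_mono)
        have "1 \<le> (real k + ?l) / l0" using l l0 by (simp add: field_simps)
        then have "real m * 1 \<le> real M * ((real k + ?l) / l0)" using False by (intro mult_mono) auto
        then have "real n / real m * (real m * 1) \<le> real n / real m * (real M * ((real k + ?l) / l0))"
          by (intro mult_left_mono) auto
        then show "real n * 1 \<le> real n / real m * (real M * ((real k + ?l) / l0))" using posm by simp
      qed auto
      also have "\<dots> = C2 * (real n / real m * (real k + ?l))" by (simp add: C2_def ac_simps)
      also have "\<dots> \<le> (C1 + C2) * (real n / real m * (real k + ?l))" using C nmkl by (intro mult_right_mono) auto
      finally show ?thesis by simp
    qed
  qed
  show ?thesis
    using K1 C main by (intro exI[of _ K] exI[of _ D] conjI exI[of _ "C1 + C2"]) (auto simp: D_def)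
qed

theorem theorem2:
  shows "\<exists>c::real. c > 0 \<and> (\<forall>\<sigma>::nat. \<sigma> \<ge> 2 \<longrightarrow>
    (\<exists>A. solves_ACSM \<sigma> A \<and>
      (\<exists>C::real. C > 0 \<and> (\<forall>n m k. \<forall>x \<in> strings \<sigma> m.
         2 \<le> m \<and> m < n \<and> k < m \<and> real k / real m < 1 / 2 - c / sqrt (real \<sigma>) \<longrightarrow>
         average_search_time \<sigma> A k x n
           \<le> C * (real n * (real k + log (real \<sigma>) (real m)) / real m)))) \<and>
    (\<exists>C'::real. C' > 0 \<and> (\<forall>A. solves_ACSM \<sigma> A \<longrightarrow>
      (\<forall>n m k. 1 \<le> m \<and> m < n \<and> k < m \<and> real k / real m < 1 / 2 - c / sqrt (real \<sigma>) \<longrightarrow>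
         (\<exists>x \<in> strings \<sigma> m.
            average_search_time \<sigma> A k x n
              \<ge> C' * (real n * (real k + log (real \<sigma>) (real m)) / real m))))))"
\<comment> \<open>7 is the constant of \<open>long_pattern_arith\<close>; the lower bound draws
  \<open>2 * k < m\<close> from the same ratio.\<close>
proof (rule exI[of _ 7], intro conjI allI impI)
  fix \<sigma> :: nat assume \<sigma>: "\<sigma> \<ge> 2"
  show "\<exists>A. solves_ACSM \<sigma> A \<and>
      (\<exists>C::real. C > 0 \<and> (\<forall>n m k. \<forall>x \<in> strings \<sigma> m.
         2 \<le> m \<and> m < n \<and> k < m \<and> real k / real m < 1 / 2 - 7 / sqrt (real \<sigma>) \<longrightarrow>
         average_search_time \<sigma> A k x n
           \<le> C * (real n * (real k + log (real \<sigma>) (real m)) / real m)))"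
  proof (cases "sqrt (real \<sigma>) > 14")
    case True
    then show ?thesis
      using average_upper_bound acsm_algorithm_solves[OF \<sigma>] by blast
  next
    case False
    \<comment> \<open>For \<open>sqrt \<sigma> \<le> 14\<close> the bound on the ratio is at most 0,
      so no \<open>k\<close> satisfies it and any correct algorithm will do.\<close>
    have "\<not> real k / real m < 1 / 2 - 7 / sqrt (real \<sigma>)" for k m :: nat
    proof -
      have "1 / 2 \<le> 7 / sqrt (real \<sigma>)" using False \<sigma> by (simp add: field_simps)
      moreover have "0 \<le> real k / real m" by simp
      ultimately show ?thesis by linarith
    qed
    then show ?thesis
      using acsm_algorithm_solves[OF \<sigma>, of 1 0]
      by (intro exI[of _ "acsm_algorithm \<sigma> 1 0"] conjI exI[of _ 1]) auto
  qed
  obtain C' :: real where C': "C' > 0" "\<And>A n m k. solves_ACSM \<sigma> A \<Longrightarrow> 1 \<le> m \<and> m < n \<and> 2 * k < m \<Longrightarrow>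
      \<exists>x \<in> strings \<sigma> m. average_search_time \<sigma> A k x n
        \<ge> C' * (real n * (real k + log (real \<sigma>) (real m)) / real m)"
    using average_lower_bound[OF \<sigma>] by blast
  have "2 * k < m" if "real k / real m < 1 / 2 - 7 / sqrt (real \<sigma>)" "1 \<le> m" for k m :: nat
  proof -
    have "0 \<le> 7 / sqrt (real \<sigma>)" by simp
    then have "real k / real m < 1 / 2" using that(1) by linarith
    then have "real (2 * k) < real m" using that(2) by (simp add: field_simps)
    then show ?thesis unfolding of_nat_less_iff .
  qed
  then show "\<exists>C'::real. C' > 0 \<and> (\<forall>A. solves_ACSM \<sigma> A \<longrightarrow>
      (\<forall>n m k. 1 \<le> m \<and> m < n \<and> k < m \<and> real k / real m < 1 / 2 - 7 / sqrt (real \<sigma>) \<longrightarrow>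
         (\<exists>x \<in> strings \<sigma> m.
            average_search_time \<sigma> A k x n
              \<ge> C' * (real n * (real k + log (real \<sigma>) (real m)) / real m))))"
    using C' by (intro exI[of _ C'] conjI allI impI) auto
qed simp

end
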